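(* Let $N\ge2$ be an integer, let $F_N=F(a_1,\dots,a_N)$ be the free group with free basis $A=\{a_1,\dots,a_N\}$, and let \[ \rho_N:=\inf_{\phi\in\mathrm{Out}(F_N)}\frac{\lambda_A(\phi)}{\Lambda_A(\phi)} . \] Then $\rho_N>0$.
   Context: For $w\in F_N$, $\|w\|_A$ denotes the cyclically reduced length of $w$ over $A^{\pm1}$. It depends only on the conjugacy class of $w$, so $\|\phi(w)\|_A$ is well defined for $\phi\in\mathrm{Out}(F_N)$. The extremal stretching factor of $\phi\in\mathrm{Out}(F_N)$ with respect to $A$ is $\Lambda_A(\phi)=\sup_{w\in F_N\smallsetminus\{1\}}\frac{\|\phi(w)\|_A}{\|w\|_A}$. Consider the simple non-backtracking random walk on $F_N$ with respect to $A$. Its trajectories are semi-infinite freely reduced words $y_1y_2y_3\dots$ over $A^{\pm1}$, the first letter is uniform on $A^{\pm1}$, and each letter $x$ is followed by each $y\ne x^{-1}$ in $A^{\pm1}$ with probability $1/(2N-1)$. The generic stretching factor $\lambda_A(\phi)$ of $\phi$ with respect to $A$ is the number (which is known to exist) such that for a.e. trajectory $y_1y_2\dots$ one has $\lambda_A(\phi)=\lim_{n\to\infty}\frac{\|\phi(y_1\dots y_n)\|_A}{n}=\lim_{n\to\infty}\frac{\|\phi(y_1\dots y_n)\|_A}{\|y_1\dots y_n\|_A}$. *)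

theory Defs
  imports "HOL-Algebra.Bij" "HOL-Algebra.Coset" "HOL-Probability.Probability"
begin

section \<open>Free groups as groups of freely reduced words\<close>

text \<open>The letter \<^term>\<open>(i, True)\<close> stands for the basis element number \<open>i + 1\<close>, and
  \<^term>\<open>(i, False)\<close> for its inverse.\<close>

type_synonym letter = "nat \<times> bool"
type_synonym word = "letter list"

definition letters :: "nat \<Rightarrow> letter set" where
  "letters N = {..<N} \<times> UNIV"

definition inv_letter :: "letter \<Rightarrow> letter" where
  "inv_letter x = (fst x, \<not> snd x)"

definition inv_word :: "word \<Rightarrow> word" where
  "inv_word w = rev (map inv_letter w)"

fun reduced :: "word \<Rightarrow> bool" where
  "reduced (x # y # w) \<longleftrightarrow> y \<noteq> inv_letter x \<and> reduced (y # w)"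
| "reduced _ \<longleftrightarrow> True"

text \<open>Left multiplication of a reduced word by a letter, followed by free reduction.\<close>

fun cancel_Cons :: "letter \<Rightarrow> word \<Rightarrow> word" where
  "cancel_Cons x [] = [x]"
| "cancel_Cons x (y # w) = (if y = inv_letter x then w else x # y # w)"

definition free_reduce :: "word \<Rightarrow> word" where
  "free_reduce w = foldr cancel_Cons w []"

definition free_group :: "nat \<Rightarrow> word monoid" where
  "free_group N =
    \<lparr>carrier = {w. reduced w \<and> set w \<subseteq> letters N},
     monoid.mult = (\<lambda>u v. free_reduce (u @ v)),
     one = []\<rparr>"

lemma inv_letter_inv_letter [simp]: "inv_letter (inv_letter x) = x"
  by (simp add: inv_letter_def)

lemma inv_letter_neq [simp]: "inv_letter x \<noteq> x" "x \<noteq> inv_letter x"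
  by (auto simp: inv_letter_def prod_eq_iff)

lemma inv_letter_eq_iff [simp]: "inv_letter x = inv_letter y \<longleftrightarrow> x = y"
  by (metis inv_letter_inv_letter)

lemma inv_letter_in_letters [simp]: "inv_letter x \<in> letters N \<longleftrightarrow> x \<in> letters N"
  by (auto simp: letters_def inv_letter_def mem_Times_iff)

lemma reduced_Cons: "reduced (x # w) \<longleftrightarrow> reduced w \<and> (w \<noteq> [] \<longrightarrow> hd w \<noteq> inv_letter x)"
  by (cases w) auto

lemma reduced_cancel_Cons: "reduced w \<Longrightarrow> reduced (cancel_Cons x w)"
  by (cases w) (auto simp: reduced_Cons)

lemma cancel_Cons_inverse:
  "reduced w \<Longrightarrow> cancel_Cons (inv_letter x) (cancel_Cons x w) = w"
  by (cases w; cases "tl w") (auto simp: reduced_Cons)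

lemma cancel_Cons_inverse':
  "reduced w \<Longrightarrow> cancel_Cons x (cancel_Cons (inv_letter x) w) = w"
  using cancel_Cons_inverse[of w "inv_letter x"] by simp

lemma reduced_foldr_cancel: "reduced w \<Longrightarrow> reduced (foldr cancel_Cons u w)"
  by (induction u) (auto simp: reduced_cancel_Cons)

lemma reduced_free_reduce [simp]: "reduced (free_reduce w)"
  by (simp add: free_reduce_def reduced_foldr_cancel)

lemma free_reduce_id: "reduced w \<Longrightarrow> free_reduce w = w"
proof (induction w)
  case (Cons x w)
  then show ?case by (cases w) (auto simp: free_reduce_def)
qed (simp add: free_reduce_def)

lemma foldr_cancel_cancel_Cons:
  "reduced u \<Longrightarrow> reduced w \<Longrightarrow>
    foldr cancel_Cons (cancel_Cons x u) w = cancel_Cons x (foldr cancel_Cons u w)"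
  by (cases u) (auto simp: cancel_Cons_inverse' reduced_foldr_cancel)

lemma foldr_cancel_free_reduce:
  "reduced w \<Longrightarrow> foldr cancel_Cons (free_reduce u) w = foldr cancel_Cons u w"
proof (induction u)
  case (Cons x u)
  have "free_reduce (x # u) = cancel_Cons x (free_reduce u)"
    by (simp add: free_reduce_def)
  with Cons show ?case by (simp add: foldr_cancel_cancel_Cons)
qed (simp add: free_reduce_def)

lemma free_reduce_append: "free_reduce (u @ v) = foldr cancel_Cons u (free_reduce v)"
  by (simp add: free_reduce_def)

lemma free_reduce_append_left: "free_reduce (free_reduce u @ v) = free_reduce (u @ v)"
  by (simp add: free_reduce_append foldr_cancel_free_reduce)

lemma free_reduce_append_right: "free_reduce (u @ free_reduce v) = free_reduce (u @ v)"
  by (simp add: free_reduce_append free_reduce_id)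

lemma set_cancel_Cons: "set (cancel_Cons x w) \<subseteq> insert x (set w)"
  by (cases w) auto

lemma set_free_reduce: "set (free_reduce w) \<subseteq> set w"
proof (induction w)
  case (Cons x w)
  have "free_reduce (x # w) = cancel_Cons x (free_reduce w)" by (simp add: free_reduce_def)
  with Cons set_cancel_Cons[of x "free_reduce w"] show ?case by auto
qed (simp add: free_reduce_def)

lemma inv_word_Nil [simp]: "inv_word [] = []"
  and inv_word_Cons: "inv_word (x # w) = inv_word w @ [inv_letter x]"
  and inv_word_snoc: "inv_word (w @ [x]) = inv_letter x # inv_word w"
  by (simp_all add: inv_word_def)

lemma set_inv_word: "set (inv_word w) \<subseteq> letters N \<longleftrightarrow> set w \<subseteq> letters N"
proof
  assume *: "set (inv_word w) \<subseteq> letters N"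
  show "set w \<subseteq> letters N"
  proof
    fix x assume "x \<in> set w"
    then have "inv_letter x \<in> letters N" using * by (auto simp: inv_word_def)
    then show "x \<in> letters N" by simp
  qed
qed (auto simp: inv_word_def subset_iff)

lemma foldr_cancel_inv_word:
  "reduced v \<Longrightarrow> foldr cancel_Cons (inv_word w) (foldr cancel_Cons w v) = v"
  by (induction w arbitrary: v)
    (auto simp: inv_word_Cons cancel_Cons_inverse reduced_foldr_cancel)

lemma free_reduce_inv_word: "free_reduce (inv_word w @ w) = []"
  using foldr_cancel_inv_word[of "[]" w] by (simp add: free_reduce_def)

theorem group_free_group: "group (free_group N)"
proof (rule groupI)
  fix x assume x: "x \<in> carrier (free_group N)"
  have "free_reduce (inv_word x) \<otimes>\<^bsub>free_group N\<^esub> x = \<one>\<^bsub>free_group N\<^esub>"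
    by (simp add: free_group_def free_reduce_append_left free_reduce_inv_word)
  moreover have "free_reduce (inv_word x) \<in> carrier (free_group N)"
    using x set_free_reduce[of "inv_word x"] set_inv_word[of x N] by (auto simp: free_group_def)
  ultimately show "\<exists>y\<in>carrier (free_group N). y \<otimes>\<^bsub>free_group N\<^esub> x = \<one>\<^bsub>free_group N\<^esub>" by blast
next
  fix x y assume "x \<in> carrier (free_group N)" "y \<in> carrier (free_group N)"
  then show "x \<otimes>\<^bsub>free_group N\<^esub> y \<in> carrier (free_group N)"
    using set_free_reduce[of "x @ y"] by (auto simp: free_group_def)
qed (auto simp: free_group_def free_reduce_append_left free_reduce_append_right free_reduce_id)

lemma inv_free_group:
  assumes "w \<in> carrier (free_group N)"
  shows "inv\<^bsub>free_group N\<^esub> w = free_reduce (inv_word w)"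
proof (rule group.inv_equality[OF group_free_group _ assms])
  show "free_reduce (inv_word w) \<otimes>\<^bsub>free_group N\<^esub> w = \<one>\<^bsub>free_group N\<^esub>"
    by (simp add: free_group_def free_reduce_append_left free_reduce_inv_word)
  show "free_reduce (inv_word w) \<in> carrier (free_group N)"
    using assms set_free_reduce[of "inv_word w"] set_inv_word[of w N] by (auto simp: free_group_def)
qed


section \<open>Cyclically reduced length\<close>

text \<open>On a freely reduced word this yields its cyclically reduced form.\<close>

function cyc_reduce :: "word \<Rightarrow> word" where
  "cyc_reduce w =
    (if 2 \<le> length w \<and> last w = inv_letter (hd w) then cyc_reduce (butlast (tl w)) else w)"
  by auto
termination by (relation "Wellfounded.measure length") auto

declare cyc_reduce.simps [simp del]

definition cyc_length :: "word \<Rightarrow> nat" where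
  "cyc_length w = length (cyc_reduce w)"

lemma cyc_length_conj_letter: "cyc_length (x # w @ [inv_letter x]) = cyc_length w"
  by (simp add: cyc_length_def cyc_reduce.simps[of "x # w @ [inv_letter x]"])

lemma reduced_append:
  "reduced (u @ v) \<longleftrightarrow>
    reduced u \<and> reduced v \<and> (u \<noteq> [] \<longrightarrow> v \<noteq> [] \<longrightarrow> hd v \<noteq> inv_letter (last u))"
  by (induction u) (auto simp: reduced_Cons hd_append)

lemma cyc_length_rotate:
  assumes "reduced (x # v)" "reduced (v @ [x])"
  shows "cyc_length (x # v) = cyc_length (v @ [x])"
proof (cases "v = []")
  case False
  have "last v \<noteq> inv_letter x"
    using assms False by (auto simp: reduced_append)
  moreover have "x \<noteq> inv_letter (hd v)"
    using assms False by (auto simp: reduced_Cons)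
  ultimately show ?thesis
    using False
    by (simp add: cyc_length_def cyc_reduce.simps[of "x # v"] cyc_reduce.simps[of "v @ [x]"])
qed simp

lemma free_reduce_snoc_inv:
  assumes "reduced w" "w \<noteq> []" "last w = x"
  shows "free_reduce (w @ [inv_letter x]) = butlast w"
proof -
  have w: "w = butlast w @ [x]" using assms by (metis append_butlast_last_id)
  then have "reduced (butlast w)" using assms(1) by (metis reduced_append)
  moreover have "free_reduce ((butlast w @ [x]) @ [inv_letter x]) = free_reduce (butlast w)"
    by (simp add: free_reduce_def)
  ultimately show ?thesis using w by (simp add: free_reduce_id)
qed

lemma cyc_length_conj_step:
  assumes w: "reduced w"
  shows "cyc_length (free_reduce (x # w @ [inv_letter x])) = cyc_length w"
proof (cases "w = []")
  case True
  then show ?thesis by (simp add: free_reduce_def)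
next
  case False
  have step: "free_reduce (x # u) = cancel_Cons x (free_reduce u)" for u
    by (simp add: free_reduce_def)
  show ?thesis
  proof (cases "last w = x")
    case lx: True
    note E = free_reduce_snoc_inv[OF w False lx]
    obtain v where v: "w = v @ [x]" using lx False by (metis append_butlast_last_id)
    show ?thesis
    proof (cases "hd w = inv_letter x")
      case True
      then obtain v' where "v = inv_letter x # v'" using v by (cases v) auto
      then show ?thesis
        using v E step cyc_length_conj_letter[of "inv_letter x" v'] by simp
    next
      case hx: False
      then have "cancel_Cons x v = x # v" using v by (cases v) auto
      moreover have "reduced (x # v)"
        using w v hx by (cases v) (auto simp: reduced_append reduced_Cons)
      ultimately show ?thesis
        using v E step w cyc_length_rotate[of x v] by simp
    qed
  next
    case lx: False
    then have red: "reduced (w @ [inv_letter x])" using w False by (auto simp: reduced_append)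
    then have E: "free_reduce (x # w @ [inv_letter x]) = cancel_Cons x (w @ [inv_letter x])"
      by (simp add: step free_reduce_id)
    show ?thesis
    proof (cases "hd w = inv_letter x")
      case True
      then obtain v where "w = inv_letter x # v" using False by (cases w) auto
      moreover from this red have "reduced (v @ [inv_letter x])" by (auto simp: reduced_Cons)
      ultimately show ?thesis using E w cyc_length_rotate[of "inv_letter x" v] by simp
    next
      case hx: False
      then show ?thesis using E cyc_length_conj_letter[of x w] False by (cases w) auto
    qed
  qed
qed

lemma cyc_length_conj_word:
  "reduced w \<Longrightarrow> cyc_length (free_reduce (g @ w @ inv_word g)) = cyc_length w"
proof (induction g)
  case (Cons x g)
  have "free_reduce ((x # g) @ w @ inv_word (x # g)) =
        free_reduce ([x] @ free_reduce ((g @ w @ inv_word g) @ [inv_letter x]))"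
    unfolding free_reduce_append_right by (simp add: inv_word_Cons)
  also have "free_reduce ((g @ w @ inv_word g) @ [inv_letter x]) =
        free_reduce (free_reduce (g @ w @ inv_word g) @ [inv_letter x])"
    by (simp only: free_reduce_append_left)
  finally have "free_reduce ((x # g) @ w @ inv_word (x # g)) =
        free_reduce (x # free_reduce (g @ w @ inv_word g) @ [inv_letter x])"
    unfolding free_reduce_append_right by simp
  then show ?case using Cons cyc_length_conj_step by simp
qed (simp add: free_reduce_id)

theorem cyc_length_conj:
  assumes "g \<in> carrier (free_group N)" "w \<in> carrier (free_group N)"
  shows "cyc_length (g \<otimes>\<^bsub>free_group N\<^esub> w \<otimes>\<^bsub>free_group N\<^esub> inv\<^bsub>free_group N\<^esub> g) = cyc_length w"
proof -
  have "g \<otimes>\<^bsub>free_group N\<^esub> w \<otimes>\<^bsub>free_group N\<^esub> inv\<^bsub>free_group N\<^esub> g = free_reduce (g @ w @ inv_word g)"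
    unfolding inv_free_group[OF assms(1)]
    using free_reduce_append_right[of "g @ w" "inv_word g"]
    by (simp add: free_group_def free_reduce_append_left)
  then show ?thesis using assms cyc_length_conj_word by (simp add: free_group_def)
qed


section \<open>Outer automorphisms\<close>

definition Inn :: "('a, 'b) monoid_scheme \<Rightarrow> ('a \<Rightarrow> 'a) set" where
  "Inn G = (\<lambda>g. \<lambda>x\<in>carrier G. g \<otimes>\<^bsub>G\<^esub> x \<otimes>\<^bsub>G\<^esub> inv\<^bsub>G\<^esub> g) ` carrier G"

definition Out :: "('a, 'b) monoid_scheme \<Rightarrow> ('a \<Rightarrow> 'a) set monoid" where
  "Out G = AutoGroup G Mod Inn G"

text \<open>An outer automorphism is a coset \<open>\<Phi>\<close> of automorphisms.  All members of \<open>\<Phi>\<close> give the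
  image of \<open>w\<close> the same cyclically reduced length, see \<open>outer_length_eq\<close> below.\<close>

definition outer_length :: "(word \<Rightarrow> word) set \<Rightarrow> word \<Rightarrow> nat" where
  "outer_length \<Phi> w = (THE n. \<forall>f\<in>\<Phi>. cyc_length (f w) = n)"

lemma conj_comp:
  assumes "group G" "g \<in> carrier G" "h \<in> carrier G" "x \<in> carrier G"
  shows "(g \<otimes>\<^bsub>G\<^esub> h) \<otimes>\<^bsub>G\<^esub> x \<otimes>\<^bsub>G\<^esub> inv\<^bsub>G\<^esub> (g \<otimes>\<^bsub>G\<^esub> h) = g \<otimes>\<^bsub>G\<^esub> (h \<otimes>\<^bsub>G\<^esub> x \<otimes>\<^bsub>G\<^esub> inv\<^bsub>G\<^esub> h) \<otimes>\<^bsub>G\<^esub> inv\<^bsub>G\<^esub> g"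
proof -
  interpret group G by fact
  show ?thesis using assms by (simp add: inv_mult_group m_assoc)
qed

lemma Inn_subset_auto:
  assumes "group G" shows "Inn G \<subseteq> auto G"
proof
  interpret group G by fact
  fix f assume "f \<in> Inn G"
  then obtain g where g: "g \<in> carrier G"
    and f: "f = (\<lambda>x\<in>carrier G. g \<otimes>\<^bsub>G\<^esub> x \<otimes>\<^bsub>G\<^esub> inv\<^bsub>G\<^esub> g)" by (auto simp: Inn_def)
  have eq: "g \<otimes>\<^bsub>G\<^esub> (inv\<^bsub>G\<^esub> g \<otimes>\<^bsub>G\<^esub> x \<otimes>\<^bsub>G\<^esub> g) \<otimes>\<^bsub>G\<^esub> inv\<^bsub>G\<^esub> g = x"
      "inv\<^bsub>G\<^esub> g \<otimes>\<^bsub>G\<^esub> (g \<otimes>\<^bsub>G\<^esub> x \<otimes>\<^bsub>G\<^esub> inv\<^bsub>G\<^esub> g) \<otimes>\<^bsub>G\<^esub> g = x" if "x \<in> carrier G" for x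
    using conj_comp[OF assms g inv_closed[OF g] that] conj_comp[OF assms inv_closed[OF g] g that] g that
    by simp_all
  have "bij_betw f (carrier G) (carrier G)"
    by (rule bij_betw_byWitness[where f' = "\<lambda>x. inv\<^bsub>G\<^esub> g \<otimes>\<^bsub>G\<^esub> x \<otimes>\<^bsub>G\<^esub> g"]) (use g eq f in auto)
  moreover have "f \<in> hom G G"
  proof (rule homI)
    fix x y assume xy: "x \<in> carrier G" "y \<in> carrier G"
    have "inv\<^bsub>G\<^esub> g \<otimes>\<^bsub>G\<^esub> (g \<otimes>\<^bsub>G\<^esub> z) = z" if "z \<in> carrier G" for z
      using g that by (simp add: m_assoc[symmetric])
    then show "f (x \<otimes>\<^bsub>G\<^esub> y) = f x \<otimes>\<^bsub>G\<^esub> f y"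
      using g xy f by (simp add: m_assoc)
  qed (use g f in auto)
  ultimately show "f \<in> auto G"
    by (simp add: auto_def Bij_def f)
qed

lemma mem_Out_iff:
  assumes "group G"
  shows "\<Phi> \<in> carrier (Out G) \<longleftrightarrow>
    (\<exists>f\<in>auto G. \<Phi> = (\<lambda>g. \<lambda>x\<in>carrier G. g \<otimes>\<^bsub>G\<^esub> f x \<otimes>\<^bsub>G\<^esub> inv\<^bsub>G\<^esub> g) ` carrier G)"
proof -
  have "Inn G #>\<^bsub>AutoGroup G\<^esub> f = (\<lambda>g. \<lambda>x\<in>carrier G. g \<otimes>\<^bsub>G\<^esub> f x \<otimes>\<^bsub>G\<^esub> inv\<^bsub>G\<^esub> g) ` carrier G"
    if f: "f \<in> auto G" for f
  proof -
    have "Inn G #>\<^bsub>AutoGroup G\<^esub> f = (\<lambda>h. h \<otimes>\<^bsub>AutoGroup G\<^esub> f) ` Inn G"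
      by (auto simp: r_coset_def)
    also have "\<dots> = (\<lambda>h. compose (carrier G) h f) ` Inn G"
      using f Inn_subset_auto[OF assms]
      by (intro image_cong) (auto simp: AutoGroup_def BijGroup_def auto_def)
    also have "\<dots> = (\<lambda>g. \<lambda>x\<in>carrier G. g \<otimes>\<^bsub>G\<^esub> f x \<otimes>\<^bsub>G\<^esub> inv\<^bsub>G\<^esub> g) ` carrier G"
      using f unfolding Inn_def image_image
      by (intro image_cong refl ext) (auto simp: compose_def auto_def hom_def restrict_def Pi_iff)
    finally show ?thesis .
  qed
  then show ?thesis
    by (auto simp: Out_def FactGroup_def RCOSETS_def AutoGroup_def)
qed

theorem outer_length_eq:
  assumes "\<Phi> \<in> carrier (Out (free_group N))" "f \<in> \<Phi>" "w \<in> carrier (free_group N)"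
  shows "outer_length \<Phi> w = cyc_length (f w)"
proof -
  obtain f0 where f0: "f0 \<in> auto (free_group N)" and
    \<Phi>: "\<Phi> = (\<lambda>g. \<lambda>x\<in>carrier (free_group N).
      g \<otimes>\<^bsub>free_group N\<^esub> f0 x \<otimes>\<^bsub>free_group N\<^esub> inv\<^bsub>free_group N\<^esub> g) ` carrier (free_group N)"
    using assms(1) mem_Out_iff[OF group_free_group] by blast
  have "f0 w \<in> carrier (free_group N)" using f0 assms(3) by (auto simp: auto_def hom_def)
  then have "\<forall>h\<in>\<Phi>. cyc_length (h w) = cyc_length (f0 w)"
    using assms(3) by (auto simp: \<Phi> cyc_length_conj)
  with assms(2) show ?thesis unfolding outer_length_def by (intro the_equality) auto
qed

theorem Inn_normal:
  assumes "group G" shows "Inn G \<lhd> AutoGroup G"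
proof -
  interpret group G by fact
  interpret A: group "AutoGroup G" by (rule AutoGroup)
  have mult: "f \<otimes>\<^bsub>AutoGroup G\<^esub> h = compose (carrier G) f h" if "f \<in> auto G" "h \<in> auto G" for f h
    using that by (auto simp: AutoGroup_def BijGroup_def auto_def)
  have carr: "carrier (AutoGroup G) = auto G" by (simp add: AutoGroup_def)
  let ?c = "\<lambda>g. \<lambda>x\<in>carrier G. g \<otimes>\<^bsub>G\<^esub> x \<otimes>\<^bsub>G\<^esub> inv\<^bsub>G\<^esub> g"
  have c: "?c g \<in> auto G" if "g \<in> carrier G" for g
    using that Inn_subset_auto[OF assms] by (auto simp: Inn_def)
  have cc: "?c g \<otimes>\<^bsub>AutoGroup G\<^esub> ?c h = ?c (g \<otimes>\<^bsub>G\<^esub> h)" if "g \<in> carrier G" "h \<in> carrier G" for g h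
    unfolding mult[OF c[OF that(1)] c[OF that(2)]]
    using that conj_comp[OF assms that] by (auto simp: compose_def restrict_def fun_eq_iff)
  have one: "?c \<one>\<^bsub>G\<^esub> = \<one>\<^bsub>AutoGroup G\<^esub>"
    by (auto simp: AutoGroup_def BijGroup_def restrict_def fun_eq_iff)
  have inv: "inv\<^bsub>AutoGroup G\<^esub> (?c g) = ?c (inv\<^bsub>G\<^esub> g)" if "g \<in> carrier G" for g
  proof (rule A.inv_equality)
    show "?c (inv\<^bsub>G\<^esub> g) \<otimes>\<^bsub>AutoGroup G\<^esub> ?c g = \<one>\<^bsub>AutoGroup G\<^esub>"
      unfolding cc[OF inv_closed[OF that] that] l_inv[OF that] by (rule one)
    show "?c g \<in> carrier (AutoGroup G)" "?c (inv\<^bsub>G\<^esub> g) \<in> carrier (AutoGroup G)"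
      unfolding carr using c[OF that] c[OF inv_closed[OF that]] .
  qed
  have "subgroup (Inn G) (AutoGroup G)"
  proof (rule A.subgroupI)
    show "Inn G \<subseteq> carrier (AutoGroup G)" using Inn_subset_auto[OF assms] carr by simp
    show "Inn G \<noteq> {}" by (auto simp: Inn_def)
  next
    fix a assume "a \<in> Inn G"
    then show "inv\<^bsub>AutoGroup G\<^esub> a \<in> Inn G" unfolding Inn_def using inv inv_closed by blast
  next
    fix a b assume "a \<in> Inn G" "b \<in> Inn G"
    then obtain g h where "g \<in> carrier G" "a = ?c g" "h \<in> carrier G" "b = ?c h"
      by (auto simp: Inn_def)
    then show "a \<otimes>\<^bsub>AutoGroup G\<^esub> b \<in> Inn G" using cc[of g h] by (auto simp: Inn_def)
  qed
  moreover have "f \<otimes>\<^bsub>AutoGroup G\<^esub> h \<otimes>\<^bsub>AutoGroup G\<^esub> inv\<^bsub>AutoGroup G\<^esub> f \<in> Inn G"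
    if fh: "f \<in> carrier (AutoGroup G)" "h \<in> Inn G" for f h
  proof -
    obtain g where g: "g \<in> carrier G" "h = ?c g" using fh(2) by (auto simp: Inn_def)
    have f: "f \<in> auto G" using fh carr by simp
    then have f_hom: "f \<in> hom G G" and fG: "\<And>x. x \<in> carrier G \<Longrightarrow> f x \<in> carrier G"
      by (auto simp: auto_def hom_def)
    interpret f: group_hom G G f
      by (rule group_hom.intro[OF assms assms]) (simp add: group_hom_axioms_def f_hom)
    have "f \<otimes>\<^bsub>AutoGroup G\<^esub> h = ?c (f g) \<otimes>\<^bsub>AutoGroup G\<^esub> f"
      unfolding g(2) mult[OF f c[OF g(1)]] mult[OF c[OF fG[OF g(1)]] f]
      using g(1) fG by (auto simp: compose_def restrict_def fun_eq_iff)
    then have "f \<otimes>\<^bsub>AutoGroup G\<^esub> h \<otimes>\<^bsub>AutoGroup G\<^esub> inv\<^bsub>AutoGroup G\<^esub> f = ?c (f g)"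
      using fh(1) A.m_assoc[of "?c (f g)" f "inv\<^bsub>AutoGroup G\<^esub> f"] c[OF fG[OF g(1)]]
      unfolding carr[symmetric] by (metis A.inv_closed A.r_inv A.r_one)
    with fG[OF g(1)] show ?thesis by (auto simp: Inn_def)
  qed
  ultimately show ?thesis by (simp add: A.normal_inv_iff)
qed


section \<open>The simple non-backtracking random walk\<close>

text \<open>The law of the next letter after \<open>i\<close> letters \<open>y 0, \<dots>, y (i - 1)\<close>.\<close>

definition nbrw_step :: "nat \<Rightarrow> nat \<Rightarrow> (nat \<Rightarrow> letter) \<Rightarrow> letter measure" where
  "nbrw_step N i y =
    measure_pmf (pmf_of_set (if i = 0 then letters N else letters N - {inv_letter (y (i - 1))}))"

lemma Ionescu_Tulcea_nbrw: "Ionescu_Tulcea (nbrw_step N) (\<lambda>_. count_space UNIV)"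
proof (rule Ionescu_Tulcea.intro)
  fix i
  show "nbrw_step N i \<in> PiM {0..<i} (\<lambda>_. count_space UNIV) \<rightarrow>\<^sub>M subprob_algebra (count_space UNIV)"
  proof (cases "i = 0")
    case True
    then have "nbrw_step N i = (\<lambda>_. measure_pmf (pmf_of_set (letters N)))"
      by (auto simp: nbrw_step_def)
    then show ?thesis by (auto intro: measurable_const)
  next
    case False
    then have "nbrw_step N i =
        (\<lambda>x. measure_pmf (pmf_of_set (letters N - {inv_letter x}))) \<circ> (\<lambda>y. y (i - 1))"
      by (auto simp: nbrw_step_def)
    moreover have "(\<lambda>y. y (i - 1)) \<in> PiM {0..<i} (\<lambda>_. count_space UNIV) \<rightarrow>\<^sub>M count_space (UNIV :: letter set)"
      using False by (intro measurable_component_singleton) auto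
    ultimately show ?thesis by (auto intro!: measurable_comp simp: measurable_count_space_eq1)
  qed
qed (simp add: nbrw_step_def measure_pmf.prob_space_axioms)

interpretation nbrw: Ionescu_Tulcea "nbrw_step N" "\<lambda>_. count_space UNIV" for N
  by (rule Ionescu_Tulcea_nbrw)

text \<open>The law on the space of trajectories, given by the Ionescu-Tulcea extension theorem.
  The trajectory \<open>y\<^sub>1 y\<^sub>2 y\<^sub>3 \<dots>\<close> is the sequence \<open>y 0, y 1, y 2, \<dots>\<close>.\<close>

definition nbrw_measure :: "nat \<Rightarrow> (nat \<Rightarrow> letter) measure" where
  "nbrw_measure N = nbrw.PF.lim N"

definition prefix_word :: "(nat \<Rightarrow> letter) \<Rightarrow> nat \<Rightarrow> word" where
  "prefix_word y n = map y [0..<n]"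

lemma card_letters: "card (letters N) = 2 * N"
  by (simp add: letters_def card_cartesian_product)

lemma finite_letters [simp]: "finite (letters N)"
  by (simp add: letters_def)

lemma space_nbrw [simp]: "space (nbrw_measure N) = UNIV"
  and sets_nbrw [measurable_cong]: "sets (nbrw_measure N) = sets (PiM UNIV (\<lambda>_. count_space UNIV))"
  by (simp_all add: nbrw_measure_def nbrw.PF.space_lim nbrw.PF.sets_lim space_PiM)

lemma prob_space_nbrw: "prob_space (nbrw_measure N)"
proof (rule prob_space_distrD)
  show "(\<lambda>x. restrict x {}) \<in> nbrw_measure N \<rightarrow>\<^sub>M PiM {} (\<lambda>_. count_space UNIV)"
    by (simp add: measurable_cong_sets[OF sets_nbrw refl])
  show "prob_space (distr (nbrw_measure N) (PiM {} (\<lambda>_. count_space UNIV)) (\<lambda>x. restrict x {}))"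
    unfolding nbrw_measure_def nbrw.distr_lim[OF finite.emptyI]
    by (rule nbrw.PF.prob_space_P) auto
qed

lemma emeasure_nbrw_step:
  assumes "N \<ge> 1" "i = 0 \<or> y (i - 1) \<in> letters N"
    and "x \<in> letters N" "i = 0 \<or> x \<noteq> inv_letter (y (i - 1))"
  shows "emeasure (nbrw_step N i y) {x} = ennreal (if i = 0 then 1 / (2 * N) else 1 / (2 * N - 1))"
proof (cases "i = 0")
  case True
  have "letters N \<noteq> {}" using assms(3) by auto
  with True assms show ?thesis
    by (simp add: nbrw_step_def emeasure_pmf_single card_letters)
next
  case False
  let ?S = "letters N - {inv_letter (y (i - 1))}"
  have "card ?S = 2 * N - 1" using False assms(2) by (simp add: card_letters)
  moreover have "x \<in> ?S" using False assms(3,4) by simp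
  moreover from this have "?S \<noteq> {}" by blast
  ultimately show ?thesis
    using False assms(1) by (simp add: nbrw_step_def emeasure_pmf_single of_nat_diff)
qed

theorem emeasure_nbrw_cylinder:
  assumes "N \<ge> 1" "reduced w" "set w \<subseteq> letters N" "w \<noteq> []"
  shows "emeasure (nbrw_measure N) {y. prefix_word y (length w) = w} =
    ennreal (1 / (2 * N * (2 * N - 1) ^ (length w - 1)))"
proof -
  define A where "A w = (\<Pi>\<^sub>E i\<in>{0..<length w}. {w ! i})" for w :: word
  define p where "p w = (if w = [] then 1 else 1 / (2 * real N * (2 * real N - 1) ^ (length w - 1)))"
    for w :: word
  let ?M = "\<lambda>J. PiM J (\<lambda>_. count_space (UNIV :: letter set))"
  have A: "A w \<in> sets (?M {0..<length w})" for w
    unfolding A_def by (intro sets_PiM_I_finite) auto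
  have sp: "y \<in> space (?M {0..<n}) \<longleftrightarrow> y \<in> extensional {0..<n}" for y n
    by (auto simp: space_PiM PiE_def)
  have C: "emeasure (nbrw.C N 0 (length w) (\<lambda>_. undefined)) (A w) = ennreal (p w)"
    if "reduced w" "set w \<subseteq> letters N" for w
    using that
  proof (induction w rule: rev_induct)
    case Nil
    then show ?case by (simp add: A_def p_def PiM_empty)
  next
    case (snoc x w)
    let ?n = "length w" and ?w' = "w @ [x]"
    let ?C = "nbrw.C N 0 ?n (\<lambda>_. undefined)"
    define c where "c = (if ?n = 0 then 1 / (2 * real N) else 1 / (2 * real N - 1))"
    have u: "(\<lambda>_. undefined) \<in> space (?M {0..<0})" by (simp add: space_PiM PiE_def extensional_def)
    have spC: "space ?C = space (?M {0..<?n})" using nbrw.space_C[OF u, of N ?n] by simp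
    have setsC: "sets ?C = sets (?M {0..<?n})" using nbrw.sets_C[OF u, of N ?n] by simp
    have pos: "c \<ge> 0" "p w \<ge> 0" using assms(1) by (auto simp: c_def p_def)
    have red: "reduced w" "set w \<subseteq> letters N" using snoc.prems by (auto simp: reduced_append)
    have step: "emeasure (nbrw.eP N ?n y) (A ?w') = ennreal c * indicator (A w) y"
      if y: "y \<in> space (?M {0..<?n})" for y
    proof -
      have "(\<lambda>z. y(?n := z)) -` A ?w' = (if y \<in> A w then {x} else {})"
      proof -
        have 1: "y \<in> A w \<longleftrightarrow> (\<forall>i<?n. y i = w ! i)"
          using y unfolding sp A_def by (simp add: PiE_iff Ball_def)
        have "y(?n := z) \<in> extensional {0..<Suc ?n}" for z
          using y unfolding sp by (simp add: extensional_def)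
        then have "y(?n := z) \<in> A ?w' \<longleftrightarrow> (\<forall>i<Suc ?n. (y(?n := z)) i = ?w' ! i)" for z
          unfolding A_def by (simp add: PiE_iff Ball_def del: fun_upd_apply)
        then have "y(?n := z) \<in> A ?w' \<longleftrightarrow> z = x \<and> y \<in> A w" for z
          unfolding 1 by (simp add: All_less_Suc nth_append)
        then show ?thesis by auto
      qed
      moreover have "emeasure (nbrw_step N ?n y) {x} = ennreal c" if yA: "y \<in> A w"
      proof -
        have last: "y (?n - 1) = last w" if "?n \<noteq> 0"
          using yA that by (auto simp: A_def PiE_iff last_conv_nth)
        have "?n = 0 \<or> y (?n - 1) \<in> letters N"
          using last red(2) last_in_set[of w] by (cases "w = []") auto
        moreover have "?n = 0 \<or> x \<noteq> inv_letter (y (?n - 1))"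
          using last snoc.prems(1) by (cases "w = []") (auto simp: reduced_append)
        ultimately show ?thesis
          using snoc.prems(2) emeasure_nbrw_step[of N ?n y x] assms(1) by (simp add: c_def)
      qed
      ultimately show ?thesis
        using nbrw.emeasure_eP[OF y, of "A ?w'" N] A[of ?w'] by auto
    qed
    have "emeasure (nbrw.C N 0 (length ?w') (\<lambda>_. undefined)) (A ?w') =
        (\<integral>\<^sup>+y. emeasure (nbrw.eP N ?n y) (A ?w') \<partial>?C)"
      using A[of ?w'] nbrw.measurable_eP[of N ?n] u
      by (simp add: emeasure_bind[where N = "?M {0..<Suc ?n}"] spC measurable_cong_sets[OF setsC refl])
    also have "\<dots> = (\<integral>\<^sup>+y. ennreal c * indicator (A w) y \<partial>?C)"
      by (intro nn_integral_cong) (simp add: spC step)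
    also have "\<dots> = ennreal c * ennreal (p w)"
      using A[of w] setsC snoc.IH[OF red] by (simp add: nn_integral_cmult_indicator)
    also have "\<dots> = ennreal (p ?w')"
    proof -
      have "c * p w = p ?w'"
        by (cases w) (simp_all add: c_def p_def)
      then show ?thesis using pos by (metis ennreal_mult)
    qed
    finally show ?case .
  qed
  have "{y. prefix_word y (length w) = w} = prod_emb UNIV (\<lambda>_. count_space UNIV) {0..<length w} (A w)"
  proof -
    have "prefix_word y (length w) = w \<longleftrightarrow> (\<forall>i<length w. y i = w ! i)" for y
      unfolding prefix_word_def by (subst list_eq_iff_nth_eq) simp
    moreover have "restrict y {0..<length w} \<in> A w \<longleftrightarrow> (\<forall>i<length w. y i = w ! i)" for y
      unfolding A_def by (simp add: PiE_iff Ball_def)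
    ultimately show ?thesis by (simp add: prod_emb_def set_eq_iff space_PiM)
  qed
  then have "emeasure (nbrw_measure N) {y. prefix_word y (length w) = w} =
      emeasure (nbrw.C N 0 (length w) (\<lambda>_. undefined)) (A w)"
  proof -
    have "prod_emb {0..<length w} (\<lambda>_. count_space UNIV) {0..<length w} (A w) = A w"
      by (rule prod_emb_id) (auto simp: A_def PiE_iff)
    moreover assume "{y. prefix_word y (length w) = w} =
      prod_emb UNIV (\<lambda>_. count_space UNIV) {0..<length w} (A w)"
    ultimately show ?thesis
      using A[of w] nbrw.emeasure_CI[of "{0..<length w}" "length w" "A w" N]
      by (simp add: nbrw_measure_def nbrw.lim)
  qed
  then show ?thesis using C[OF assms(2,3)] assms(4) by (simp add: p_def)
qed


section \<open>Stretching factors\<close>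

text \<open>The supremum is over a bounded set, see \<open>bdd_above_extremal_stretch\<close> below.\<close>

definition extremal_stretch :: "nat \<Rightarrow> (word \<Rightarrow> word) set \<Rightarrow> real" where
  "extremal_stretch N \<Phi> =
    (SUP w \<in> carrier (free_group N) - {\<one>\<^bsub>free_group N\<^esub>}. outer_length \<Phi> w / cyc_length w)"

definition is_generic_stretch :: "nat \<Rightarrow> (word \<Rightarrow> word) set \<Rightarrow> real \<Rightarrow> bool" where
  "is_generic_stretch N \<Phi> L \<longleftrightarrow>
    (AE y in nbrw_measure N.
      (\<lambda>n. outer_length \<Phi> (prefix_word y n) / n) \<longlonglongrightarrow> L \<and>
      (\<lambda>n. outer_length \<Phi> (prefix_word y n) / cyc_length (prefix_word y n)) \<longlonglongrightarrow> L)"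

text \<open>At most one number satisfies this, see \<open>is_generic_stretch_unique\<close> below.\<close>

definition generic_stretch :: "nat \<Rightarrow> (word \<Rightarrow> word) set \<Rightarrow> real" where
  "generic_stretch N \<Phi> = (THE L. is_generic_stretch N \<Phi> L)"

lemma is_generic_stretch_unique:
  assumes "is_generic_stretch N \<Phi> L" "is_generic_stretch N \<Phi> L'"
  shows "L = L'"
proof -
  interpret prob_space "nbrw_measure N" by (rule prob_space_nbrw)
  from assms have "AE y in nbrw_measure N. L = L'"
    unfolding is_generic_stretch_def by eventually_elim (auto intro: LIMSEQ_unique)
  then show ?thesis by simp
qed

lemma length_cancel_Cons: "length (cancel_Cons x w) \<le> Suc (length w)"
  by (cases w) auto

lemma length_free_reduce: "length (free_reduce w) \<le> length w"
  unfolding free_reduce_def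
  by (induction w) (auto intro: order_trans[OF length_cancel_Cons])

lemma length_cyc_reduce: "length (cyc_reduce w) \<le> length w"
  by (induction w rule: cyc_reduce.induct) (subst cyc_reduce.simps, auto)

lemma cyc_reduce_decomp: "\<exists>g. w = g @ cyc_reduce w @ inv_word g"
proof (induction w rule: cyc_reduce.induct)
  case (1 w)
  show ?case
  proof (cases "2 \<le> length w \<and> last w = inv_letter (hd w)")
    case True
    then obtain g where g: "butlast (tl w) = g @ cyc_reduce (butlast (tl w)) @ inv_word g"
      using 1 by blast
    have "w = hd w # butlast (tl w) @ [inv_letter (hd w)]"
      using True by (cases w; cases "tl w" rule: rev_cases) (auto split: if_splits)
    then have "w = (hd w # g) @ cyc_reduce w @ inv_word (hd w # g)"
    proof -
      have cr: "cyc_reduce w = cyc_reduce (butlast (tl w))"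
        using True by (simp add: cyc_reduce.simps[of w])
      note \<open>w = hd w # butlast (tl w) @ [inv_letter (hd w)]\<close>
      also have "butlast (tl w) = g @ cyc_reduce w @ inv_word g"
        unfolding cr by (rule g)
      finally show ?thesis by (simp add: inv_word_Cons)
    qed
    then show ?thesis by blast
  next
    case False
    then have "w = [] @ cyc_reduce w @ inv_word []" by (subst cyc_reduce.simps) auto
    then show ?thesis by blast
  qed
qed

theorem bdd_above_extremal_stretch:
  assumes "\<Phi> \<in> carrier (Out (free_group N))"
  shows "bdd_above ((\<lambda>w. outer_length \<Phi> w / cyc_length w) `
    (carrier (free_group N) - {\<one>\<^bsub>free_group N\<^esub>}))"
proof -
  interpret group "free_group N" by (rule group_free_group)
  obtain f where f: "f \<in> auto (free_group N)" and
    \<Phi>: "\<Phi> = (\<lambda>g. \<lambda>x\<in>carrier (free_group N).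
      g \<otimes>\<^bsub>free_group N\<^esub> f x \<otimes>\<^bsub>free_group N\<^esub> inv\<^bsub>free_group N\<^esub> g) ` carrier (free_group N)"
    using assms mem_Out_iff[OF group_free_group] by blast
  then have hom: "f \<in> hom (free_group N) (free_group N)" by (simp add: auto_def)
  interpret f: group_hom "free_group N" "free_group N" f
    by (rule group_hom.intro[OF group_free_group group_free_group]) (simp add: group_hom_axioms_def hom)
  define K where "K = (\<Sum>a\<in>letters N. length (f [a]))"
  have len: "length (f w) \<le> K * length w" if "w \<in> carrier (free_group N)" for w
    using that
  proof (induction w)
    case Nil
    then show ?case using f.hom_one by (simp add: free_group_def)
  next
    case (Cons a w)
    then have aw: "[a] \<in> carrier (free_group N)" "w \<in> carrier (free_group N)" "a \<in> letters N"
      by (auto simp: free_group_def reduced_Cons)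
    have "a # w = [a] \<otimes>\<^bsub>free_group N\<^esub> w"
      using Cons.prems by (simp add: free_group_def free_reduce_id)
    then have "f (a # w) = f [a] \<otimes>\<^bsub>free_group N\<^esub> f w" using aw by simp
    then have "length (f (a # w)) \<le> length (f [a]) + length (f w)"
      using length_free_reduce[of "f [a] @ f w"] by (simp add: free_group_def)
    moreover have "length (f [a]) \<le> K"
      unfolding K_def using aw(3) by (intro member_le_sum) auto
    ultimately show ?case using Cons.IH[OF aw(2)] by simp
  qed
  have mem: "(\<lambda>x\<in>carrier (free_group N). \<one>\<^bsub>free_group N\<^esub> \<otimes>\<^bsub>free_group N\<^esub> f x
      \<otimes>\<^bsub>free_group N\<^esub> inv\<^bsub>free_group N\<^esub> \<one>\<^bsub>free_group N\<^esub>) \<in> \<Phi>"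
    unfolding \<Phi> using one_closed by (rule imageI)
  have outer: "outer_length \<Phi> w = cyc_length (f w)" if "w \<in> carrier (free_group N)" for w
    using outer_length_eq[OF assms mem that] that by simp
  have "outer_length \<Phi> w \<le> K * cyc_length w" if w: "w \<in> carrier (free_group N)" for w
  proof -
    obtain g where g: "w = g @ cyc_reduce w @ inv_word g" using cyc_reduce_decomp by blast
    let ?u = "cyc_reduce w"
    have "reduced (g @ ?u @ inv_word g)" "set (g @ ?u @ inv_word g) \<subseteq> letters N"
      using w g by (simp_all add: free_group_def)
    then have gu: "g \<in> carrier (free_group N)" "?u \<in> carrier (free_group N)"
      by (auto simp: free_group_def reduced_append)
    have "w = g \<otimes>\<^bsub>free_group N\<^esub> ?u \<otimes>\<^bsub>free_group N\<^esub> inv\<^bsub>free_group N\<^esub> g"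
      unfolding inv_free_group[OF gu(1)]
      using g w free_reduce_append_right[of "g @ ?u" "inv_word g"] free_reduce_id[of w]
      by (simp add: free_group_def free_reduce_append_left)
    then have "f w = f g \<otimes>\<^bsub>free_group N\<^esub> f ?u \<otimes>\<^bsub>free_group N\<^esub> inv\<^bsub>free_group N\<^esub> f g"
      using gu by (metis f.hom_inv f.hom_mult inv_closed m_closed)
    then have "cyc_length (f w) = cyc_length (f ?u)"
      using gu by (simp add: cyc_length_conj)
    also have "\<dots> \<le> length (f ?u)" by (simp add: cyc_length_def length_cyc_reduce)
    also have "\<dots> \<le> K * cyc_length w" using len[OF gu(2)] by (simp add: cyc_length_def)
    finally show ?thesis using outer[OF w] by simp
  qed
  then have "real (outer_length \<Phi> w) / real (cyc_length w) \<le> real K"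
    if "w \<in> carrier (free_group N)" for w
    using that by (simp add: divide_le_eq of_nat_mult[symmetric] del: of_nat_mult)
  then show ?thesis by (intro bdd_aboveI[of _ "real K"]) auto
qed

definition rho :: "nat \<Rightarrow> real" where
  "rho N = (INF \<Phi> \<in> carrier (Out (free_group N)). generic_stretch N \<Phi> / extremal_stretch N \<Phi>)"

end

theory Submission
  imports Defs "HOL-Library.Sublist"
begin

text \<open>
  Let \<open>L w\<close> be the reduced length of the image of \<open>w\<close> under a representative \<open>f\<close> of the outer
  automorphism, and let \<open>K\<close> be the maximal length of the image of a letter.  Both the cancellation
  in \<open>f\<close> and its stretching are controlled by \<open>K\<close> alone, uniformly in \<open>f\<close>:

  \<^item> If \<open>u v\<close> is reduced, then \<open>L (u v) \<ge> L u + L v - 2 C\<close> with \<open>C \<le> 4 N K\<close>.  Since the action is free,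
    a vertex of the target tree has only \<open>O (N K)\<close> preimages in the subdivided source tree.  Two diverging paths
    whose images share an initial segment provide for each vertex of the segment a pair of its
    preimages.  The distance to which the image of the path joining the pair leaves that vertex grows
    along the segment.  After translating all vertices to the base point, the relations \<open>connected in the preimage
    of the ball of radius r\<close> form a chain of equivalence relations on one set of \<open>O (N K)\<close> points, which
    can grow only that often.
  \<^item> If \<open>f\<close> minimizes the total length of the images of the basis, some word \<open>v\<close> of length at most 2 has
    a cyclically reduced image of length at least \<open>K\<close>.  In particular the extremal stretching factor is
    between \<open>K / 2\<close> and \<open>K\<close>.

  Hence a power \<open>g\<close> of \<open>v\<close> of length depending only on \<open>N\<close> satisfies \<open>L g \<ge> 4 C + K\<close>, and \<open>L w\<close> is at least \<open>K\<close>
  times the number of disjoint occurrences of \<open>g\<close> in \<open>w\<close>, which has positive density along the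
  random walk.  The generic stretching factor exists because \<open>L\<close> is a quasimorphism on reduced words: the means
  of \<open>L\<close> are quasi-additive, and \<open>L\<close> concentrates exponentially around them.
\<close>

section \<open>Reduced words\<close>

lemma inv_word_append [simp]: "inv_word (u @ v) = inv_word v @ inv_word u"
  by (simp add: inv_word_def)

lemma inv_word_inv_word [simp]: "inv_word (inv_word u) = u"
  by (simp add: inv_word_def rev_map comp_def)

lemma length_inv_word [simp]: "length (inv_word u) = length u"
  by (simp add: inv_word_def)

lemma inv_word_eq_Nil_iff [simp]: "inv_word u = [] \<longleftrightarrow> u = []"
  by (simp add: inv_word_def)

lemma hd_inv_word: "u \<noteq> [] \<Longrightarrow> hd (inv_word u) = inv_letter (last u)"
  by (simp add: inv_word_def hd_rev last_map)

lemma last_inv_word: "u \<noteq> [] \<Longrightarrow> last (inv_word u) = inv_letter (hd u)"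
  by (simp add: inv_word_def last_rev hd_map)

lemma reduced_inv_word [simp]: "reduced (inv_word u) \<longleftrightarrow> reduced u"
proof -
  have "reduced u \<Longrightarrow> reduced (inv_word u)" for u
  proof (induction u)
    case (Cons x u)
    then show ?case
      by (cases "u = []") (auto simp: inv_word_Cons reduced_append reduced_Cons last_inv_word)
  qed simp
  from this[of u] this[of "inv_word u"] show ?thesis by auto
qed

lemma free_reduce_Nil [simp]: "free_reduce [] = []"
  by (simp add: free_reduce_def)

lemma free_reduce_cancel_inv: "free_reduce (inv_word w @ w @ v) = free_reduce v"
  by (simp add: free_reduce_def foldr_cancel_inv_word reduced_foldr_cancel)

lemma free_reduce_cancel_inv': "free_reduce (w @ inv_word w @ v) = free_reduce v"
  using free_reduce_cancel_inv[of "inv_word w" v] by simp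

lemma free_reduce_mid: "free_reduce (u @ free_reduce v @ w) = free_reduce (u @ v @ w)"
  by (metis free_reduce_append_left free_reduce_append_right)

lemma free_reduce_Cons: "free_reduce (x # w) = cancel_Cons x (free_reduce w)"
  by (simp add: free_reduce_def)

lemma free_reduce_eq_left_cancel:
  assumes "free_reduce (u @ v) = free_reduce (u @ w)"
  shows "free_reduce v = free_reduce w"
proof -
  have "free_reduce (inv_word u @ free_reduce (u @ v)) = free_reduce (inv_word u @ free_reduce (u @ w))"
    using assms by simp
  then show ?thesis by (simp add: free_reduce_append_right free_reduce_cancel_inv)
qed

lemma free_reduce_snoc:
  assumes "reduced w"
  shows "free_reduce (w @ [x]) = (if w \<noteq> [] \<and> last w = inv_letter x then butlast w else w @ [x])"
proof (cases "w \<noteq> [] \<and> last w = inv_letter x")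
  case True
  then show ?thesis using free_reduce_snoc_inv[of w "inv_letter x"] assms by simp
next
  case False
  then have "reduced (w @ [x])" using assms by (auto simp: reduced_append)
  then show ?thesis using False by (auto simp: free_reduce_id)
qed

lemma set_free_reduce_subset: "set w \<subseteq> L \<Longrightarrow> set (free_reduce w) \<subseteq> L"
  using set_free_reduce by blast

text \<open>In the Cayley tree: a path passes through every vertex of the geodesic joining its ends.\<close>

lemma prefix_free_reduce_hit:
  assumes "prefix p (free_reduce w)"
  shows "\<exists>k\<le>length w. free_reduce (take k w) = p"
  using assms
proof (induction w rule: rev_induct)
  case Nil
  then show ?case by simp
next
  case (snoc x w)
  have eq: "free_reduce (w @ [x]) = free_reduce (free_reduce w @ [x])"
    by (simp add: free_reduce_append_left)
  show ?case
  proof (cases "prefix p (free_reduce w)")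
    case True
    then obtain k where "k \<le> length w" "free_reduce (take k w) = p" using snoc.IH by blast
    then show ?thesis by (intro exI[of _ k]) auto
  next
    case False
    then have "free_reduce (w @ [x]) = free_reduce w @ [x]"
      using snoc.prems prefix_order.trans[of p "butlast (free_reduce w)"]
      unfolding eq by (subst free_reduce_snoc) (auto simp: free_reduce_snoc prefixeq_butlast split: if_splits)
    then have "p = free_reduce (w @ [x])"
      using False snoc.prems by (auto simp: prefix_snoc)
    then show ?thesis by (intro exI[of _ "length (w @ [x])"]) auto
  qed
qed

lemma common_prefix_decomp:
  obtains c u' v' where "u = c @ u'" "v = c @ v'" "u' = [] \<or> v' = [] \<or> hd u' \<noteq> hd v'"
proof -
  let ?c = "longest_common_prefix u v"
  obtain u' v' where uv: "u = ?c @ u'" "v = ?c @ v'"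
    using longest_common_prefix_prefix1[of u v] longest_common_prefix_prefix2[of u v]
    by (auto simp: prefix_def)
  have "hd u' \<noteq> hd v'" if ne: "u' \<noteq> []" "v' \<noteq> []"
  proof
    assume "hd u' = hd v'"
    then have "prefix (?c @ [hd u']) u" "prefix (?c @ [hd u']) v"
      using ne uv by (metis append.assoc append_Cons append_Nil list.collapse prefixI)+
    then have "prefix (?c @ [hd u']) ?c" by (rule longest_common_prefix_max_prefix)
    then show False by (auto dest: prefix_length_le)
  qed
  then show ?thesis using that uv by blast
qed

text \<open>This is the geodesic between two vertices of the Cayley tree. Seen from the base vertex
  they branch at \<open>c\<close>, and behind \<open>c\<close> nothing cancels, as a branch is empty
  or both start with different letters.\<close>

lemma free_reduce_inv_word_append:
  assumes "reduced (c @ u)" "reduced (c @ v)" "u = [] \<or> v = [] \<or> hd u \<noteq> hd v"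
  shows "free_reduce (inv_word (c @ u) @ c @ v) = inv_word u @ v" "reduced (inv_word u @ v)"
proof -
  show red: "reduced (inv_word u @ v)"
    using assms by (auto simp: reduced_append last_inv_word)
  have "free_reduce (inv_word (c @ u) @ c @ v) = free_reduce (inv_word u @ free_reduce (inv_word c @ c @ v))"
    by (simp add: free_reduce_append_right)
  also have "\<dots> = inv_word u @ v"
    using red by (simp add: free_reduce_cancel_inv free_reduce_append_right free_reduce_id)
  finally show "free_reduce (inv_word (c @ u) @ c @ v) = inv_word u @ v" .
qed

text \<open>In the Cayley tree, \<open>length (free_reduce (inv_word x @ y))\<close> is the distance
  of the reduced words \<open>x\<close> and \<open>y\<close>. As \<open>z\<close> does not lie
  strictly beyond \<open>p\<close>, the geodesic from \<open>p @ q\<close> to \<open>z\<close>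
  passes through \<open>p\<close>.\<close>

lemma length_free_reduce_diff_append:
  assumes "reduced (p @ q)" "reduced z" "p \<noteq> []" "\<not> prefix p z \<or> z = p"
  shows "length (free_reduce (inv_word (p @ q) @ z)) = length q + length (free_reduce (inv_word p @ z))"
proof (cases "z = p")
  case True
  have "free_reduce (inv_word (p @ q) @ z) = free_reduce (inv_word q @ free_reduce (inv_word p @ p))"
    by (simp add: True free_reduce_append_right)
  then show ?thesis
    using True assms by (simp add: free_reduce_inv_word free_reduce_id reduced_append)
next
  case False
  obtain c p' z' where d: "p = c @ p'" "z = c @ z'" "p' = [] \<or> z' = [] \<or> hd p' \<noteq> hd z'"
    by (rule common_prefix_decomp)
  have "p' \<noteq> []" using False assms d by auto
  have "free_reduce (inv_word (c @ p') @ c @ z') = inv_word p' @ z'"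
    using assms d by (intro free_reduce_inv_word_append) (auto simp: reduced_append)
  moreover have "free_reduce (inv_word (c @ p' @ q) @ c @ z') = inv_word (p' @ q) @ z'"
    using assms d \<open>p' \<noteq> []\<close> by (intro free_reduce_inv_word_append) (auto simp: reduced_append)
  ultimately show ?thesis using d by simp
qed

lemma free_reduce_cancel_inv_right: "free_reduce (u @ w @ inv_word w) = free_reduce u"
proof -
  have "free_reduce (u @ w @ inv_word w) = free_reduce (u @ free_reduce (w @ inv_word w))"
    by (simp add: free_reduce_append_right)
  then show ?thesis using free_reduce_cancel_inv'[of w "[]"] by simp
qed

lemma reduced_take: "reduced w \<Longrightarrow> reduced (take k w)"
  using reduced_append[of "take k w" "drop k w"] unfolding append_take_drop_id by blast

lemma set_take_subset_trans: "set w \<subseteq> L \<Longrightarrow> set (take k w) \<subseteq> L"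
  using set_take_subset[of k w] by (rule order_trans)

lemma take_inv_word: "take k (inv_word w) = inv_word (drop (length w - k) w)"
  by (simp add: inv_word_def take_rev drop_map)

lemma take_concat:
  assumes "xss \<noteq> []" "k \<le> length (concat xss)"
  shows "\<exists>m<length xss. \<exists>i\<le>length (xss ! m). take k (concat xss) = concat (take m xss) @ take i (xss ! m)"
  using assms
proof (induction xss arbitrary: k)
  case (Cons xs xss)
  show ?case
  proof (cases "k \<le> length xs \<or> xss = []")
    case True
    then show ?thesis using Cons.prems by (intro exI[of _ 0]) auto
  next
    case False
    then obtain m i where "m < length xss" "i \<le> length (xss ! m)"
      "take (k - length xs) (concat xss) = concat (take m xss) @ take i (xss ! m)"
      using Cons.IH[of "k - length xs"] Cons.prems by (auto simp: le_diff_conv)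
    then show ?thesis using False by (intro exI[of _ "Suc m"]) auto
  qed
qed simp

text \<open>The blocks will be images of the letters of a path, so a vertex on the geodesic is met
  inside the image of one definite edge.\<close>

lemma prefix_free_reduce_concat_hit:
  assumes "xss \<noteq> []" "prefix p (free_reduce (concat xss))"
  shows "\<exists>m<length xss. \<exists>i\<le>length (xss ! m). free_reduce (concat (take m xss) @ take i (xss ! m)) = p"
  using prefix_free_reduce_hit[OF assms(2)] take_concat[OF assms(1)] by metis

lemma cyc_reduce_cyclically_reduced:
  "cyc_reduce w \<noteq> [] \<Longrightarrow> last (cyc_reduce w) \<noteq> inv_letter (hd (cyc_reduce w))"
proof (induction w rule: cyc_reduce.induct)
  case (1 w)
  show ?case
  proof (cases "2 \<le> length w \<and> last w = inv_letter (hd w)")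
    case True
    then have "cyc_reduce w = cyc_reduce (butlast (tl w))" by (simp add: cyc_reduce.simps[of w])
    then show ?thesis using 1 True by simp
  next
    case False
    then have eq: "cyc_reduce w = w" by (subst cyc_reduce.simps) auto
    then show ?thesis using False 1(2) by (cases w; cases "tl w") auto
  qed
qed

lemma cyc_length_cyclically_reduced:
  "last w \<noteq> inv_letter (hd w) \<Longrightarrow> cyc_length w = length w"
  unfolding cyc_length_def by (subst cyc_reduce.simps) auto

lemma reduced_concat_replicate:
  assumes "reduced u" "u \<noteq> []" "hd u \<noteq> inv_letter (last u)"
  shows "reduced (concat (replicate n u))"
proof (induction n)
  case (Suc n)
  have "hd (concat (replicate n u)) = hd u" if "concat (replicate n u) \<noteq> []"
    using that assms(2) by (cases n) auto
  then show ?case using Suc assms by (auto simp: reduced_append)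
qed simp

lemma length_concat_replicate: "length (concat (replicate n u)) = n * length u"
  by (induction n) auto

text \<open>Meant for powers of the well-stretched word \<open>v\<close> chosen later, which is
  positive: inverse letters never meet there.\<close>

lemma reduced_positive: "\<forall>x\<in>set w. snd x \<Longrightarrow> reduced w"
  by (induction w rule: reduced.induct) (auto simp: inv_letter_def)

text \<open>Each end of \<open>w\<close> that is equal to \<open>x\<close> saves two letters when \<open>w\<close> is conjugated by \<open>x\<close>.\<close>

lemma length_conj_letter:
  assumes "reduced w" "w \<noteq> []"
  shows "length (free_reduce (inv_letter x # w @ [x])) + 2 * (of_bool (hd w = x) + of_bool (last w = inv_letter x))
    \<le> length w + 2"
proof -
  have *: "free_reduce (inv_letter x # w @ [x]) = cancel_Cons (inv_letter x) (free_reduce (w @ [x]))"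
    by (rule free_reduce_Cons)
  have hd: "hd w = x \<Longrightarrow> last w = inv_letter x \<Longrightarrow> length w \<ge> 2"
    using assms(2) by (cases w; cases "tl w") auto
  show ?thesis
  proof (cases "last w = inv_letter x")
    case True
    then have e: "free_reduce (w @ [x]) = butlast w" using assms by (simp add: free_reduce_snoc)
    show ?thesis
    proof (cases "hd w = x")
      case hx: True
      then obtain v where "butlast w = x # v" using hd[OF hx True] by (cases w; cases "tl w") auto
      then have "length (free_reduce (inv_letter x # w @ [x])) = length w - 2" unfolding * e
        by (metis Suc_1 cancel_Cons.simps(2) diff_Suc_1 diff_Suc_eq_diff_pred inv_letter_inv_letter length_Cons length_butlast)
      then show ?thesis using hx True hd by simp
    next
      case False
      have "length (cancel_Cons (inv_letter x) (butlast w)) \<le> length w"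
        using length_cancel_Cons[of "inv_letter x" "butlast w"] assms(2) by (cases w) auto
      then show ?thesis unfolding * e using False True by simp
    qed
  next
    case False
    then have e: "free_reduce (w @ [x]) = w @ [x]" using assms by (simp add: free_reduce_snoc)
    show ?thesis unfolding * e using False assms(2) by (cases w) auto
  qed
qed

section \<open>Chains of equivalence relations\<close>

text \<open>Sending a class of \<open>R\<close> to the class of \<open>S\<close> that contains it is
  onto, and it identifies the distinct classes of \<open>x\<close> and \<open>y\<close>.\<close>

lemma card_quotient_less:
  assumes "finite A" "equiv A R" "equiv A S" "R \<subseteq> S" "(x, y) \<in> S" "(x, y) \<notin> R"
  shows "card (A // S) < card (A // R)"
proof -
  have xy: "x \<in> A" "y \<in> A" using equiv_type[OF assms(3)] assms(5) by blast+
  have fin: "finite (A // R)" using assms(1,2) by (simp add: finite_quotient equiv_type)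
  have mem: "R `` {x} \<in> A // R" "R `` {y} \<in> A // R" using xy by (auto intro: quotientI)
  have ne: "R `` {x} \<noteq> R `` {y}" using assms(2,6) xy by (simp add: eq_equiv_class_iff)
  have im: "S `` (R `` {z}) = S `` {z}" if "z \<in> A" for z
    by (rule refines_equiv_class_eq2[OF assms(4,2,3)])
  have "S `` {x} = S `` {y}" using assms(3,5) by (simp add: equiv_class_eq)
  then have "(``) S (R `` {x}) = (``) S (R `` {y})" using im xy by simp
  then have "(``) S ` (A // R) \<subseteq> (``) S ` (A // R - {R `` {x}})"
    using mem(2) ne by (smt (verit, best) DiffI imageE imageI singletonD subsetI)
  then have "A // S \<subseteq> (``) S ` (A // R - {R `` {x}})"
    using refines_equiv_image_eq[OF assms(4,2,3)] by simp
  then have "card (A // S) \<le> card (A // R - {R `` {x}})"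
    using fin by (meson card_image_le card_mono finite_Diff finite_imageI le_trans)
  also have "\<dots> < card (A // R)" using fin mem(1) by (rule card_Diff1_less)
  finally show ?thesis .
qed

text \<open>\<open>H j\<close> is the first level at which \<open>x j\<close> and \<open>y j\<close>
  are related. As these levels increase strictly, each of the \<open>M - 1\<close> passages from
  \<open>H j\<close> to \<open>H (Suc j)\<close> loses at least one class, and at least one class
  remains at the end.\<close>

lemma equiv_chain_length_le:
  fixes R :: "nat \<Rightarrow> ('a \<times> 'a) set" and H :: "nat \<Rightarrow> nat"
  assumes "finite A" and eq: "\<And>r. equiv A (R r)" and mono: "\<And>r r'. r \<le> r' \<Longrightarrow> R r \<subseteq> R r'"
    and H: "\<And>j. j \<ge> 1 \<Longrightarrow> j < M \<Longrightarrow> H j < H (Suc j)"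
    and rel: "\<And>j. j \<ge> 1 \<Longrightarrow> j \<le> M \<Longrightarrow> (x j, y j) \<in> R (H j)"
    and nrel: "\<And>j r. j \<ge> 1 \<Longrightarrow> j \<le> M \<Longrightarrow> r < H j \<Longrightarrow> (x j, y j) \<notin> R r"
  shows "M \<le> card A"
proof (cases "M = 0")
  case False
  have "card (A // R (H j)) + (j - 1) \<le> card A" if "j \<ge> 1" "j \<le> M" for j
    using that
  proof (induction j rule: dec_induct)
    case base
    have "A // R (H 1) = (\<lambda>x. R (H 1) `` {x}) ` A" by (auto simp: quotient_def)
    then show ?case using assms(1) by (simp add: card_image_le)
  next
    case (step j)
    then have lt: "H j < H (Suc j)" by (intro H) auto
    have "card (A // R (H (Suc j))) < card (A // R (H j))"
      using step.prems lt
      by (intro card_quotient_less[OF assms(1) eq eq mono rel[of "Suc j"] nrel[of "Suc j"]]) auto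
    then show ?case using step by auto
  qed
  from this[of M] have le: "card (A // R (H M)) + (M - 1) \<le> card A" using False by simp
  have "x M \<in> A" using rel[of M] equiv_type[OF eq[of "H M"]] False by auto
  then have "A // R (H M) \<noteq> {}" by (auto simp: quotient_def)
  moreover have "finite (A // R (H M))" using assms(1) eq[of "H M"] by (simp add: finite_quotient equiv_type)
  ultimately have "card (A // R (H M)) \<noteq> 0" by simp
  with le show ?thesis using False by linarith
qed simp

section \<open>Bounded cancellation\<close>

text \<open>Defined on all words, so that it also applies to paths with backtracking.\<close>

definition letter_hom :: "(letter \<Rightarrow> word) \<Rightarrow> word \<Rightarrow> word" where
  "letter_hom \<phi> w = free_reduce (concat (map \<phi> w))"

lemma letter_hom_Nil [simp]: "letter_hom \<phi> [] = []"
  by (simp add: letter_hom_def)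

lemma reduced_letter_hom [simp]: "reduced (letter_hom \<phi> w)"
  by (simp add: letter_hom_def)

lemma letter_hom_append: "letter_hom \<phi> (u @ v) = free_reduce (letter_hom \<phi> u @ letter_hom \<phi> v)"
  by (simp add: letter_hom_def free_reduce_append_left free_reduce_append_right)

text \<open>The last two assumptions are the trivial kernel and the surjectivity of the induced
  endomorphism of the free group.\<close>

locale free_automorphism =
  fixes N :: nat and \<phi> :: "letter \<Rightarrow> word"
  assumes image_inv_letter: "x \<in> letters N \<Longrightarrow> \<phi> (inv_letter x) = inv_word (\<phi> x)"
    and image_letters: "x \<in> letters N \<Longrightarrow> set (\<phi> x) \<subseteq> letters N"
    and reduced_image: "x \<in> letters N \<Longrightarrow> reduced (\<phi> x)"
    and letter_hom_eq_Nil: "reduced w \<Longrightarrow> set w \<subseteq> letters N \<Longrightarrow> letter_hom \<phi> w = [] \<Longrightarrow> w = []"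
    and letter_hom_surj:
      "reduced p \<Longrightarrow> set p \<subseteq> letters N \<Longrightarrow> \<exists>w. reduced w \<and> set w \<subseteq> letters N \<and> letter_hom \<phi> w = p"
begin

abbreviation "F \<equiv> letter_hom \<phi>"

lemma F_free_reduce:
  assumes "set w \<subseteq> letters N"
  shows "F (free_reduce w) = F w"
  using assms
proof (induction w)
  case (Cons x w)
  have "F (cancel_Cons x r) = free_reduce (\<phi> x @ F r)" if "set r \<subseteq> letters N" for r
  proof (cases r)
    case (Cons y r')
    show ?thesis
    proof (cases "y = inv_letter x")
      case True
      then have "free_reduce (\<phi> x @ F r) = free_reduce (\<phi> x @ inv_word (\<phi> x) @ concat (map \<phi> r'))"
        using Cons that image_inv_letter[of x] by (simp add: letter_hom_def free_reduce_append_right)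
      then show ?thesis using True Cons by (simp add: free_reduce_cancel_inv' letter_hom_def)
    qed (simp add: Cons letter_hom_def free_reduce_append_right)
  qed (simp add: letter_hom_def)
  then have "F (free_reduce (x # w)) = free_reduce (\<phi> x @ F (free_reduce w))"
    using Cons.prems set_free_reduce_subset[of w "letters N"] by (simp add: free_reduce_Cons)
  also have "\<dots> = F (x # w)"
    using Cons by (simp add: letter_hom_def free_reduce_append_right)
  finally show ?case .
qed simp

lemma F_inv_word:
  assumes "set w \<subseteq> letters N"
  shows "F (inv_word w) = inv_word (F w)"
proof -
  have "F (w @ inv_word w) = []"
    using F_free_reduce[of "w @ inv_word w"] assms set_inv_word[of w N] free_reduce_cancel_inv'[of w "[]"]
    by simp
  then have "free_reduce (inv_word (F w) @ free_reduce (F w @ F (inv_word w))) = free_reduce (inv_word (F w))"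
    by (simp add: letter_hom_append)
  then show ?thesis
    by (simp add: free_reduce_append_right free_reduce_cancel_inv free_reduce_id)
qed

lemma set_F: "set w \<subseteq> letters N \<Longrightarrow> set (F w) \<subseteq> letters N"
  unfolding letter_hom_def using image_letters by (intro set_free_reduce_subset) auto

lemma F_inj:
  assumes "set u \<subseteq> letters N" "set v \<subseteq> letters N" "F u = F v"
  shows "free_reduce u = free_reduce v"
proof -
  have "F (free_reduce (inv_word u @ v)) = F (inv_word u @ v)"
    using assms set_inv_word[of u N] by (intro F_free_reduce) auto
  also have "\<dots> = []"
    unfolding letter_hom_append F_inv_word[OF assms(1)] assms(3) by (rule free_reduce_inv_word)
  finally have "F (free_reduce (inv_word u @ v)) = []" .
  then have "free_reduce (inv_word u @ v) = []"
    using assms set_inv_word[of u N]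
    by (intro letter_hom_eq_Nil[OF reduced_free_reduce set_free_reduce_subset]) auto
  then have "free_reduce (inv_word u @ v) = free_reduce (inv_word u @ u)"
    by (simp add: free_reduce_inv_word)
  from free_reduce_eq_left_cancel[OF this] show ?thesis by simp
qed

lemma F_cong:
  assumes "set u \<subseteq> letters N" "set v \<subseteq> letters N" "free_reduce u = free_reduce v"
  shows "F u = F v"
  using F_free_reduce assms by metis

text \<open>The vertices \<open>u\<close> and \<open>v\<close> of the source tree lie in one
  component of the preimage of the ball of radius \<open>r\<close> about the base vertex of the
  target tree, as tested on vertices. The path \<open>w\<close> may backtrack, so that paths can be
  concatenated and reversed freely.\<close>

definition conn :: "nat \<Rightarrow> word \<Rightarrow> word \<Rightarrow> bool" where
  "conn r u v \<longleftrightarrow> (\<exists>w. set w \<subseteq> letters N \<and> v = free_reduce (u @ w) \<and>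
    (\<forall>k\<le>length w. length (F (u @ take k w)) \<le> r))"

lemma conn_trans:
  assumes "conn r u v" "conn r v w" "set u \<subseteq> letters N"
  shows "conn r u w"
proof -
  obtain a where a: "set a \<subseteq> letters N" "v = free_reduce (u @ a)"
    "\<forall>k\<le>length a. length (F (u @ take k a)) \<le> r" using assms(1) by (auto simp: conn_def)
  obtain b where b: "set b \<subseteq> letters N" "w = free_reduce (v @ b)"
    "\<forall>k\<le>length b. length (F (v @ take k b)) \<le> r" using assms(2) by (auto simp: conn_def)
  have v: "set v \<subseteq> letters N" using a assms(3) by (auto intro!: set_free_reduce_subset)
  have "F (u @ a @ take k b) = F (v @ take k b)" for k
    using a b v assms(3) set_take_subset[of k b]
    by (intro F_cong) (auto simp: free_reduce_append_left)
  then have "length (F (u @ take k (a @ b))) \<le> r" if "k \<le> length (a @ b)" for k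
    using that a(3) b(3) by (cases "k \<le> length a") auto
  moreover have "w = free_reduce (u @ a @ b)"
    using a b by (simp add: free_reduce_append_left)
  ultimately show ?thesis unfolding conn_def using a(1) b(1) by (intro exI[of _ "a @ b"]) auto
qed

lemma conn_sym:
  assumes "conn r u v" "set u \<subseteq> letters N" "reduced u"
  shows "conn r v u"
proof -
  obtain a where a: "set a \<subseteq> letters N" "v = free_reduce (u @ a)"
    "\<forall>k\<le>length a. length (F (u @ take k a)) \<le> r" using assms(1) by (auto simp: conn_def)
  have v: "set v \<subseteq> letters N" using a assms(2) by (auto intro!: set_free_reduce_subset)
  have "length (F (v @ take k (inv_word a))) \<le> r" if "k \<le> length a" for k
  proof -
    let ?m = "length a - k"
    have "free_reduce (v @ inv_word (drop ?m a)) = free_reduce ((u @ take ?m a) @ drop ?m a @ inv_word (drop ?m a))"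
      unfolding a(2) free_reduce_append_left
      by (metis append.assoc append_take_drop_id)
    also have "\<dots> = free_reduce (u @ take ?m a)" by (rule free_reduce_cancel_inv_right)
    finally have "F (v @ take k (inv_word a)) = F (u @ take ?m a)"
      unfolding take_inv_word
      using a(1) v assms(2) set_inv_word[of "drop ?m a" N] set_take_subset[of ?m a] set_drop_subset[of ?m a]
      by (intro F_cong) auto
    then show ?thesis using a(3) by simp
  qed
  moreover have "u = free_reduce (v @ inv_word a)"
    unfolding a(2) free_reduce_append_left using free_reduce_cancel_inv_right[of u a] assms(3)
    by (simp add: free_reduce_id)
  ultimately show ?thesis unfolding conn_def using a(1) set_inv_word[of a N]
    by (intro exI[of _ "inv_word a"]) auto
qed

lemma conn_length:
  assumes "conn r u v" "set u \<subseteq> letters N"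
  shows "length (F u) \<le> r" "length (F v) \<le> r"
proof -
  obtain a where a: "set a \<subseteq> letters N" "v = free_reduce (u @ a)"
    "\<forall>k\<le>length a. length (F (u @ take k a)) \<le> r" using assms(1) by (auto simp: conn_def)
  show "length (F u) \<le> r" using a(3)[rule_format, of 0] by simp
  show "length (F v) \<le> r" using a(3)[rule_format, of "length a"] a assms(2) by (simp add: F_free_reduce)
qed

text \<open>The pairs \<open>(a, k)\<close> index the points of the source tree that are mapped to the base vertex
  of the target tree: \<open>(a, k)\<close> stands for the \<open>k\<close>-th point of the subdivided edge
  from \<open>root (a, k)\<close> with label \<open>a\<close>.\<close>

definition points :: "(letter \<times> nat) set" where
  "points = Sigma (letters N) (\<lambda>a. {..length (\<phi> a)})"

definition root :: "letter \<times> nat \<Rightarrow> word" where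
  "root i = (SOME g. reduced g \<and> set g \<subseteq> letters N \<and> F g = inv_word (take (snd i) (\<phi> (fst i))))"

definition ends :: "letter \<times> nat \<Rightarrow> word set" where
  "ends i = {root i, free_reduce (root i @ [fst i])}"

text \<open>Points in the same component of the preimage of the ball of radius \<open>r\<close>.\<close>

definition ball_rel :: "nat \<Rightarrow> ((letter \<times> nat) \<times> (letter \<times> nat)) set" where
  "ball_rel r = {(i, j) \<in> points \<times> points. i = j \<or> (\<exists>u\<in>ends i. \<exists>v\<in>ends j. conn r u v)}"

section \<open>Components of preimages of balls as equivalence relations on the points\<close>

lemma finite_points: "finite points"
  by (simp add: points_def)

lemma root:
  assumes "i \<in> points"
  shows "reduced (root i)" "set (root i) \<subseteq> letters N"
    "F (root i) = inv_word (take (snd i) (\<phi> (fst i)))"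
proof -
  have i: "fst i \<in> letters N" using assms by (auto simp: points_def)
  have "reduced (take (snd i) (\<phi> (fst i)))"
    using reduced_image[OF i] by (rule reduced_take)
  moreover have "set (take (snd i) (\<phi> (fst i))) \<subseteq> letters N"
    using image_letters[OF i] by (rule set_take_subset_trans)
  ultimately have "\<exists>g. reduced g \<and> set g \<subseteq> letters N \<and> F g = inv_word (take (snd i) (\<phi> (fst i)))"
    by (intro letter_hom_surj) (simp_all only: reduced_inv_word set_inv_word)
  from someI_ex[OF this] show "reduced (root i)" "set (root i) \<subseteq> letters N"
    "F (root i) = inv_word (take (snd i) (\<phi> (fst i)))" unfolding root_def by blast+
qed

lemma ends:
  assumes "i \<in> points" "u \<in> ends i"
  shows "reduced u" "set u \<subseteq> letters N"
proof -
  have "fst i \<in> letters N" using assms by (auto simp: points_def)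
  then show "reduced u" "set u \<subseteq> letters N"
    using assms(2) root[OF assms(1)] set_free_reduce_subset[of "root i @ [fst i]" "letters N"]
    by (auto simp: ends_def)
qed

text \<open>The two ends are adjacent, so the single edge between them is a path of the required
  kind. It bridges the gap in transitivity when two connections use different ends of the middle
  point.\<close>

lemma conn_ends:
  assumes "i \<in> points" "u \<in> ends i" "v \<in> ends i" "length (F u) \<le> r" "length (F v) \<le> r"
  shows "conn r u v"
proof -
  let ?g = "root i" and ?a = "fst i"
  let ?h = "free_reduce (?g @ [?a])"
  have a: "?a \<in> letters N" using assms(1) by (auto simp: points_def)
  have refl: "conn r u u" if "reduced u" "length (F u) \<le> r" for u
    using that by (auto simp: conn_def free_reduce_id intro!: exI[of _ "[]"])
  have 1: "conn r ?g ?h" if "length (F ?g) \<le> r" "length (F ?h) \<le> r"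
  proof -
    have "F ?h = F (?g @ [?a])" using a root[OF assms(1)] by (intro F_free_reduce) auto
    then have "length (F (?g @ take k [?a])) \<le> r" for k using that by (cases k) auto
    then show ?thesis unfolding conn_def using a by (intro exI[of _ "[?a]"]) auto
  qed
  have "u = v \<or> u = ?g \<and> v = ?h \<or> u = ?h \<and> v = ?g" using assms(2,3) by (auto simp: ends_def)
  then show ?thesis
    using refl[of u] 1 conn_sym[OF 1] assms ends[OF assms(1,2)] root[OF assms(1)] by auto
qed

lemma equiv_ball_rel: "equiv points (ball_rel r)"
proof (rule equivI)
  show "ball_rel r \<subseteq> points \<times> points" by (auto simp: ball_rel_def)
  \<comment> \<open>The clause \<open>i = j\<close> of \<open>ball_rel\<close> matters for small
    \<open>r\<close>, when possibly no end of the edge is mapped into the ball.\<close>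
  show "refl_on points (ball_rel r)" by (auto simp: ball_rel_def refl_on_def)
  show "sym (ball_rel r)"
  proof (rule symI)
    fix i j assume "(i, j) \<in> ball_rel r"
    then show "(j, i) \<in> ball_rel r"
      unfolding ball_rel_def using conn_sym ends by blast
  qed
  show "trans (ball_rel r)"
  proof (rule transI)
    fix i j k assume ij: "(i, j) \<in> ball_rel r" and jk: "(j, k) \<in> ball_rel r"
    then have pts: "i \<in> points" "j \<in> points" "k \<in> points" by (auto simp: ball_rel_def)
    show "(i, k) \<in> ball_rel r"
    proof (cases "i = j \<or> j = k")
      case True
      then show ?thesis using ij jk by auto
    next
      case False
      then obtain u v v' w where *: "u \<in> ends i" "v \<in> ends j" "conn r u v"
        "v' \<in> ends j" "w \<in> ends k" "conn r v' w" using ij jk by (auto simp: ball_rel_def)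
      then have "conn r v v'"
        using pts ends conn_length[of r u v] conn_length[of r v' w] by (intro conn_ends[of j]) auto
      then have "conn r u w"
        using * pts ends by (meson conn_trans)
      then show ?thesis using * pts by (auto simp: ball_rel_def)
    qed
  qed
qed

lemma ball_rel_mono:
  assumes "r \<le> r'" shows "ball_rel r \<subseteq> ball_rel r'"
proof -
  have "conn r' u v" if c: "conn r u v" for u v
  proof -
    obtain w where "set w \<subseteq> letters N" "v = free_reduce (u @ w)"
      "\<forall>k\<le>length w. length (F (u @ take k w)) \<le> r" using c unfolding conn_def by blast
    then show ?thesis using assms unfolding conn_def by (intro exI[of _ w]) (auto intro: le_trans)
  qed
  then show ?thesis by (auto simp: ball_rel_def)
qed

text \<open>Translation by the inverse of \<open>h\<close> carries a point over the vertex
  \<open>F h\<close> to a point over the base vertex, and injectivity of \<open>F\<close> determines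
  the root of the latter. In this way the points over every vertex are represented in the one finite
  set \<open>points\<close>.\<close>

lemma root_translate:
  assumes g: "set g \<subseteq> letters N" and h: "set h \<subseteq> letters N" and i: "(a, k) \<in> points"
    and eq: "F h = free_reduce (F g @ take k (\<phi> a))"
  shows "root (a, k) = free_reduce (inv_word h @ g)"
proof -
  let ?t = "take k (\<phi> a)"
  have "free_reduce (inv_word (F h) @ F g @ ?t) = free_reduce (inv_word (F h) @ F h)"
    unfolding eq by (simp add: free_reduce_append_right)
  then have "free_reduce (free_reduce (inv_word (F h) @ F g @ ?t) @ inv_word ?t) = free_reduce (inv_word ?t)"
    by (simp add: free_reduce_inv_word)
  then have "free_reduce (inv_word (F h) @ F g) = free_reduce (inv_word ?t)"
    using free_reduce_cancel_inv_right[of "inv_word (F h) @ F g" ?t]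
    by (simp add: free_reduce_append_left)
  moreover have "free_reduce (inv_word ?t) = inv_word ?t"
    using root(3)[OF i] by (metis fst_conv reduced_letter_hom snd_conv free_reduce_id)
  ultimately have "F (inv_word h @ g) = F (root (a, k))"
    using root[OF i] h by (simp add: letter_hom_append F_inv_word)
  from F_inj[OF _ _ this] show ?thesis
    using g h root[OF i] set_inv_word[of h N] by (simp add: free_reduce_id)
qed

section \<open>First visits of the image of a path to a vertex\<close>

definition hits :: "word \<Rightarrow> word \<Rightarrow> nat \<Rightarrow> bool" where
  "hits s p m \<longleftrightarrow> m < length s \<and> (\<exists>k\<le>length (\<phi> (s ! m)). free_reduce (F (take m s) @ take k (\<phi> (s ! m))) = p)"

definition first_hit :: "word \<Rightarrow> word \<Rightarrow> nat" where
  "first_hit s p = (LEAST m. hits s p m)"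

text \<open>A prefix of the end \<open>F (take m s)\<close> is a vertex on the geodesic from the
  base vertex to that end, so one of the first \<open>m\<close> edges has a point over it.\<close>

lemma hits_before:
  assumes "prefix p (F (take m s))" "p \<noteq> []"
  shows "\<exists>m'<m. hits s p m'"
proof -
  let ?x = "map \<phi> (take m s)"
  have ne: "?x \<noteq> []"
  proof
    assume "?x = []"
    then have "concat (map \<phi> (take m s)) = []" by (simp only: concat.simps)
    then have "F (take m s) = []" by (simp only: letter_hom_def free_reduce_Nil)
    with assms show False by simp
  qed
  have "prefix p (free_reduce (concat ?x))" using assms(1) by (simp add: letter_hom_def)
  from prefix_free_reduce_concat_hit[OF ne this] obtain m' i where
    "m' < length ?x" "i \<le> length (?x ! m')" "free_reduce (concat (take m' ?x) @ take i (?x ! m')) = p"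
    by blast
  then show ?thesis
    by (intro exI[of _ m'])
      (auto simp: hits_def letter_hom_def free_reduce_append_left take_map min_def split: if_splits)
qed

lemma hits_first_hit:
  assumes "prefix p (F s)" "p \<noteq> []"
  shows "hits s p (first_hit s p)"
  using hits_before[of p "length s" s] assms LeastI[of "hits s p"] by (auto simp: first_hit_def)

text \<open>Up to and including the start of the edge first hit, the vertices of the path have
  images on the near side of \<open>p\<close>. Hence their distances grow when \<open>p\<close> is
  pushed outwards.\<close>

lemma not_prefix_before_first_hit:
  assumes "p \<noteq> []" "m \<le> first_hit s p"
  shows "\<not> prefix p (F (take m s))"
proof
  assume "prefix p (F (take m s))"
  then obtain m' where m': "m' < m" "hits s p m'" using hits_before assms(1) by blast
  then have "first_hit s p \<le> m'" unfolding first_hit_def by (intro Least_le)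
  then show False using m'(1) assms(2) by simp
qed

text \<open>The image of the path, followed until it is at \<open>q\<close>, has to pass through the
  vertex \<open>p\<close> on the geodesic to \<open>q\<close>.\<close>

lemma first_hit_mono:
  assumes "p \<noteq> []" "prefix p q" "prefix q (F s)"
  shows "first_hit s p \<le> first_hit s q"
proof -
  have "q \<noteq> []" using assms by auto
  let ?m = "first_hit s q"
  obtain k where m: "?m < length s" and k: "k \<le> length (\<phi> (s ! ?m))"
    and q: "free_reduce (F (take ?m s) @ take k (\<phi> (s ! ?m))) = q"
    using hits_first_hit[OF assms(3) \<open>q \<noteq> []\<close>] by (auto simp: hits_def)
  \<comment> \<open>The last block is only the piece of the image of edge \<open>?m\<close> that
    ends at \<open>q\<close>.\<close>
  let ?x = "map \<phi> (take ?m s) @ [take k (\<phi> (s ! ?m))]"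
  have "prefix p (free_reduce (concat ?x))"
    using q assms(2) by (simp add: letter_hom_def free_reduce_append_left)
  from prefix_free_reduce_concat_hit[OF _ this] obtain m' i where m': "m' < length ?x"
    and i: "i \<le> length (?x ! m')" and p: "free_reduce (concat (take m' ?x) @ take i (?x ! m')) = p"
    by auto
  have "m' \<le> ?m" using m' m by simp
  have "hits s p m'"
  proof (cases "m' = ?m")
    case True
    then have "?x ! m' = take k (\<phi> (s ! m'))" "take m' ?x = map \<phi> (take m' s)"
      using m by (simp_all add: nth_append)
    then have "free_reduce (F (take m' s) @ take (min i k) (\<phi> (s ! m'))) = p"
      using p by (simp add: letter_hom_def free_reduce_append_left)
    then show ?thesis using m k True unfolding hits_def by (intro conjI exI[of _ "min i k"]) auto
  next
    case False
    then have "m' < ?m" using \<open>m' \<le> ?m\<close> by simp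
    then have x: "?x ! m' = \<phi> (s ! m')" "take m' ?x = map \<phi> (take m' s)"
      using m by (simp_all add: nth_append take_map min_def)
    then have "free_reduce (F (take m' s) @ take i (\<phi> (s ! m'))) = p"
      using p by (simp add: letter_hom_def free_reduce_append_left)
    then show ?thesis using m i x \<open>m' < ?m\<close> unfolding hits_def by (intro conjI exI[of _ i]) auto
  qed
  then show ?thesis using \<open>m' \<le> ?m\<close> Least_le[of "hits s p" m'] unfolding first_hit_def by simp
qed

lemma first_hit_point:
  assumes "set s \<subseteq> letters N" "set h \<subseteq> letters N" "F h = p" "prefix p (F s)" "p \<noteq> []"
  shows "first_hit s p < length s"
    and "\<exists>k. (s ! first_hit s p, k) \<in> points \<and>
      root (s ! first_hit s p, k) = free_reduce (inv_word h @ take (first_hit s p) s) \<and>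
      ends (s ! first_hit s p, k) =
        {free_reduce (inv_word h @ take (first_hit s p) s), free_reduce (inv_word h @ take (Suc (first_hit s p)) s)}"
proof -
  let ?m = "first_hit s p"
  obtain k where m: "?m < length s" and k: "k \<le> length (\<phi> (s ! ?m))"
    and p: "free_reduce (F (take ?m s) @ take k (\<phi> (s ! ?m))) = p"
    using hits_first_hit[OF assms(4,5)] by (auto simp: hits_def)
  show "?m < length s" by (rule m)
  have "s ! ?m \<in> letters N" using m assms(1) by (meson nth_mem subsetD)
  then have pt: "(s ! ?m, k) \<in> points" using k by (simp add: points_def)
  have root: "root (s ! ?m, k) = free_reduce (inv_word h @ take ?m s)"
    using assms p set_take_subset_trans[OF assms(1)] by (intro root_translate[OF _ _ pt]) auto
  moreover have "ends (s ! ?m, k) =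
      {free_reduce (inv_word h @ take ?m s), free_reduce (inv_word h @ take (Suc ?m) s)}"
    unfolding ends_def root using m by (simp add: free_reduce_append_left take_Suc_conv_app_nth)
  ultimately show "\<exists>k. (s ! ?m, k) \<in> points \<and> root (s ! ?m, k) = free_reduce (inv_word h @ take ?m s) \<and>
      ends (s ! ?m, k) = {free_reduce (inv_word h @ take ?m s), free_reduce (inv_word h @ take (Suc ?m) s)}"
    using pt by blast
qed

text \<open>The connecting path runs back along \<open>s\<close> to the common start and then out
  along \<open>t\<close>.\<close>

lemma conn_translate:
  assumes h: "set h \<subseteq> letters N" and s: "set s \<subseteq> letters N" and t: "set t \<subseteq> letters N"
    and rs: "\<And>i. i \<le> length s \<Longrightarrow> length (F (inv_word h @ take i s)) \<le> r"
    and rt: "\<And>i. i \<le> length t \<Longrightarrow> length (F (inv_word h @ take i t)) \<le> r"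
  shows "conn r (free_reduce (inv_word h @ s)) (free_reduce (inv_word h @ t))"
  unfolding conn_def
proof (intro exI[of _ "inv_word s @ t"] conjI allI impI)
  let ?h = "inv_word h"
  have h': "set ?h \<subseteq> letters N" using h by (simp only: set_inv_word)
  show "set (inv_word s @ t) \<subseteq> letters N" using s t set_inv_word[of s N] by simp
  have "free_reduce (?h @ s @ inv_word s @ t) = free_reduce (free_reduce (?h @ s @ inv_word s) @ t)"
    by (simp add: free_reduce_append_left)
  then have eq: "free_reduce (?h @ s @ inv_word s @ t) = free_reduce (?h @ t)" for t
    by (metis append.assoc free_reduce_append_left free_reduce_cancel_inv_right)
  then show "free_reduce (?h @ t) = free_reduce (free_reduce (?h @ s) @ inv_word s @ t)"
    by (simp add: free_reduce_append_left)
  fix k assume k: "k \<le> length (inv_word s @ t)"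
  show "length (F (free_reduce (?h @ s) @ take k (inv_word s @ t))) \<le> r"
  proof (cases "k \<le> length s")
    case True
    let ?m = "length s - k"
    have "take k (inv_word s @ t) = inv_word (drop ?m s)"
      using True by (simp add: take_inv_word)
    moreover have "free_reduce (free_reduce (?h @ s) @ inv_word (drop ?m s)) = free_reduce (?h @ take ?m s)"
      using free_reduce_cancel_inv_right[of "?h @ take ?m s" "drop ?m s"]
      unfolding free_reduce_append_left append.assoc append_take_drop_id
      by (metis append.assoc append_take_drop_id)
    ultimately have "F (free_reduce (?h @ s) @ take k (inv_word s @ t)) = F (?h @ take ?m s)"
      using h' s set_inv_word[of "drop ?m s" N] set_take_subset_trans[OF s, of ?m]
        set_free_reduce_subset[of "?h @ s" "letters N"] order_trans[OF set_drop_subset[of ?m s] s]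
      by (intro F_cong) auto
    then show ?thesis using rs[of ?m] by simp
  next
    case False
    let ?m = "k - length s"
    have "take k (inv_word s @ t) = inv_word s @ take ?m t" using False by simp
    moreover have "F (free_reduce (?h @ s) @ inv_word s @ take ?m t) = F (?h @ take ?m t)"
      using h' s t set_inv_word[of s N] set_take_subset_trans[OF t, of ?m] eq[of "take ?m t"]
        set_free_reduce_subset[of "?h @ s" "letters N"]
      by (intro F_cong) (auto simp: free_reduce_append_left)
    ultimately show ?thesis using rt[of ?m] k by simp
  qed
qed

text \<open>In a tree every path between two vertices passes through all vertices of the geodesic,
  which is \<open>inv_word s @ t\<close> here. So if some path stays in the preimage of the ball,
  the geodesic does.\<close>

lemma conn_translate_converse:
  assumes h: "set h \<subseteq> letters N" and s: "set s \<subseteq> letters N" and t: "set t \<subseteq> letters N"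
    and red: "reduced (inv_word s @ t)"
    and c: "conn r (free_reduce (inv_word h @ s)) (free_reduce (inv_word h @ t))"
  shows "i \<le> length s \<Longrightarrow> length (F (inv_word h @ take i s)) \<le> r"
    and "i \<le> length t \<Longrightarrow> length (F (inv_word h @ take i t)) \<le> r"
proof -
  let ?h = "inv_word h"
  have h': "set ?h \<subseteq> letters N" using h by (simp only: set_inv_word)
  obtain w where w: "set w \<subseteq> letters N" "free_reduce (?h @ t) = free_reduce (free_reduce (?h @ s) @ w)"
    "\<forall>k\<le>length w. length (F (free_reduce (?h @ s) @ take k w)) \<le> r" using c by (auto simp: conn_def)
  have "free_reduce (?h @ t) = free_reduce (?h @ s @ w)" using w(2) by (simp add: free_reduce_append_left)
  from free_reduce_eq_left_cancel[OF this] have "free_reduce t = free_reduce (s @ w)" .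
  then have "free_reduce (inv_word s @ free_reduce (s @ w)) = free_reduce (inv_word s @ t)"
    by (metis free_reduce_append_right)
  then have fw: "free_reduce w = inv_word s @ t"
    using red by (simp add: free_reduce_append_right free_reduce_cancel_inv free_reduce_id)
  \<comment> \<open>\<open>q\<close> marks a vertex of the geodesic, counted from the end of
    \<open>s\<close>; the word \<open>x\<close> leads to the same vertex from the common
    start.\<close>
  have near: "length (F (?h @ x)) \<le> r"
    if q: "prefix q (inv_word s @ t)" and x: "free_reduce (s @ q) = free_reduce x" "set x \<subseteq> letters N" for q x
  proof -
    obtain k where k: "k \<le> length w" "free_reduce (take k w) = q"
      using prefix_free_reduce_hit[of q w] q fw by auto
    have "free_reduce (free_reduce (?h @ s) @ take k w) = free_reduce (?h @ free_reduce (s @ free_reduce (take k w)))"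
      by (simp add: free_reduce_append_left free_reduce_append_right)
    also have "\<dots> = free_reduce (?h @ x)" unfolding k(2) x(1) by (rule free_reduce_append_right)
    finally have "F (free_reduce (?h @ s) @ take k w) = F (?h @ x)"
      using h' s x(2) set_take_subset_trans[OF w(1), of k] set_free_reduce_subset[of "?h @ s" "letters N"]
      by (intro F_cong) auto
    then show ?thesis using w(3) k(1) by metis
  qed
  show "length (F (?h @ take i s)) \<le> r" if "i \<le> length s"
  proof (rule near)
    have "inv_word s = inv_word (drop i s) @ inv_word (take i s)"
      by (metis append_take_drop_id inv_word_append)
    then show "prefix (inv_word (drop i s)) (inv_word s @ t)" by simp
    show "free_reduce (s @ inv_word (drop i s)) = free_reduce (take i s)"
      using free_reduce_cancel_inv_right[of "take i s" "drop i s"] by (metis append.assoc append_take_drop_id)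
  qed (rule set_take_subset_trans[OF s])
  show "length (F (?h @ take i t)) \<le> r" if "i \<le> length t"
  proof (rule near)
    show "prefix (inv_word s @ take i t) (inv_word s @ t)" by (simp add: take_is_prefix)
    show "free_reduce (s @ inv_word s @ take i t) = free_reduce (take i t)"
      by (rule free_reduce_cancel_inv')
  qed (rule set_take_subset_trans[OF t])
qed

text \<open>Let \<open>x\<^sub>j\<close> and \<open>y\<^sub>j\<close> be the first points on the two paths that are mapped to the \<open>j\<close>-th vertex of
  the common prefix.  The largest distance \<open>H j\<close> from that vertex to the image of the path from \<open>x\<^sub>j\<close>
  to \<open>y\<^sub>j\<close> increases strictly with \<open>j\<close>, and it is the smallest \<open>r\<close> such that \<open>ball_rel r\<close> relates the
  translates of \<open>x\<^sub>j\<close> and \<open>y\<^sub>j\<close>.\<close>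

lemma common_prefix_bound:
  assumes s: "reduced s" "set s \<subseteq> letters N" and t: "reduced t" "set t \<subseteq> letters N"
    and ne: "s = [] \<or> t = [] \<or> hd s \<noteq> hd t" and P: "prefix P (F s)" "prefix P (F t)"
  shows "length P \<le> card points"
proof -
  let ?M = "length P"
  define p where "p j = take j P" for j
  have p_ne: "p j \<noteq> []" if "1 \<le> j" "j \<le> ?M" for j using that by (auto simp: p_def)
  have redP: "reduced P" using P(1) by (auto simp: prefix_def) (metis reduced_append reduced_letter_hom)
  have setP: "set P \<subseteq> letters N" using P(1) set_F[OF s(2)] by (auto simp: prefix_def)
  have pP: "prefix (p j) (F s)" "prefix (p j) (F t)" for j
    using P take_is_prefix prefix_order.trans unfolding p_def by blast+
  \<comment> \<open>The distance in the target tree from the vertex \<open>p j\<close> to the image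
    of \<open>z\<close>.\<close>
  define dst where "dst j z = length (free_reduce (inv_word (p j) @ F z))" for j z
  define a where "a j = first_hit s (p j)" for j
  define b where "b j = first_hit t (p j)" for j
  define D where "D j = (\<lambda>i. dst j (take i s)) ` {..a j} \<union> (\<lambda>i. dst j (take i t)) ` {..b j}" for j
  define H where "H j = Max (D j)" for j
  have finD: "finite (D j)" "D j \<noteq> {}" for j by (auto simp: D_def)
  have "\<exists>h. set h \<subseteq> letters N \<and> F h = p j" for j
    using letter_hom_surj[of "p j"] reduced_take[OF redP] set_take_subset_trans[OF setP]
    unfolding p_def by blast
  then obtain h where h: "\<And>j. set (h j) \<subseteq> letters N" "\<And>j. F (h j) = p j" by metis
  have dst_h: "length (F (inv_word (h j) @ z)) = dst j z" if "set z \<subseteq> letters N" for j z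
    by (simp add: letter_hom_append F_inv_word h dst_def)
  have "\<exists>k. 1 \<le> j \<and> j \<le> ?M \<longrightarrow> (s ! a j, k) \<in> points \<and>
      root (s ! a j, k) = free_reduce (inv_word (h j) @ take (a j) s) \<and>
      ends (s ! a j, k) =
        {free_reduce (inv_word (h j) @ take (a j) s), free_reduce (inv_word (h j) @ take (Suc (a j)) s)}" for j
    using first_hit_point(2)[OF s(2) h(1)[of j] h(2)[of j] pP(1)] p_ne[of j] unfolding a_def by blast
  then obtain k where k: "\<And>j. 1 \<le> j \<Longrightarrow> j \<le> ?M \<Longrightarrow> (s ! a j, k j) \<in> points \<and>
      root (s ! a j, k j) = free_reduce (inv_word (h j) @ take (a j) s) \<and>
      ends (s ! a j, k j) =
        {free_reduce (inv_word (h j) @ take (a j) s), free_reduce (inv_word (h j) @ take (Suc (a j)) s)}"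
    by metis
  have "\<exists>k. 1 \<le> j \<and> j \<le> ?M \<longrightarrow> (t ! b j, k) \<in> points \<and>
      root (t ! b j, k) = free_reduce (inv_word (h j) @ take (b j) t) \<and>
      ends (t ! b j, k) =
        {free_reduce (inv_word (h j) @ take (b j) t), free_reduce (inv_word (h j) @ take (Suc (b j)) t)}" for j
    using first_hit_point(2)[OF t(2) h(1)[of j] h(2)[of j] pP(2)] p_ne[of j] unfolding b_def by blast
  then obtain l where l: "\<And>j. 1 \<le> j \<Longrightarrow> j \<le> ?M \<Longrightarrow> (t ! b j, l j) \<in> points \<and>
      root (t ! b j, l j) = free_reduce (inv_word (h j) @ take (b j) t) \<and>
      ends (t ! b j, l j) =
        {free_reduce (inv_word (h j) @ take (b j) t), free_reduce (inv_word (h j) @ take (Suc (b j)) t)}"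
    by metis
  have ab: "a j < length s" "b j < length t" if "1 \<le> j" "j \<le> ?M" for j
    unfolding a_def b_def
    using that first_hit_point(1)[OF _ h(1)[of j] h(2)[of j] _ p_ne[of j]] s(2) t(2) pP by blast+
  have red: "reduced (inv_word (take m s) @ take m' t)" for m m'
    using s t ne reduced_take[of s m] reduced_take[of t m']
    by (auto simp: reduced_append last_inv_word)
  \<comment> \<open>The image of \<open>z\<close> is not beyond \<open>p j\<close>, so the geodesic
    to it from the next vertex of the common prefix passes through \<open>p j\<close>.\<close>
  have dist_Suc: "dst (Suc j) z = 1 + dst j z" if "1 \<le> j" "j < ?M" "\<not> prefix (p j) (F z)" for j z
  proof -
    have "p (Suc j) = p j @ [P ! j]" using that by (simp add: p_def take_Suc_conv_app_nth)
    moreover have "reduced (p (Suc j))" unfolding p_def by (rule reduced_take[OF redP])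
    ultimately show ?thesis
      unfolding dst_def using that p_ne[of j] length_free_reduce_diff_append[of "p j" "[P ! j]" "F z"] by simp
  qed
  have before: "\<not> prefix (p j) (F (take i s))" if "1 \<le> j" "j \<le> ?M" "i \<le> a j" for i j
    using not_prefix_before_first_hit[OF p_ne[OF that(1,2)], of i s] that by (simp add: a_def)
  have before': "\<not> prefix (p j) (F (take i t))" if "1 \<le> j" "j \<le> ?M" "i \<le> b j" for i j
    using not_prefix_before_first_hit[OF p_ne[OF that(1,2)], of i t] that by (simp add: b_def)
  have pre: "prefix (p j) (p (Suc j))" for j
    unfolding p_def by (metis le_SucI order_refl prefix_def take_add add.commute plus_1_eq_Suc)
  show ?thesis
  proof (rule equiv_chain_length_le[OF finite_points equiv_ball_rel ball_rel_mono,
        where H = H and x = "\<lambda>j. (s ! a j, k j)" and y = "\<lambda>j. (t ! b j, l j)"])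
    fix j assume j: "1 \<le> j" "j < ?M"
    have mono: "a j \<le> a (Suc j)" "b j \<le> b (Suc j)"
      unfolding a_def b_def using first_hit_mono[OF p_ne pre pP(1)] first_hit_mono[OF p_ne pre pP(2)] j by simp_all
    have "H j \<in> D j" unfolding H_def using finD by (rule Max_in)
    \<comment> \<open>The vertex that realizes the maximum for \<open>j\<close> is still counted for
      \<open>Suc j\<close>, one step farther away.\<close>
    then have "1 + H j \<in> D (Suc j)"
    proof (unfold D_def, elim UnE imageE)
      fix i assume i: "H j = dst j (take i s)" "i \<in> {..a j}"
      then have "1 + H j = dst (Suc j) (take i s)" using dist_Suc[of j "take i s"] before[of j i] j by simp
      then show "1 + H j \<in> (\<lambda>i. dst (Suc j) (take i s)) ` {..a (Suc j)} \<union> (\<lambda>i. dst (Suc j) (take i t)) ` {..b (Suc j)}"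
        using i mono by (intro UnI1) (auto intro: image_eqI[of _ _ i])
    next
      fix i assume i: "H j = dst j (take i t)" "i \<in> {..b j}"
      then have "1 + H j = dst (Suc j) (take i t)" using dist_Suc[of j "take i t"] before'[of j i] j by simp
      then show "1 + H j \<in> (\<lambda>i. dst (Suc j) (take i s)) ` {..a (Suc j)} \<union> (\<lambda>i. dst (Suc j) (take i t)) ` {..b (Suc j)}"
        using i mono by (intro UnI2) (auto intro: image_eqI[of _ _ i])
    qed
    then have "1 + H j \<le> H (Suc j)" unfolding H_def[of "Suc j"] using finD by (intro Max_ge)
    then show "H j < H (Suc j)" by simp
  next
    fix j assume j: "1 \<le> j" "j \<le> ?M"
    have "dst j (take i s) \<le> H j" if "i \<le> a j" for i
      unfolding H_def using that by (intro Max_ge finD) (auto simp: D_def)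
    moreover have "dst j (take i t) \<le> H j" if "i \<le> b j" for i
      unfolding H_def using that by (intro Max_ge finD) (auto simp: D_def)
    ultimately have "conn (H j) (free_reduce (inv_word (h j) @ take (a j) s)) (free_reduce (inv_word (h j) @ take (b j) t))"
      using s t by (intro conn_translate h) (auto simp: dst_h set_take_subset_trans min_def)
    then show "((s ! a j, k j), (t ! b j, l j)) \<in> ball_rel (H j)"
      using k[OF j] l[OF j] by (auto simp: ball_rel_def)
  next
    fix j r assume j: "1 \<le> j" "j \<le> ?M" and r: "r < H j"
    show "((s ! a j, k j), (t ! b j, l j)) \<notin> ball_rel r"
    proof
      assume "((s ! a j, k j), (t ! b j, l j)) \<in> ball_rel r"
      then consider "(s ! a j, k j) = (t ! b j, l j)"
        | "\<exists>u\<in>ends (s ! a j, k j). \<exists>v\<in>ends (t ! b j, l j). conn r u v" by (auto simp: ball_rel_def)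
      then show False
      proof cases
        \<comment> \<open>Equal points have equal roots and equal edge labels. The two paths would
          then share their edges up to the hit, hence their first letter.\<close>
        case 1
        then have "free_reduce (inv_word (h j) @ take (a j) s) = free_reduce (inv_word (h j) @ take (b j) t)"
          using k[OF j] l[OF j] by metis
        from free_reduce_eq_left_cancel[OF this] have "take (a j) s = take (b j) t"
          using s t by (simp add: free_reduce_id reduced_take)
        then have eq: "take (Suc (a j)) s = take (Suc (b j)) t"
          using 1 ab[OF j] by (simp add: take_Suc_conv_app_nth)
        then have "hd (take (Suc (a j)) s) = hd (take (Suc (b j)) t)" by simp
        then have "hd s = hd t" by simp
        then show False using ne ab[OF j] by auto
      next
        case 2
        \<comment> \<open>Whichever end of the edges is joined, it is not before the vertices number
          \<open>a j\<close> and \<open>b j\<close>, so the geodesic contains all vertices counted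
          in \<open>D j\<close>.\<close>
        then obtain m m' where m: "a j \<le> m" "b j \<le> m'" "m \<le> length s" "m' \<le> length t"
          "conn r (free_reduce (inv_word (h j) @ take m s)) (free_reduce (inv_word (h j) @ take m' t))"
          using k[OF j] l[OF j] ab[OF j]
          by (auto simp: less_eq_Suc_le) (meson Suc_leD order_refl le_SucI)+
        note c = conn_translate_converse[OF h(1) set_take_subset_trans[OF s(2)] set_take_subset_trans[OF t(2)] red m(5)]
        have "dst j (take i s) \<le> r" if "i \<le> a j" for i
          using c(1)[of i] that m by (simp add: dst_h set_take_subset_trans s min_def)
        moreover have "dst j (take i t) \<le> r" if "i \<le> b j" for i
          using c(2)[of i] that m by (simp add: dst_h set_take_subset_trans t min_def)
        ultimately have "H j \<le> r"
          unfolding H_def using finD by (subst Max_le_iff) (auto simp: D_def)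
        then show False using r by simp
      qed
    qed
  qed
qed

text \<open>What cancels between \<open>F u\<close> and \<open>F v\<close> is the common prefix of
  \<open>F (inv_word u)\<close> and \<open>F v\<close>. As \<open>u @ v\<close> is reduced, the
  paths \<open>inv_word u\<close> and \<open>v\<close> leave the base vertex in different
  directions.\<close>

theorem bounded_cancellation:
  assumes "reduced (u @ v)" "set (u @ v) \<subseteq> letters N"
  shows "length (F u) + length (F v) \<le> length (F (u @ v)) + 2 * card points"
proof -
  have u: "reduced u" "set u \<subseteq> letters N" and v: "reduced v" "set v \<subseteq> letters N"
    using assms by (auto simp: reduced_append)
  let ?s = "inv_word u"
  obtain c s' t' where d: "F ?s = c @ s'" "F v = c @ t'" "s' = [] \<or> t' = [] \<or> hd s' \<noteq> hd t'"
    by (rule common_prefix_decomp)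
  have "length c \<le> card points"
  proof (rule common_prefix_bound[of ?s v])
    show "?s = [] \<or> v = [] \<or> hd ?s \<noteq> hd v"
      using assms(1) by (auto simp: reduced_append hd_inv_word)
  qed (use u v d in \<open>auto simp: set_inv_word\<close>)
  moreover have "F (u @ v) = inv_word s' @ t'"
  proof -
    have "F u = inv_word (c @ s')" using d(1) F_inv_word[OF u(2)] by (metis inv_word_inv_word)
    then have "F (u @ v) = free_reduce (inv_word (c @ s') @ c @ t')"
      using d(2) by (simp add: letter_hom_append)
    also have "\<dots> = inv_word s' @ t'"
      using d reduced_letter_hom[of \<phi> ?s] reduced_letter_hom[of \<phi> v]
      by (intro free_reduce_inv_word_append) auto
    finally show ?thesis .
  qed
  moreover have "length (F u) = length c + length s'"
    using d(1) F_inv_word[OF u(2)] by (metis length_append length_inv_word)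
  ultimately show ?thesis using d(2) by simp
qed

section \<open>Length estimates for images\<close>

lemma length_F_le:
  assumes "set w \<subseteq> letters N" "\<And>a. a \<in> letters N \<Longrightarrow> length (\<phi> a) \<le> K"
  shows "length (F w) \<le> K * length w"
proof -
  have "length (concat (map \<phi> w)) \<le> K * length w"
    using assms(1)
  proof (induction w)
    case (Cons a w)
    then show ?case using assms(2)[of a] by simp
  qed simp
  then show ?thesis unfolding letter_hom_def using length_free_reduce le_trans by blast
qed

lemma card_points_le:
  assumes "\<And>a. a \<in> letters N \<Longrightarrow> length (\<phi> a) \<le> K" "K \<ge> 1"
  shows "card points \<le> 4 * N * K"
proof -
  have "card points = (\<Sum>a\<in>letters N. Suc (length (\<phi> a)))" by (simp add: points_def)
  also have "\<dots> \<le> (\<Sum>a\<in>letters N. 2 * K)"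
    using assms by (intro sum_mono) (metis Suc_le_mono add_mono mult_2 plus_1_eq_Suc add.commute le_trans)
  also have "\<dots> = 4 * N * K" by (simp add: card_letters)
  finally show ?thesis .
qed

text \<open>If \<open>F u\<close> is the conjugate of its cyclically reduced form by
  \<open>c\<close>, then a pair of words \<open>c\<close> cancels in the square, whereas
  \<open>u @ u\<close> is reduced. Bounded cancellation therefore gives
  \<open>length c \<le> card points\<close>.\<close>

lemma cyc_length_F_cyclically_reduced:
  assumes "reduced u" "set u \<subseteq> letters N" "u \<noteq> [] \<Longrightarrow> last u \<noteq> inv_letter (hd u)"
  shows "length (F u) \<le> cyc_length (F u) + 2 * card points"
proof -
  obtain c where c: "F u = c @ cyc_reduce (F u) @ inv_word c" using cyc_reduce_decomp by blast
  let ?r = "cyc_reduce (F u)"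
  have len: "length (F u) = 2 * length c + length ?r" by (subst c) simp
  have "F (u @ u) = free_reduce ((c @ ?r) @ (inv_word c @ c @ ?r @ inv_word c))"
    unfolding letter_hom_append by (subst (1 2) c) simp
  also have "\<dots> = free_reduce ((c @ ?r) @ ?r @ inv_word c)"
    by (metis free_reduce_append_right free_reduce_cancel_inv)
  finally have "length (F (u @ u)) \<le> 2 * length c + 2 * length ?r"
    using length_free_reduce[of "(c @ ?r) @ ?r @ inv_word c"] by simp
  moreover have "reduced (u @ u)" using assms by (auto simp: reduced_append)
  then have "length (F u) + length (F u) \<le> length (F (u @ u)) + 2 * card points"
    using assms(2) by (intro bounded_cancellation) auto
  ultimately show ?thesis using len by (simp add: cyc_length_def)
qed

text \<open>Write \<open>w\<close> as the conjugate of a cyclically reduced word by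
  \<open>g\<close>. Then \<open>F w\<close> differs from the image of that word by conjugation with
  \<open>F g\<close>, which costs at most \<open>2 * K * length g\<close>, that is, \<open>K\<close>
  times the part of \<open>w\<close> lost in cyclic reduction.\<close>

lemma cyc_length_F_close:
  assumes w: "reduced w" "set w \<subseteq> letters N" and K: "\<And>a. a \<in> letters N \<Longrightarrow> length (\<phi> a) \<le> K"
  shows "cyc_length (F w) \<le> K * cyc_length w"
    and "\<bar>real (cyc_length (F w)) - length (F w)\<bar> \<le> 2 * card points + K * (real (length w) - cyc_length w)"
proof -
  let ?u = "cyc_reduce w"
  obtain g where g: "w = g @ ?u @ inv_word g" using cyc_reduce_decomp by blast
  have "reduced (g @ ?u @ inv_word g)" "set (g @ ?u @ inv_word g) \<subseteq> letters N"
    using w g by simp_all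
  then have u: "reduced ?u" "set ?u \<subseteq> letters N" and sg: "set g \<subseteq> letters N"
    by (auto simp: reduced_append)
  have len: "length w = 2 * length g + length ?u" by (subst g) simp
  have "F w = F (g @ ?u @ inv_word g)" using g by simp
  also have "\<dots> = free_reduce (F g @ F ?u @ inv_word (F g))"
    by (simp add: letter_hom_append F_inv_word[OF sg] free_reduce_append_right)
  finally have Fw: "F w = free_reduce (F g @ F ?u @ inv_word (F g))" .
  have cyc: "cyc_length (F w) = cyc_length (F ?u)"
    unfolding Fw by (rule cyc_length_conj_word) simp
  have gl: "length (F g) \<le> K * length g" by (rule length_F_le[OF sg K])
  have "cyc_length (F ?u) \<le> length (F ?u)" by (simp add: cyc_length_def length_cyc_reduce)
  also have "\<dots> \<le> K * length ?u" by (rule length_F_le[OF u(2) K])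
  finally show "cyc_length (F w) \<le> K * cyc_length w" using cyc by (simp add: cyc_length_def)
  have 1: "length (F w) \<le> length (F ?u) + 2 * (K * length g)"
    unfolding Fw using length_free_reduce[of "F g @ F ?u @ inv_word (F g)"] gl by simp
  have "free_reduce (inv_word (F g) @ F w @ F g) =
      free_reduce ((inv_word (F g) @ F g @ F ?u) @ inv_word (F g) @ F g)"
    unfolding Fw by (simp add: free_reduce_mid)
  also have "\<dots> = free_reduce (inv_word (F g) @ F g @ F ?u)"
    using free_reduce_cancel_inv_right[of "inv_word (F g) @ F g @ F ?u" "inv_word (F g)"] by simp
  also have "\<dots> = F ?u" by (simp add: free_reduce_cancel_inv free_reduce_id)
  finally have "length (F ?u) \<le> length (inv_word (F g) @ F w @ F g)"
    by (metis length_free_reduce)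
  then have 2: "length (F ?u) \<le> length (F w) + 2 * (K * length g)" using gl by simp
  have 3: "length (F ?u) \<le> cyc_length (F ?u) + 2 * card points"
    using cyc_reduce_cyclically_reduced by (intro cyc_length_F_cyclically_reduced u) auto
  have 4: "cyc_length (F ?u) \<le> length (F ?u)" by (simp add: cyc_length_def length_cyc_reduce)
  have "real (length w) - cyc_length w = 2 * length g" using len by (simp add: cyc_length_def)
  then have "K * (real (length w) - cyc_length w) = real (2 * (K * length g))" by simp
  then show "\<bar>real (cyc_length (F w)) - length (F w)\<bar> \<le> 2 * card points + K * (real (length w) - cyc_length w)"
    unfolding cyc using 1 2 3 4 unfolding abs_le_iff by linarith
qed

end

section \<open>Expectations along the random walk\<close>

text \<open>Comparing \<open>a (m * n)\<close> with both \<open>n * a m\<close> and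
  \<open>m * a n\<close> shows that \<open>a n / n\<close> is Cauchy. Letting only \<open>n\<close>
  tend to infinity in the same estimate gives the bound with the same \<open>C\<close>.\<close>

lemma quasi_additive_sequence:
  fixes a :: "nat \<Rightarrow> real"
  assumes a: "\<And>m n. \<bar>a (m + n) - a m - a n\<bar> \<le> C"
  obtains l :: real where "\<And>n. \<bar>a n - n * l\<bar> \<le> C"
proof -
  have "\<bar>a (0 + 0) - a 0 - a 0\<bar> \<le> C" by (rule a)
  then have C: "C \<ge> 0" by linarith
  have mult: "\<bar>a (k * m) - k * a m\<bar> \<le> k * C" if "k \<ge> 1" for k m
    using that
  proof (induction k rule: dec_induct)
    case (step k)
    then show ?case using a[of m "k * m"] by (simp add: algebra_simps abs_le_iff)
  qed (use C in auto)
  have close: "\<bar>a m / m - a n / n\<bar> \<le> C / m + C / n" if "m \<ge> 1" "n \<ge> 1" for m n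
  proof -
    have "\<bar>n * a m - m * a n\<bar> \<le> n * C + m * C"
      using mult[OF that(1), of n] mult[OF that(2), of m] by (simp add: mult.commute abs_le_iff)
    moreover have "a m / m - a n / n = (n * a m - m * a n) / (m * n)"
      "C / m + C / n = (n * C + m * C) / (m * n)"
      using that by (simp_all add: field_simps)
    ultimately show ?thesis using that by (simp add: abs_divide divide_right_mono)
  qed
  have C0: "(\<lambda>n. C / real n) \<longlonglongrightarrow> 0" by (rule lim_const_over_n)
  have "Cauchy (\<lambda>n. a n / n)"
  proof (rule metric_CauchyI)
    fix e :: real assume "e > 0"
    then have "\<forall>\<^sub>F n in sequentially. C / real n < e / 2 \<and> n \<ge> 1"
      using order_tendstoD(2)[OF C0, of "e / 2"] eventually_ge_at_top[of 1] by (auto intro: eventually_conj)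
    then obtain M where M: "\<And>n. n \<ge> M \<Longrightarrow> C / real n < e / 2 \<and> n \<ge> 1"
      by (auto simp: eventually_sequentially)
    have "dist (a m / m) (a n / n) < e" if "m \<ge> M" "n \<ge> M" for m n
    proof -
      have "\<bar>a m / m - a n / n\<bar> \<le> C / m + C / n" using M[OF that(1)] M[OF that(2)] by (intro close) auto
      also have "\<dots> < e" using M[OF that(1)] M[OF that(2)] by linarith
      finally show ?thesis by (simp add: dist_real_def)
    qed
    then show "\<exists>M. \<forall>m\<ge>M. \<forall>n\<ge>M. dist (a m / m) (a n / n) < e" by blast
  qed
  then obtain l where l: "(\<lambda>n. a n / n) \<longlonglongrightarrow> l" by (auto simp: Cauchy_convergent_iff convergent_def)
  have "\<bar>a m - m * l\<bar> \<le> C" for m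
  proof (cases "m = 0")
    case True
    then show ?thesis using a[of 0 0] by simp
  next
    case False
    have "(\<lambda>n. \<bar>a m / m - a n / n\<bar>) \<longlonglongrightarrow> \<bar>a m / m - l\<bar>"
      by (intro tendsto_intros l)
    moreover have "(\<lambda>n. C / m + C / n) \<longlonglongrightarrow> C / m + 0"
      by (intro tendsto_intros C0)
    moreover have "\<forall>\<^sub>F n in sequentially. \<bar>a m / m - a n / n\<bar> \<le> C / m + C / n"
      using eventually_ge_at_top[of 1] by eventually_elim (use close False in auto)
    ultimately have "\<bar>a m / m - l\<bar> \<le> C / m + 0"
      by (intro tendsto_le[OF sequentially_bot])
    moreover have "a m / m - l = (a m - m * l) / m" using False by (simp add: field_simps)
    ultimately show ?thesis using False by (simp add: abs_divide divide_le_cancel)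
  qed
  then show ?thesis using that by blast
qed

text \<open>For negative \<open>x\<close> it suffices that \<open>(1 - x) * exp x \<le> 1\<close>,
  as \<open>(1 - x) * (1 + x + x^2) = 1 - x^3\<close> is at least 1.\<close>

lemma exp_le_quadratic:
  fixes x :: real
  assumes "x \<le> 1"
  shows "exp x \<le> 1 + x + x\<^sup>2"
proof (cases "x \<ge> 0")
  case True
  then show ?thesis using exp_bound[of x] assms by simp
next
  case False
  have "(1 - x) * exp x \<le> exp (- x) * exp x"
    using exp_ge_add_one_self[of "- x"] by (intro mult_right_mono) auto
  then have "(1 - x) * exp x \<le> 1" by (simp add: exp_minus)
  also have "1 \<le> (1 - x) * (1 + x + x\<^sup>2)"
  proof -
    have "x * x\<^sup>2 \<le> 0" using False by (intro mult_nonpos_nonneg) auto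
    then show ?thesis by (simp add: algebra_simps power2_eq_square)
  qed
  finally show ?thesis using False by simp
qed

text \<open>The last letter of the past of the walk, if there is one, is passed as an optional letter.\<close>

locale walk =
  fixes N :: nat
  assumes N_ge: "N \<ge> 2"
begin

section \<open>Finite averages along the walk\<close>

definition succs :: "letter option \<Rightarrow> letter set" where
  "succs x = (case x of None \<Rightarrow> letters N | Some a \<Rightarrow> letters N - {inv_letter a})"

definition avg :: "letter option \<Rightarrow> (letter \<Rightarrow> real) \<Rightarrow> real" where
  "avg x h = (\<Sum>y\<in>succs x. h y) / card (succs x)"

text \<open>The expectation over the next \<open>n\<close> letters as an iterated finite average;
  \<open>measure_prefix_word\<close> links it with the law of trajectories.\<close>

fun walk_exp :: "nat \<Rightarrow> letter option \<Rightarrow> (word \<Rightarrow> real) \<Rightarrow> real" where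
  "walk_exp 0 x F = F []"
| "walk_exp (Suc n) x F = avg x (\<lambda>y. walk_exp n (Some y) (\<lambda>w. F (y # w)))"

fun walk_words :: "nat \<Rightarrow> letter option \<Rightarrow> word set" where
  "walk_words 0 x = {[]}"
| "walk_words (Suc n) x = (\<Union>y\<in>succs x. (#) y ` walk_words n (Some y))"

definition tip :: "letter option \<Rightarrow> word \<Rightarrow> letter option" where
  "tip x w = (if w = [] then x else Some (last w))"

abbreviation valid :: "letter option \<Rightarrow> bool" where
  "valid x \<equiv> set_option x \<subseteq> letters N"

lemma succs_simps [simp]:
  "succs None = letters N" "succs (Some a) = letters N - {inv_letter a}"
  by (simp_all add: succs_def)

lemma succs_subset: "succs x \<subseteq> letters N"
  by (cases x) auto

lemma finite_succs [simp]: "finite (succs x)"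
  using succs_subset finite_subset by (metis finite_letters)

lemma card_succs_Some [simp]: "a \<in> letters N \<Longrightarrow> card (succs (Some a)) = 2 * N - 1"
  by (simp add: card_letters)

lemma card_succs_bounds: "valid x \<Longrightarrow> card (succs x) \<le> 2 * N \<and> card (succs x) \<ge> 3"
  using N_ge by (cases x) (auto simp: card_letters)

lemma valid_Some_succs: "y \<in> succs x \<Longrightarrow> valid (Some y)"
  using succs_subset by auto

lemma avg_mono:
  assumes "\<And>y. y \<in> succs x \<Longrightarrow> h y \<le> k y"
  shows "avg x h \<le> avg x k"
  unfolding avg_def using assms by (intro divide_right_mono sum_mono) auto

lemma avg_const: "valid x \<Longrightarrow> avg x (\<lambda>_. c) = c"
  using card_succs_bounds[of x] by (auto simp: avg_def)

lemma avg_add: "avg x (\<lambda>y. h y + k y) = avg x h + avg x k"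
  by (simp add: avg_def sum.distrib add_divide_distrib)

lemma avg_cmult: "avg x (\<lambda>y. c * h y) = c * avg x h"
  by (simp add: avg_def sum_distrib_left)

lemma avg_cong: "(\<And>y. y \<in> succs x \<Longrightarrow> h y = k y) \<Longrightarrow> avg x h = avg x k"
  by (simp add: avg_def)

lemma walk_exp_mono:
  "(\<And>w. w \<in> walk_words n x \<Longrightarrow> F w \<le> G w) \<Longrightarrow> walk_exp n x F \<le> walk_exp n x G"
proof (induction n arbitrary: x F G)
  case (Suc n)
  show ?case
    unfolding walk_exp.simps by (intro avg_mono Suc.IH Suc.prems) auto
qed simp

lemma walk_exp_const: "valid x \<Longrightarrow> walk_exp n x (\<lambda>_. c) = c"
proof (induction n arbitrary: x)
  case (Suc n)
  have "walk_exp (Suc n) x (\<lambda>_. c) = avg x (\<lambda>_. c)"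
    using Suc.IH valid_Some_succs by (auto intro!: avg_cong)
  then show ?case using Suc.prems by (simp add: avg_const)
qed simp

lemma walk_exp_add: "walk_exp n x (\<lambda>w. F w + G w) = walk_exp n x F + walk_exp n x G"
  by (induction n arbitrary: x F G) (simp_all add: avg_add)

lemma walk_exp_cmult: "walk_exp n x (\<lambda>w. c * F w) = c * walk_exp n x F"
  by (induction n arbitrary: x F) (simp_all add: avg_cmult)

lemma walk_exp_add_const:
  "valid x \<Longrightarrow> walk_exp n x (\<lambda>w. c + F w) = c + walk_exp n x F"
  by (simp add: walk_exp_add walk_exp_const)

lemma walk_exp_close:
  assumes "valid x" "\<And>w. w \<in> walk_words n x \<Longrightarrow> \<bar>F w - G w\<bar> \<le> c"
  shows "\<bar>walk_exp n x F - walk_exp n x G\<bar> \<le> c"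
proof -
  have "F w \<le> c + G w" "G w \<le> c + F w" if "w \<in> walk_words n x" for w
    using assms(2)[OF that] by auto
  then have "walk_exp n x F \<le> walk_exp n x (\<lambda>w. c + G w)" "walk_exp n x G \<le> walk_exp n x (\<lambda>w. c + F w)"
    by (auto intro!: walk_exp_mono)
  then show ?thesis using assms(1) by (simp add: walk_exp_add_const)
qed

text \<open>The Markov property: the future depends on the past only through its last
  letter.\<close>

lemma walk_exp_append:
  "walk_exp (m + n) x F = walk_exp m x (\<lambda>w. walk_exp n (tip x w) (\<lambda>v. F (w @ v)))"
proof (induction m arbitrary: x F)
  case (Suc m)
  have "tip (Some y) w = tip x (y # w)" for y w by (simp add: tip_def)
  then show ?case using Suc.IH by simp
qed (simp add: tip_def)

lemma walk_words_iff:
  assumes "valid x"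
  shows "w \<in> walk_words n x \<longleftrightarrow>
    length w = n \<and> reduced w \<and> set w \<subseteq> letters N \<and> (w \<noteq> [] \<longrightarrow> hd w \<in> succs x)"
  using assms
proof (induction n arbitrary: x w)
  case (Suc n)
  show ?case
  proof (cases w)
    case (Cons y v)
    then have "w \<in> walk_words (Suc n) x \<longleftrightarrow> y \<in> succs x \<and> v \<in> walk_words n (Some y)" by auto
    also have "\<dots> \<longleftrightarrow> y \<in> succs x \<and> length v = n \<and> reduced v \<and> set v \<subseteq> letters N \<and>
        (v \<noteq> [] \<longrightarrow> hd v \<in> succs (Some y))"
      using Suc.IH valid_Some_succs[of y x] by blast
    finally show ?thesis using Cons succs_subset[of x] hd_in_set[of v]
      by (auto simp: reduced_Cons simp del: walk_words.simps)
  qed auto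
qed auto

lemma walk_words_None_iff: "w \<in> walk_words n None \<longleftrightarrow> length w = n \<and> reduced w \<and> set w \<subseteq> letters N"
  by (subst walk_words_iff) (auto intro: hd_in_set)

lemma append_walk_words:
  assumes "reduced u" "set u \<subseteq> letters N" "w \<in> walk_words n (tip None u)"
  shows "reduced (u @ w)" "set (u @ w) \<subseteq> letters N"
proof -
  have "valid (tip None u)" using assms(2) by (auto simp: tip_def)
  then show "reduced (u @ w)" "set (u @ w) \<subseteq> letters N"
    using assms by (auto simp: walk_words_iff reduced_append tip_def split: if_splits)
qed

lemma finite_walk_words [simp]: "finite (walk_words n x)"
  by (induction n arbitrary: x) auto

text \<open>The probability of each single word that can follow \<open>x\<close>: every letter after
  the first has \<open>2 * N - 1\<close> choices.\<close>

definition weight :: "nat \<Rightarrow> letter option \<Rightarrow> real" where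
  "weight n x = (if n = 0 then 1 else 1 / (card (succs x) * (2 * N - 1) ^ (n - 1)))"

lemma walk_exp_sum:
  assumes "valid x"
  shows "walk_exp n x F = weight n x * (\<Sum>w\<in>walk_words n x. F w)"
  using assms
proof (induction n arbitrary: x F)
  case 0
  then show ?case by (simp add: weight_def)
next
  case (Suc n)
  have w: "weight n (Some y) = 1 / (2 * real N - 1) ^ n" if "y \<in> succs x" for y
    using valid_Some_succs[OF that] N_ge
    by (cases n) (simp_all add: weight_def of_nat_diff del: succs_simps)
  have "walk_exp (Suc n) x F =
      avg x (\<lambda>y. 1 / (2 * real N - 1) ^ n * (\<Sum>v\<in>walk_words n (Some y). F (y # v)))"
    using Suc.IH valid_Some_succs by (auto intro!: avg_cong simp: w)
  also have "\<dots> = weight (Suc n) x * (\<Sum>y\<in>succs x. \<Sum>v\<in>walk_words n (Some y). F (y # v))"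
    using N_ge unfolding avg_cmult by (simp add: avg_def weight_def of_nat_diff)
  also have "(\<Sum>y\<in>succs x. \<Sum>v\<in>walk_words n (Some y). F (y # v)) =
      (\<Sum>y\<in>succs x. \<Sum>w\<in>(#) y ` walk_words n (Some y). F w)"
    by (simp add: sum.reindex)
  also have "\<dots> = (\<Sum>w\<in>walk_words (Suc n) x. F w)"
    unfolding walk_words.simps by (intro sum.UNION_disjoint[symmetric]) auto
  finally show ?case .
qed

lemma weight_ge:
  assumes "valid x"
  shows "weight n x \<ge> (1 / (2 * N)) ^ n"
proof (cases n)
  case (Suc m)
  have "real (card (succs x)) * (2 * real N - 1) ^ m \<le> real (2 * N) * (2 * real N) ^ m"
    using card_succs_bounds[OF assms] N_ge by (intro mult_mono power_mono) (simp_all only: of_nat_le_iff, auto)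
  moreover have "0 < real (card (succs x)) * (2 * real N - 1) ^ m"
    using card_succs_bounds[OF assms] N_ge by auto
  ultimately have "1 / (real (2 * N) * (2 * real N) ^ m) \<le> 1 / (real (card (succs x)) * (2 * real N - 1) ^ m)"
    using N_ge card_succs_bounds[OF assms] by (intro divide_left_mono mult_pos_pos) auto
  then show ?thesis using Suc N_ge by (simp add: weight_def power_divide of_nat_diff)
qed (simp add: weight_def)

lemma walk_exp_ge_single:
  assumes "valid x" "w \<in> walk_words n x" "\<And>v. v \<in> walk_words n x \<Longrightarrow> F v \<ge> 0" "F w \<ge> 1"
  shows "walk_exp n x F \<ge> (1 / (2 * N)) ^ n"
proof -
  have "F w \<le> (\<Sum>v\<in>walk_words n x. F v)" using assms by (intro member_le_sum) auto
  then have "(\<Sum>v\<in>walk_words n x. F v) \<ge> 1" using assms(4) by linarith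
  then have "weight n x * 1 \<le> walk_exp n x F"
    unfolding walk_exp_sum[OF assms(1)] using weight_ge[OF assms(1), of n]
    by (intro mult_left_mono) (auto intro: order_trans[rotated])
  then show ?thesis using weight_ge[OF assms(1), of n] by linarith
qed

lemma weight_le:
  assumes "valid x"
  shows "weight n x \<le> (1 / 3) ^ n"
proof (cases n)
  case (Suc m)
  have "(3::real) * 3 ^ m \<le> real (card (succs x)) * (2 * real N - 1) ^ m"
    using card_succs_bounds[OF assms] N_ge by (intro mult_mono power_mono) auto
  then have "1 / (real (card (succs x)) * (2 * real N - 1) ^ m) \<le> 1 / (3 * 3 ^ m)"
    by (intro divide_left_mono mult_pos_pos) (use card_succs_bounds[OF assms] N_ge in auto)
  then show ?thesis using Suc N_ge by (simp add: weight_def power_divide of_nat_diff)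
qed (simp add: weight_def)

lemma walk_exp_eq_word_le:
  assumes "valid x"
  shows "walk_exp n x (\<lambda>v. if v = c then 1 else 0) \<le> (1 / 3) ^ n"
proof -
  have "walk_exp n x (\<lambda>v. if v = c then 1 else 0) = weight n x * (if c \<in> walk_words n x then 1 else 0)"
    by (simp add: walk_exp_sum[OF assms] sum.delta)
  also have "\<dots> \<le> (1 / 3) ^ n" using weight_le[OF assms] by simp
  finally show ?thesis .
qed

lemma walk_exp_nonneg:
  assumes "valid x" "\<And>w. F w \<ge> 0"
  shows "walk_exp n x F \<ge> 0"
  using walk_exp_mono[of n x "\<lambda>_. 0" F] assms by (simp add: walk_exp_const)

lemma valid_tip: "valid x \<Longrightarrow> w \<in> walk_words n x \<Longrightarrow> valid (tip x w)"
  by (auto simp: walk_words_iff tip_def split: if_splits)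

text \<open>Since \<open>2 * k \<le> n\<close>, the first \<open>n - k\<close> letters determine the
  prefix. The last \<open>k\<close> letters must then form one given word.\<close>

lemma walk_exp_inverse_ends_le:
  assumes "2 * k \<le> n"
  shows "walk_exp n None (\<lambda>w. if drop (n - k) w = inv_word (take k w) then 1 else 0) \<le> (1 / 3) ^ k"
proof -
  let ?Q = "\<lambda>w. if drop (n - k) w = inv_word (take k w) then 1 else 0 :: real"
  have "walk_exp n None ?Q = walk_exp (n - k) None (\<lambda>w. walk_exp k (tip None w) (\<lambda>v. ?Q (w @ v)))"
    using walk_exp_append[of "n - k" k None ?Q] assms by simp
  also have "\<dots> \<le> walk_exp (n - k) None (\<lambda>_. (1 / 3) ^ k)"
  proof (rule walk_exp_mono)
    fix w assume w: "w \<in> walk_words (n - k) None"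
    then have "length w = n - k" by (simp add: walk_words_None_iff)
    then have "(\<lambda>v. ?Q (w @ v)) = (\<lambda>v. if v = inv_word (take k w) then 1 else 0)"
      using assms by auto
    then show "walk_exp k (tip None w) (\<lambda>v. ?Q (w @ v)) \<le> (1 / 3) ^ k"
      using walk_exp_eq_word_le[OF valid_tip[OF _ w], of k "inv_word (take k w)"] by (simp only:) simp
  qed
  finally show ?thesis by (simp add: walk_exp_const)
qed

section \<open>From finite averages to the law of trajectories\<close>

lemma prefix_word_sets: "{y. prefix_word y n = w} \<in> sets (nbrw_measure N)"
proof (cases "length w = n")
  case True
  have "{y. prefix_word y n = w} = {y \<in> space (nbrw_measure N). \<forall>i<n. y i = w ! i}"
    using True unfolding prefix_word_def by (auto simp: list_eq_iff_nth_eq)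
  also have "\<dots> \<in> sets (nbrw_measure N)" by measurable
  finally show ?thesis .
next
  case False
  then have "{y. prefix_word y n = w} = {}" by (auto simp: prefix_word_def)
  then show ?thesis by simp
qed

lemma prefix_word_mem_sets: "{y. Q (prefix_word y n)} \<in> sets (nbrw_measure N)"
proof -
  have "{y. Q (prefix_word y n)} = (\<Union>w\<in>Collect Q. {y. prefix_word y n = w})" by auto
  also have "\<dots> \<in> sets (nbrw_measure N)"
    by (intro sets.countable_UN') (auto intro: prefix_word_sets)
  finally show ?thesis .
qed

lemma measure_prefix_word_walk_words:
  assumes "n \<ge> 1"
  shows "measure (nbrw_measure N) {y. prefix_word y n \<in> walk_words n None \<and> Q (prefix_word y n)} =
    walk_exp n None (\<lambda>w. if Q w then 1 else 0)"
proof -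
  interpret prob_space "nbrw_measure N" by (rule prob_space_nbrw)
  let ?A = "{w \<in> walk_words n None. Q w}"
  have single: "measure (nbrw_measure N) {y. prefix_word y n = w} = weight n None" if "w \<in> ?A" for w
  proof -
    have w: "length w = n" "reduced w" "set w \<subseteq> letters N" "w \<noteq> []"
      using that assms by (auto simp: walk_words_None_iff)
    then have "measure (nbrw_measure N) {y. prefix_word y n = w} = 1 / (2 * N * (2 * N - 1) ^ (n - 1))"
      using emeasure_nbrw_cylinder[of N w] N_ge by (simp add: measure_def)
    then show ?thesis using assms N_ge by (simp add: weight_def card_letters of_nat_diff)
  qed
  have "{y. prefix_word y n \<in> walk_words n None \<and> Q (prefix_word y n)} = (\<Union>w\<in>?A. {y. prefix_word y n = w})"
    by auto
  also have "measure (nbrw_measure N) \<dots> = (\<Sum>w\<in>?A. measure (nbrw_measure N) {y. prefix_word y n = w})"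
    using prefix_word_sets by (intro finite_measure_finite_Union) (auto simp: disjoint_family_on_def)
  also have "\<dots> = (\<Sum>w\<in>?A. weight n None)" by (intro sum.cong refl single)
  also have "\<dots> = walk_exp n None (\<lambda>w. if Q w then 1 else 0)"
    unfolding walk_exp_sum[of None n, simplified] by (simp add: sum.If_cases Int_def)
  finally show ?thesis .
qed

lemma AE_prefix_word: "AE y in nbrw_measure N. \<forall>n. prefix_word y n \<in> walk_words n None"
proof -
  interpret prob_space "nbrw_measure N" by (rule prob_space_nbrw)
  have "AE y in nbrw_measure N. prefix_word y n \<in> walk_words n None" for n
  proof (cases "n \<ge> 1")
    case True
    have "prob {y. prefix_word y n \<in> walk_words n None \<and> True} = 1"
      unfolding measure_prefix_word_walk_words[OF True, of "\<lambda>_. True"] by (simp add: walk_exp_const)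
    then show ?thesis using AE_prob_1 by fastforce
  next
    case False
    then have "n = 0" by simp
    then show ?thesis by (simp add: prefix_word_def)
  qed
  then show ?thesis by (simp add: AE_all_countable)
qed

lemma measure_prefix_word:
  assumes "n \<ge> 1"
  shows "measure (nbrw_measure N) {y. Q (prefix_word y n)} = walk_exp n None (\<lambda>w. if Q w then 1 else 0)"
proof -
  have "measure (nbrw_measure N) {y. Q (prefix_word y n)} =
      measure (nbrw_measure N) {y. prefix_word y n \<in> walk_words n None \<and> Q (prefix_word y n)}"
    using prefix_word_mem_sets[of Q n] prefix_word_mem_sets[of "\<lambda>w. w \<in> walk_words n None \<and> Q w" n] AE_prefix_word
    by (intro measure_eq_AE) auto
  then show ?thesis using measure_prefix_word_walk_words[OF assms] by simp
qed

text \<open>Borel-Cantelli for events of exponentially small probability.\<close>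

lemma AE_eventually_not:
  assumes r: "0 \<le> r" "r < 1"
    and le: "\<And>n. n \<ge> 1 \<Longrightarrow> walk_exp n None (\<lambda>w. if Q n w then 1 else 0) \<le> c * r ^ n"
  shows "AE y in nbrw_measure N. \<forall>\<^sub>F n in sequentially. \<not> Q n (prefix_word y n)"
proof -
  interpret prob_space "nbrw_measure N" by (rule prob_space_nbrw)
  have sum: "summable (\<lambda>n. measure (nbrw_measure N) {y. Q n (prefix_word y n)})"
  proof (rule summable_comparison_test')
    show "summable (\<lambda>n. c * r ^ n)" using r by (intro summable_mult summable_geometric) auto
    show "norm (measure (nbrw_measure N) {y. Q n (prefix_word y n)}) \<le> c * r ^ n" if "n \<ge> 1" for n
      using measure_prefix_word[OF that, of "Q n"] le[OF that] 
      by (metis abs_of_nonneg measure_nonneg real_norm_def)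
  qed
  have "AE y in nbrw_measure N. eventually (\<lambda>n. y \<in> space (nbrw_measure N) - {y. Q n (prefix_word y n)}) sequentially"
    using sum by (intro borel_cantelli_AE1 prefix_word_mem_sets) (auto simp: less_top[symmetric])
  then show ?thesis by simp
qed

text \<open>A word that is far from being cyclically reduced ends with the inverse of a long prefix.\<close>

lemma AE_cyc_length:
  "AE y in nbrw_measure N. (\<lambda>n. cyc_length (prefix_word y n) / n) \<longlonglongrightarrow> 1"
proof -
  have ev: "AE y in nbrw_measure N. \<forall>\<^sub>F n in sequentially. \<not> (real n - cyc_length (prefix_word y n) \<ge> 2 * e * n)"
    if e: "e > 0" for e :: real
  proof (rule AE_eventually_not[where c = 1])
    show "0 \<le> (1 / 3 :: real) powr e" "(1 / 3 :: real) powr e < 1"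
      using e powr_less_mono'[of "1 / 3" 0 e] by auto
    fix n :: nat assume n: "n \<ge> 1"
    \<comment> \<open>A word in \<open>?Q\<close> is a conjugate by a word of length at least
      \<open>e * n\<close>, hence at least \<open>k\<close>.\<close>
    define k where "k = nat \<lceil>e * n\<rceil>"
    have k: "e * n \<le> k" using e by (simp add: k_def)
    let ?Q = "\<lambda>w. real n - cyc_length w \<ge> 2 * e * n"
    have pos: "e * n > 0" using e n by simp
    have ends: "2 * k \<le> n \<and> drop (n - k) w = inv_word (take k w)" if w: "w \<in> walk_words n None" "?Q w" for w
    proof -
      obtain g where g: "w = g @ cyc_reduce w @ inv_word g" using cyc_reduce_decomp by blast
      have len: "length w = n" using w by (simp add: walk_words_None_iff)
      have "length w = length g + length (cyc_reduce w) + length (inv_word g)"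
        by (subst g) simp
      then have l: "n = 2 * length g + cyc_length w"
        using len by (simp add: cyc_length_def inv_word_def)
      then have "real (length g) \<ge> e * n" using w(2) by simp
      then have kg: "k \<le> length g" unfolding k_def by (simp add: ceiling_le_iff)
      have "take k w = take k g" using kg by (subst g) simp
      moreover have "drop (n - k) w = drop (length g - k) (inv_word g)"
        using l kg by (subst g) (simp add: cyc_length_def)
      moreover have "drop (length g - k) (inv_word g) = inv_word (take k g)"
        using kg by (simp add: inv_word_def drop_rev drop_map take_map)
      ultimately show ?thesis using kg l by simp
    qed
    show "walk_exp n None (\<lambda>w. if ?Q w then 1 else 0) \<le> 1 * ((1 / 3) powr e) ^ n"
    proof (cases "2 * k \<le> n")
      case True
      have "walk_exp n None (\<lambda>w. if ?Q w then 1 else 0) \<le>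
          walk_exp n None (\<lambda>w. if drop (n - k) w = inv_word (take k w) then 1 else 0)"
        using ends by (intro walk_exp_mono) auto
      also have "\<dots> \<le> (1 / 3) ^ k" by (rule walk_exp_inverse_ends_le[OF True])
      also have "\<dots> = (1 / 3) powr k" by (simp add: powr_realpow)
      also have "\<dots> \<le> (1 / 3) powr (e * n)" using k by (intro powr_mono') auto
      also have "\<dots> = ((1 / 3) powr e) ^ n" by (simp add: powr_powr[symmetric] powr_realpow)
      finally show ?thesis by simp
    next
      case False
      then have "walk_exp n None (\<lambda>w. if ?Q w then 1 else 0) \<le> walk_exp n None (\<lambda>w. 0)"
        using ends by (intro walk_exp_mono) auto
      moreover have "0 \<le> 1 * ((1 / 3 :: real) powr e) ^ n" by simp
      moreover have "walk_exp n None (\<lambda>w. 0) = 0" by (simp add: walk_exp_const)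
      ultimately show ?thesis by linarith
    qed
  qed
  \<comment> \<open>Countably many tolerances suffice, so the null sets can be collected.\<close>
  have "AE y in nbrw_measure N. \<forall>j::nat. \<forall>\<^sub>F n in sequentially.
      \<not> (real n - cyc_length (prefix_word y n) \<ge> 2 * (1 / Suc j) * n)"
    by (subst AE_all_countable) (intro allI ev, simp)
  then show ?thesis
  proof eventually_elim
    case (elim y)
    show ?case
    proof (rule LIMSEQ_I)
      fix r :: real assume r: "r > 0"
      obtain j where j: "2 * (1 / real (Suc j)) < r"
        using reals_Archimedean[of "r / 2"] r by (auto simp: inverse_eq_divide)
      have "\<forall>\<^sub>F n in sequentially. norm (real (cyc_length (prefix_word y n)) / n - 1) < r"
        using elim[rule_format, of j] eventually_ge_at_top[of 1]
      proof eventually_elim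
        case (elim n)
        have "cyc_length (prefix_word y n) \<le> n"
          using length_cyc_reduce[of "prefix_word y n"] by (simp add: cyc_length_def prefix_word_def)
        then have "norm (real (cyc_length (prefix_word y n)) / n - 1) = (real n - cyc_length (prefix_word y n)) / n"
          using elim by (simp add: field_simps)
        also have "\<dots> < 2 * (1 / real (Suc j))" using elim by (simp add: field_simps)
        finally show ?case using j by simp
      qed
      then show "\<exists>no. \<forall>n\<ge>no. norm (real (cyc_length (prefix_word y n)) / n - 1) < r"
        by (simp add: eventually_sequentially)
    qed
  qed
qed

text \<open>Cuts a word into \<open>q\<close> blocks and counts those that are \<open>g\<close>
  after one free letter. The free letter makes a good block possible after every past.\<close>

primrec block_count :: "word \<Rightarrow> nat \<Rightarrow> word \<Rightarrow> real" where
  "block_count g 0 w = 0"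
| "block_count g (Suc q) w =
    of_bool (take (length g) (tl w) = g) + block_count g q (drop (Suc (length g)) w)"

text \<open>Whatever precedes a block, at least three letters may follow, so one of them is not
  inverse to the first letter of \<open>g\<close> and can separate \<open>g\<close> from the past.
  Given any past, a block is thus good with probability at least
  \<open>(1 / (2 * N)) ^ Suc (length g)\<close>.\<close>

lemma walk_exp_block_count:
  assumes "valid x" "reduced g" "g \<noteq> []" "set g \<subseteq> letters N"
  shows "walk_exp (q * Suc (length g)) x (block_count g q) \<ge> q * (1 / (2 * N)) ^ Suc (length g)"
  using assms(1)
proof (induction q arbitrary: x)
  case 0
  then show ?case by simp
next
  case (Suc q)
  let ?m = "Suc (length g)" and ?p = "(1 / real (2 * N)) ^ Suc (length g)"
  let ?I = "\<lambda>w. of_bool (tl w = g) :: real"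
  have "card (succs x) \<ge> 3" using card_succs_bounds[OF Suc.prems] by simp
  then have "succs x - {inv_letter (hd g)} \<noteq> {}"
    using card_mono[of "{inv_letter (hd g)}" "succs x"] by auto
  then obtain c where c: "c \<in> succs x" "c \<noteq> inv_letter (hd g)" by blast
  then have "hd g \<noteq> inv_letter c" by auto
  then have "c # g \<in> walk_words ?m x"
    using assms c succs_subset[of x]
    by (auto simp: walk_words_iff[OF Suc.prems] reduced_Cons simp del: walk_words.simps)
  then have "?p \<le> walk_exp ?m x ?I"
    using walk_exp_ge_single[OF Suc.prems, of "c # g" ?m ?I] by (simp del: walk_exp.simps)
  then have "Suc q * ?p \<le> walk_exp ?m x (\<lambda>w. q * ?p + ?I w)"
    unfolding walk_exp_add_const[OF Suc.prems] of_nat_Suc distrib_right by simp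
  also have "\<dots> \<le> walk_exp ?m x (\<lambda>w. walk_exp (q * ?m) (tip x w) (\<lambda>v. block_count g (Suc q) (w @ v)))"
  proof (rule walk_exp_mono)
    fix w assume w: "w \<in> walk_words ?m x"
    then have len: "length w = ?m" unfolding walk_words_iff[OF Suc.prems] by simp
    have eq: "(\<lambda>v. block_count g (Suc q) (w @ v)) = (\<lambda>v. ?I w + block_count g q v)"
      using len by (cases w) auto
    show "q * ?p + ?I w \<le> walk_exp (q * ?m) (tip x w) (\<lambda>v. block_count g (Suc q) (w @ v))"
      using Suc.IH[OF valid_tip[OF Suc.prems w]]
      unfolding eq walk_exp_add_const[OF valid_tip[OF Suc.prems w]] by linarith
  qed
  also have "\<dots> = walk_exp (Suc q * ?m) x (block_count g (Suc q))"
    using walk_exp_append[of ?m "q * ?m" x "block_count g (Suc q)"] by (simp only: mult_Suc)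
  finally show ?case .
qed

end

section \<open>Means and concentration of a quasimorphism along the walk\<close>

locale quasi_additive = walk +
  fixes L :: "word \<Rightarrow> real" and B :: real
  assumes quasi: "reduced (u @ v) \<Longrightarrow> set (u @ v) \<subseteq> letters N \<Longrightarrow> \<bar>L (u @ v) - L u - L v\<bar> \<le> B"
    and single: "a \<in> letters N \<Longrightarrow> \<bar>L [a]\<bar> \<le> B"
begin

lemma B_nonneg: "B \<ge> 0"
  using quasi[of "[]" "[]"] by simp

lemma Cons_walk_words:
  assumes "a \<in> letters N" "w \<in> walk_words n (Some a)"
  shows "reduced (a # w)" "set (a # w) \<subseteq> letters N"
  using append_walk_words[of "[a]" w n] assms by (auto simp: tip_def)

lemma avg_close:
  assumes "valid x" "\<And>y. y \<in> succs x \<Longrightarrow> \<bar>h y - a\<bar> \<le> c"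
  shows "\<bar>avg x h - a\<bar> \<le> c"
proof -
  have "h y \<le> a + c" "a - c \<le> h y" if "y \<in> succs x" for y using assms(2)[OF that] by auto
  then have "avg x h \<le> avg x (\<lambda>_. a + c)" "avg x (\<lambda>_. a - c) \<le> avg x h"
    by (auto intro!: avg_mono)
  then show ?thesis using assms(1) by (simp add: avg_const abs_le_iff)
qed

definition first_exp :: "nat \<Rightarrow> letter \<Rightarrow> real" where
  "first_exp n a = walk_exp n (Some a) (\<lambda>w. L (a # w))"

lemma walk_exp_L_Suc: "walk_exp (Suc n) x L = avg x (first_exp n)"
  by (simp add: first_exp_def[abs_def])

lemma first_exp_close:
  assumes "a \<in> letters N"
  shows "\<bar>first_exp n a - walk_exp n (Some a) L\<bar> \<le> 2 * B"
  unfolding first_exp_def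
proof (rule walk_exp_close)
  fix w assume "w \<in> walk_words n (Some a)"
  then have "\<bar>L ([a] @ w) - L [a] - L w\<bar> \<le> B"
    using Cons_walk_words[OF assms] by (intro quasi) auto
  then show "\<bar>L (a # w) - L w\<bar> \<le> 2 * B" using single[OF assms] by simp
qed (use assms in simp)

text \<open>Two letters have at least \<open>2 N - 2\<close> of their \<open>2 N - 1\<close> successors in common, so that one step of
  the walk contracts oscillations by the factor \<open>2 N - 1 \<ge> 3\<close>.\<close>

lemma first_exp_osc:
  "a \<in> letters N \<Longrightarrow> b \<in> letters N \<Longrightarrow> \<bar>first_exp n a - first_exp n b\<bar> \<le> 6 * B"
proof (induction n arbitrary: a b)
  case 0
  then show ?case using single[of a] single[of b] B_nonneg by (simp add: first_exp_def)
next
  case (Suc n)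
  have eq: "(2 * real N - 1) * walk_exp (Suc n) (Some a) L = (\<Sum>y\<in>letters N. first_exp n y) - first_exp n (inv_letter a)"
    if "a \<in> letters N" for a
    unfolding walk_exp_L_Suc avg_def card_succs_Some[OF that]
    using that N_ge by (simp add: sum_diff1 of_nat_diff)
  \<comment> \<open>The sums over the successors of \<open>a\<close> and of \<open>b\<close> differ
    only by the two excluded letters.\<close>
  have "(2 * real N - 1) * (walk_exp (Suc n) (Some a) L - walk_exp (Suc n) (Some b) L) =
      first_exp n (inv_letter b) - first_exp n (inv_letter a)"
    using eq[OF Suc.prems(1)] eq[OF Suc.prems(2)] by (simp add: right_diff_distrib)
  then have "\<bar>(2 * real N - 1) * (walk_exp (Suc n) (Some a) L - walk_exp (Suc n) (Some b) L)\<bar> \<le> 6 * B"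
    using Suc.IH[of "inv_letter b" "inv_letter a"] Suc.prems by simp
  moreover have "3 * \<bar>d\<bar> \<le> \<bar>(2 * real N - 1) * d\<bar>" for d
    using N_ge by (simp add: abs_mult mult_right_mono)
  ultimately have "3 * \<bar>walk_exp (Suc n) (Some a) L - walk_exp (Suc n) (Some b) L\<bar> \<le> 6 * B"
    by (meson order_trans)
  \<comment> \<open>The constant 6 reproduces itself: \<open>2 + 6 / 3 + 2 = 6\<close>.\<close>
  moreover have "\<bar>p - q\<bar> \<le> 6 * B" if "\<bar>p - p'\<bar> \<le> 2 * B" "\<bar>q - q'\<bar> \<le> 2 * B" "3 * \<bar>p' - q'\<bar> \<le> 6 * B"
    for p q p' q' :: real
  proof -
    have "\<bar>p' - q'\<bar> \<le> 2 * B" using that(3) by simp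
    then show ?thesis using that(1,2) unfolding abs_le_iff by linarith
  qed
  ultimately show ?case
    using first_exp_close[OF Suc.prems(1), of "Suc n"] first_exp_close[OF Suc.prems(2), of "Suc n"]
    by blast
qed

text \<open>The past enters only through the set of letters over which \<open>first_exp\<close> is
  averaged.\<close>

lemma walk_exp_L_osc:
  assumes "valid x" "valid x'"
  shows "\<bar>walk_exp n x L - walk_exp n x' L\<bar> \<le> 6 * B"
proof (cases n)
  case 0
  then show ?thesis using B_nonneg by simp
next
  case (Suc m)
  have "\<bar>first_exp m y - avg x' (first_exp m)\<bar> \<le> 6 * B" if "y \<in> letters N" for y
    using succs_subset[of x'] that
    by (subst abs_minus_commute) (intro avg_close[OF assms(2)] first_exp_osc; blast)
  then show ?thesis unfolding Suc walk_exp_L_Suc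
    using assms(1) succs_subset[of x] by (intro avg_close) auto
qed

definition mean :: "nat \<Rightarrow> real" where
  "mean n = walk_exp n None L"

text \<open>Splitting the word costs \<open>B\<close>, and forgetting the letter before its second
  part costs \<open>6 * B\<close>.\<close>

lemma mean_quasi_additive: "\<bar>mean (m + n) - mean m - mean n\<bar> \<le> 7 * B"
proof -
  have "\<bar>walk_exp n (tip None w) (\<lambda>v. L (w @ v)) - (mean n + L w)\<bar> \<le> 7 * B"
    if w: "w \<in> walk_words m None" for w
  proof -
    have val: "valid (tip None w)" using valid_tip[OF _ w] by simp
    have red: "reduced w" "set w \<subseteq> letters N" using w by (auto simp: walk_words_None_iff)
    have "\<bar>walk_exp n (tip None w) (\<lambda>v. L (w @ v)) - walk_exp n (tip None w) (\<lambda>v. L w + L v)\<bar> \<le> B"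
    proof (rule walk_exp_close[OF val])
      fix v assume "v \<in> walk_words n (tip None w)"
      then show "\<bar>L (w @ v) - (L w + L v)\<bar> \<le> B"
        using quasi[OF append_walk_words[OF red]] by (simp add: diff_diff_eq)
    qed
    moreover have "\<bar>walk_exp n (tip None w) L - mean n\<bar> \<le> 6 * B"
      unfolding mean_def using val by (intro walk_exp_L_osc) auto
    ultimately show ?thesis using val by (simp add: walk_exp_add_const)
  qed
  then have "\<bar>walk_exp m None (\<lambda>w. walk_exp n (tip None w) (\<lambda>v. L (w @ v))) - walk_exp m None (\<lambda>w. mean n + L w)\<bar> \<le> 7 * B"
    by (intro walk_exp_close) auto
  moreover have "walk_exp m None (\<lambda>w. mean n + L w) = mean n + mean m"
    by (simp add: walk_exp_add_const mean_def)
  ultimately show ?thesis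
    unfolding mean_def[of "m + n"] walk_exp_append[of m n] by (simp add: algebra_simps)
qed

text \<open>The Doob martingale of \<open>L\<close>: the expectation of \<open>L\<close> on words of
  length \<open>length u + n\<close>, given the beginning \<open>u\<close>.\<close>

definition cond_mean :: "nat \<Rightarrow> word \<Rightarrow> real" where
  "cond_mean n u = walk_exp n (tip None u) (\<lambda>w. L (u @ w))"

lemma tip_snoc [simp]: "tip x (u @ [y]) = Some y"
  by (simp add: tip_def)

lemma cond_mean_Suc: "cond_mean (Suc n) u = avg (tip None u) (\<lambda>y. cond_mean n (u @ [y]))"
  by (simp add: cond_mean_def)

lemma cond_mean_close:
  assumes "reduced (u @ [y])" "set (u @ [y]) \<subseteq> letters N"
  shows "\<bar>cond_mean n (u @ [y]) - (L u + first_exp n y)\<bar> \<le> B"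
proof -
  have y: "valid (Some y)" using assms by simp
  have "\<bar>walk_exp n (Some y) (\<lambda>w. L (u @ y # w)) - walk_exp n (Some y) (\<lambda>w. L u + L (y # w))\<bar> \<le> B"
  proof (rule walk_exp_close[OF y])
    fix w assume "w \<in> walk_words n (Some y)"
    then have "reduced ((u @ [y]) @ w)" "set ((u @ [y]) @ w) \<subseteq> letters N"
      using append_walk_words[OF assms, of w n] by simp_all
    then show "\<bar>L (u @ y # w) - (L u + L (y # w))\<bar> \<le> B"
      using quasi[of u "y # w"] by (simp add: diff_diff_eq)
  qed
  then show ?thesis using y by (simp add: cond_mean_def first_exp_def walk_exp_add_const)
qed

text \<open>An Azuma-type bound for the martingale \<open>cond_mean\<close>, whose increments are at
  most \<open>8 * B\<close>. In \<open>1 + x + x^2\<close>, which bounds the exponential, the linear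
  term averages to zero, so each step contributes one factor
  \<open>1 + c \<le> exp c\<close>.\<close>

lemma exp_moment:
  assumes "\<bar>\<theta>\<bar> * (8 * B) \<le> 1" "reduced u" "set u \<subseteq> letters N"
  shows "walk_exp n (tip None u) (\<lambda>w. exp (\<theta> * (L (u @ w) - cond_mean n u))) \<le> exp (n * (\<theta> * (8 * B))\<^sup>2)"
  using assms(2,3)
proof (induction n arbitrary: u)
  case 0
  then show ?case by (simp add: cond_mean_def)
next
  case (Suc n)
  let ?x = "tip None u"
  let ?d = "\<lambda>y. cond_mean n (u @ [y]) - cond_mean (Suc n) u"
  let ?c = "(\<theta> * (8 * B))\<^sup>2"
  have val: "valid ?x" using Suc.prems by (auto simp: tip_def)
  have uy: "reduced (u @ [y])" "set (u @ [y]) \<subseteq> letters N" if "y \<in> succs ?x" for y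
    using append_walk_words[OF Suc.prems, of "[y]" 1] that by auto
  \<comment> \<open>Two values of \<open>cond_mean\<close> differ by at most \<open>6 * B\<close>
    for \<open>first_exp\<close> and twice \<open>B\<close> from
    \<open>cond_mean_close\<close>.\<close>
  have d: "\<bar>?d y\<bar> \<le> 8 * B" if y: "y \<in> succs ?x" for y
  proof -
    have "\<bar>cond_mean n (u @ [y']) - cond_mean n (u @ [y])\<bar> \<le> 8 * B" if y': "y' \<in> succs ?x" for y'
    proof -
      have "\<bar>first_exp n y - first_exp n y'\<bar> \<le> 6 * B"
        using y y' succs_subset[of ?x] by (intro first_exp_osc) blast+
      then show ?thesis
        using cond_mean_close[OF uy[OF y], of n] cond_mean_close[OF uy[OF y'], of n]
        unfolding abs_le_iff by linarith
    qed
    then show ?thesis unfolding cond_mean_Suc using avg_close[OF val] by (simp add: abs_minus_commute)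
  qed
  have "walk_exp (Suc n) ?x (\<lambda>w. exp (\<theta> * (L (u @ w) - cond_mean (Suc n) u))) =
      avg ?x (\<lambda>y. walk_exp n (Some y) (\<lambda>w. exp (\<theta> * ?d y) * exp (\<theta> * (L ((u @ [y]) @ w) - cond_mean n (u @ [y])))))"
    by (simp add: exp_add[symmetric] algebra_simps)
  also have "\<dots> \<le> avg ?x (\<lambda>y. exp (n * ?c) * (1 + \<theta> * ?d y + ?c))"
  proof (rule avg_mono)
    fix y assume y: "y \<in> succs ?x"
    have IH: "walk_exp n (Some y) (\<lambda>w. exp (\<theta> * (L ((u @ [y]) @ w) - cond_mean n (u @ [y])))) \<le> exp (n * ?c)"
      using Suc.IH[OF uy[OF y]] by simp
    have le: "\<bar>\<theta> * ?d y\<bar> \<le> \<bar>\<theta>\<bar> * (8 * B)"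
      unfolding abs_mult using d[OF y] by (intro mult_left_mono) auto
    then have "\<bar>\<theta> * ?d y\<bar> \<le> \<bar>\<theta> * (8 * B)\<bar>" using B_nonneg by (simp only: abs_mult)
    then have "(\<theta> * ?d y)\<^sup>2 \<le> ?c" by (simp only: abs_le_square_iff)
    moreover have "exp (\<theta> * ?d y) \<le> 1 + \<theta> * ?d y + (\<theta> * ?d y)\<^sup>2"
      using le assms(1) by (intro exp_le_quadratic) linarith
    ultimately have "exp (\<theta> * ?d y) \<le> 1 + \<theta> * ?d y + ?c" by linarith
    then have "exp (\<theta> * ?d y) * walk_exp n (Some y) (\<lambda>w. exp (\<theta> * (L ((u @ [y]) @ w) - cond_mean n (u @ [y])))) \<le>
        (1 + \<theta> * ?d y + ?c) * exp (n * ?c)"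
      using IH valid_Some_succs[OF y]
      by (intro mult_mono walk_exp_nonneg) (auto intro: order_trans[OF exp_ge_zero])
    then show "walk_exp n (Some y) (\<lambda>w. exp (\<theta> * ?d y) * exp (\<theta> * (L ((u @ [y]) @ w) - cond_mean n (u @ [y])))) \<le>
        exp (n * ?c) * (1 + \<theta> * ?d y + ?c)"
      unfolding walk_exp_cmult by (simp add: mult.commute)
  qed
  also have "\<dots> = exp (n * ?c) * (1 + ?c)"
  proof -
    have "avg ?x ?d = 0"
      using avg_add[of ?x "\<lambda>y. cond_mean n (u @ [y])" "\<lambda>_. - cond_mean (Suc n) u"] val
      by (simp add: avg_const cond_mean_Suc)
    moreover have "avg ?x (\<lambda>y. 1 + \<theta> * ?d y + ?c) = 1 + \<theta> * avg ?x ?d + ?c"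
      using val by (simp only: avg_add avg_cmult avg_const)
    ultimately show ?thesis by (simp only: avg_cmult) simp
  qed
  also have "\<dots> \<le> exp (n * ?c) * exp ?c"
    using exp_ge_add_one_self[of ?c] by (intro mult_left_mono) auto
  also have "\<dots> = exp (Suc n * ?c)" by (simp add: exp_add[symmetric] algebra_simps)
  finally show ?case .
qed

text \<open>The Chernoff bound, with the exponential moments of both signs of the parameter covering
  both tails.\<close>

lemma deviation:
  assumes "\<theta> \<ge> 0" "\<theta> * (8 * B) \<le> 1"
  shows "walk_exp n None (\<lambda>w. if \<bar>L w - mean n\<bar> \<ge> e * n then 1 else 0) \<le>
    2 * exp (n * (\<theta> * (8 * B))\<^sup>2 - \<theta> * e * n)"
proof -
  have eq: "cond_mean n [] = mean n" "tip None [] = None" by (simp_all add: cond_mean_def mean_def tip_def)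
  let ?X = "\<lambda>\<theta> w. exp (\<theta> * (L w - mean n))"
  have m: "walk_exp n None (?X \<theta>') \<le> exp (n * (\<theta> * (8 * B))\<^sup>2)" if "\<bar>\<theta>'\<bar> = \<theta>" for \<theta>'
  proof -
    have "walk_exp n None (?X \<theta>') \<le> exp (n * (\<theta>' * (8 * B))\<^sup>2)"
      using exp_moment[of \<theta>' "[]" n] that assms(2) eq by simp
    also have "(\<theta>' * (8 * B))\<^sup>2 = (\<theta> * (8 * B))\<^sup>2" unfolding that[symmetric] by (simp add: power_mult_distrib)
    finally show ?thesis .
  qed
  have "walk_exp n None (\<lambda>w. if \<bar>L w - mean n\<bar> \<ge> e * n then 1 else 0) \<le>
      walk_exp n None (\<lambda>w. exp (- (\<theta> * e * n)) * (?X \<theta> w + ?X (- \<theta>) w))"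
  proof (rule walk_exp_mono)
    fix w
    have "1 \<le> exp (- (\<theta> * e * n)) * (?X \<theta> w + ?X (- \<theta>) w)" if dev: "\<bar>L w - mean n\<bar> \<ge> e * n"
    proof -
      have "\<theta> * (e * n) \<le> \<theta> * \<bar>L w - mean n\<bar>" using dev assms(1) by (rule mult_left_mono)
      then have "exp (\<theta> * e * n) \<le> exp (\<theta> * \<bar>L w - mean n\<bar>)" by (simp add: mult.assoc)
      also have "\<dots> \<le> ?X \<theta> w + ?X (- \<theta>) w" by (cases "L w \<ge> mean n") (auto simp: algebra_simps)
      finally show ?thesis by (simp add: exp_minus field_simps)
    qed
    then show "(if \<bar>L w - mean n\<bar> \<ge> e * n then 1 else 0) \<le> exp (- (\<theta> * e * n)) * (?X \<theta> w + ?X (- \<theta>) w)"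
      by (auto intro!: mult_nonneg_nonneg add_nonneg_nonneg)
  qed
  also have "\<dots> = exp (- (\<theta> * e * n)) * (walk_exp n None (?X \<theta>) + walk_exp n None (?X (- \<theta>)))"
    by (simp only: walk_exp_cmult walk_exp_add)
  also have "\<dots> \<le> exp (- (\<theta> * e * n)) * (2 * exp (n * (\<theta> * (8 * B))\<^sup>2))"
    using m[of \<theta>] m[of "- \<theta>"] assms(1) by (intro mult_left_mono) auto
  also have "\<dots> = 2 * exp (n * (\<theta> * (8 * B))\<^sup>2 - \<theta> * e * n)"
    by (simp add: exp_diff exp_minus field_simps)
  finally show ?thesis .
qed

text \<open>Deviations from \<open>mean n\<close> have summable probability, and
  \<open>mean n\<close> is linear up to a constant by quasi-additivity. The error in the second
  conclusion does not depend on \<open>n\<close>, so long words yield sharp bounds on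
  \<open>l\<close>.\<close>

theorem law_of_large_numbers:
  obtains l :: real where "AE y in nbrw_measure N. (\<lambda>n. L (prefix_word y n) / n) \<longlonglongrightarrow> l"
    and "\<And>n. \<bar>walk_exp n None L - n * l\<bar> \<le> 7 * B"
proof -
  obtain l :: real where l: "\<And>n. \<bar>mean n - n * l\<bar> \<le> 7 * B"
    using quasi_additive_sequence[of mean "7 * B"] mean_quasi_additive by blast
  have ev: "AE y in nbrw_measure N. \<forall>\<^sub>F n in sequentially. \<not> (\<bar>L (prefix_word y n) - mean n\<bar> \<ge> e * n)"
    if e: "e > 0" for e :: real
  proof -
    \<comment> \<open>Adding 1 keeps the divisor positive when \<open>B = 0\<close>.\<close>
    define D where "D = 8 * B + 1"
    have D: "D \<ge> 1" "8 * B \<le> D" using B_nonneg by (simp_all add: D_def)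
    \<comment> \<open>The first bound makes \<open>deviation\<close> applicable; the second makes
      the quadratic term of the exponent at most half of the linear one.\<close>
    define \<theta> where "\<theta> = min (1 / D) (e / (2 * D\<^sup>2))"
    have \<theta>: "\<theta> > 0" using e D by (simp add: \<theta>_def)
    have "\<theta> \<le> 1 / D" by (simp add: \<theta>_def)
    then have "\<theta> * D \<le> 1" using D by (simp add: field_simps)
    moreover have "\<theta> * (8 * B) \<le> \<theta> * D" using D \<theta> by (intro mult_left_mono) auto
    ultimately have 1: "\<theta> * (8 * B) \<le> 1" by linarith
    have "(8 * B)\<^sup>2 \<le> D\<^sup>2" using D B_nonneg by (intro power_mono) auto
    then have "\<theta> * (8 * B)\<^sup>2 \<le> \<theta> * D\<^sup>2" using \<theta> by (intro mult_left_mono) auto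
    also have "\<theta> * D\<^sup>2 \<le> e / (2 * D\<^sup>2) * D\<^sup>2" by (intro mult_right_mono) (auto simp: \<theta>_def)
    also have "\<dots> = e / 2" using D by simp
    finally have 2: "\<theta> * (8 * B)\<^sup>2 \<le> e / 2" .
    have "\<theta> * (\<theta> * (8 * B)\<^sup>2) \<le> \<theta> * (e / 2)" using 2 \<theta> by (intro mult_left_mono) auto
    then have 3: "(\<theta> * (8 * B))\<^sup>2 - \<theta> * e \<le> - (\<theta> * e / 2)"
      by (simp add: power2_eq_square algebra_simps)
    show ?thesis
    proof (rule AE_eventually_not[where c = 2])
      show "0 \<le> exp (- (\<theta> * e / 2))" "exp (- (\<theta> * e / 2)) < 1" using \<theta> e by auto
      fix n :: nat assume "n \<ge> 1"
      have "walk_exp n None (\<lambda>w. if \<bar>L w - mean n\<bar> \<ge> e * n then 1 else 0) \<le>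
          2 * exp (n * (\<theta> * (8 * B))\<^sup>2 - \<theta> * e * n)"
        using \<theta> 1 by (intro deviation) auto
      also have "\<dots> \<le> 2 * exp (n * (- (\<theta> * e / 2)))"
        using mult_left_mono[OF 3, of "real n"] by (simp add: algebra_simps)
      also have "\<dots> = 2 * exp (- (\<theta> * e / 2)) ^ n" by (simp only: exp_of_nat_mult)
      finally show "walk_exp n None (\<lambda>w. if \<bar>L w - mean n\<bar> \<ge> e * n then 1 else 0) \<le> 2 * exp (- (\<theta> * e / 2)) ^ n" .
    qed
  qed
  have "AE y in nbrw_measure N. \<forall>j::nat. \<forall>\<^sub>F n in sequentially.
      \<not> (\<bar>L (prefix_word y n) - mean n\<bar> \<ge> 1 / Suc j * n)"
    by (subst AE_all_countable) (intro allI ev, simp)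
  then have "AE y in nbrw_measure N. (\<lambda>n. L (prefix_word y n) / n) \<longlonglongrightarrow> l"
  proof eventually_elim
    case (elim y)
    show ?case
    proof (rule LIMSEQ_I)
      fix r :: real assume r: "r > 0"
      obtain j where j: "1 / real (Suc j) < r / 2"
        using reals_Archimedean[of "r / 2"] r by (auto simp: inverse_eq_divide)
      have "\<forall>\<^sub>F n in sequentially. 7 * B / real n < r / 2"
        using order_tendstoD(2)[OF lim_const_over_n[of "7 * B"], of "r / 2"] r by simp
      then have "\<forall>\<^sub>F n in sequentially. norm (L (prefix_word y n) / n - l) < r"
        using elim[rule_format, of j] eventually_ge_at_top[of 1]
      proof eventually_elim
        case (elim n)
        have "\<bar>L (prefix_word y n) - n * l\<bar> < 1 / Suc j * n + 7 * B" using elim l[of n] by linarith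
        then have "\<bar>L (prefix_word y n) - n * l\<bar> / n < (1 / Suc j * n + 7 * B) / n"
          using elim by (intro divide_strict_right_mono) auto
        also have "\<dots> = 1 / Suc j + 7 * B / n" using elim by (simp add: field_simps)
        also have "\<dots> < r" using elim j by linarith
        finally have "\<bar>L (prefix_word y n) - n * l\<bar> / n < r" .
        moreover have "L (prefix_word y n) / n - l = (L (prefix_word y n) - n * l) / n"
          using elim by (simp add: field_simps)
        ultimately show ?case by (simp add: abs_divide)
      qed
      then show "\<exists>no. \<forall>n\<ge>no. norm (L (prefix_word y n) / n - l) < r"
        by (simp add: eventually_sequentially)
    qed
  qed
  then show ?thesis using that l by (simp add: mean_def)
qed

end

section \<open>Representatives of outer automorphisms\<close>

lemma free_automorphism_auto:
  assumes f: "f \<in> auto (free_group N)"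
  shows "free_automorphism N (\<lambda>a. f [a])"
    and "\<And>w. w \<in> carrier (free_group N) \<Longrightarrow> letter_hom (\<lambda>a. f [a]) w = f w"
proof -
  let ?G = "free_group N" and ?F = "letter_hom (\<lambda>a. f [a])"
  interpret group ?G by (rule group_free_group)
  have hom: "f \<in> hom ?G ?G" and bij: "bij_betw f (carrier ?G) (carrier ?G)"
    using f by (auto simp: auto_def Bij_def)
  interpret f: group_hom ?G ?G f
    by (rule group_hom.intro[OF group_free_group group_free_group]) (simp add: group_hom_axioms_def hom)
  have letter: "[a] \<in> carrier ?G" if "a \<in> letters N" for a using that by (simp add: free_group_def)
  have car: "w \<in> carrier ?G \<longleftrightarrow> reduced w \<and> set w \<subseteq> letters N" for w by (simp add: free_group_def)
  show Ff: "?F w = f w" if "w \<in> carrier ?G" for w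
    using that
  proof (induction w)
    case Nil
    then show ?case using f.hom_one by (simp add: free_group_def)
  next
    case (Cons a w)
    then have aw: "[a] \<in> carrier ?G" "w \<in> carrier ?G" by (auto simp: free_group_def reduced_Cons)
    have "a # w = [a] \<otimes>\<^bsub>?G\<^esub> w"
      using Cons.prems by (simp add: free_group_def free_reduce_id)
    then have "f (a # w) = f [a] \<otimes>\<^bsub>?G\<^esub> f w" using f.hom_mult[OF aw] by simp
    then have "f (a # w) = free_reduce (f [a] @ f w)" by (simp add: free_group_def)
    moreover have "?F (a # w) = free_reduce (f [a] @ ?F w)"
      by (simp add: letter_hom_def free_reduce_append_right)
    ultimately show ?case using Cons.IH[OF aw(2)] by simp
  qed
  show "free_automorphism N (\<lambda>a. f [a])"
  proof
    fix x assume x: "x \<in> letters N"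
    have fx: "f [x] \<in> carrier ?G" using letter[OF x] by simp
    then show "set (f [x]) \<subseteq> letters N" "reduced (f [x])" by (simp_all add: car)
    have "[inv_letter x] = inv\<^bsub>?G\<^esub> [x]"
      using inv_free_group[OF letter[OF x]] by (simp add: inv_word_def free_reduce_def)
    then have "f [inv_letter x] = inv\<^bsub>?G\<^esub> (f [x])" using letter[OF x] by simp
    also have "\<dots> = inv_word (f [x])"
      using inv_free_group[OF fx] fx by (simp add: car free_reduce_id)
    finally show "f [inv_letter x] = inv_word (f [x])" .
  next
    fix w assume w: "reduced w" "set w \<subseteq> letters N" "?F w = []"
    then have "f w = \<one>\<^bsub>?G\<^esub>" using Ff[of w] by (simp add: car) (simp add: free_group_def)
    then have "f w = f \<one>\<^bsub>?G\<^esub>" by simp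
    then have "w = \<one>\<^bsub>?G\<^esub>"
      using inj_onD[OF bij_betw_imp_inj_on[OF bij]] w(1,2) one_closed unfolding car by blast
    then show "w = []" by (simp add: free_group_def)
  next
    fix p assume "reduced p" "set p \<subseteq> letters N"
    then obtain w where "w \<in> carrier ?G" "f w = p"
      using bij_betw_imp_surj_on[OF bij] by (metis car imageE)
    then show "\<exists>w. reduced w \<and> set w \<subseteq> letters N \<and> ?F w = p" using Ff car by blast
  qed
qed

lemma Out_subset_auto:
  assumes "\<Phi> \<in> carrier (Out (free_group N))"
  shows "\<Phi> \<subseteq> auto (free_group N)" "\<Phi> \<noteq> {}"
proof -
  let ?A = "AutoGroup (free_group N)"
  have sub: "subgroup (Inn (free_group N)) ?A"
    using Inn_normal[OF group_free_group] by (rule normal_imp_subgroup)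
  have A: "group ?A" using group_free_group by (rule group.AutoGroup)
  have R: "\<Phi> \<in> rcosets\<^bsub>?A\<^esub> Inn (free_group N)"
    using assms by (simp add: Out_def FactGroup_def)
  show "\<Phi> \<subseteq> auto (free_group N)"
    using subgroup.rcosets_carrier[OF sub A R] by (simp add: AutoGroup_def)
  show "\<Phi> \<noteq> {}"
    using subgroup.rcosets_non_empty[OF sub R] .
qed

lemma Out_conj_closed:
  assumes "\<Phi> \<in> carrier (Out (free_group N))" "f \<in> \<Phi>" "x \<in> carrier (free_group N)"
  obtains f' where "f' \<in> \<Phi>" "\<And>w. w \<in> carrier (free_group N) \<Longrightarrow> f' w = free_reduce (x @ f w @ inv_word x)"
proof -
  let ?G = "free_group N"
  interpret group ?G by (rule group_free_group)
  obtain f0 where f0: "f0 \<in> auto ?G" and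
    \<Phi>: "\<Phi> = (\<lambda>g. \<lambda>w\<in>carrier ?G. g \<otimes>\<^bsub>?G\<^esub> f0 w \<otimes>\<^bsub>?G\<^esub> inv\<^bsub>?G\<^esub> g) ` carrier ?G"
    using assms(1) mem_Out_iff[OF group_free_group] by blast
  then obtain g where g: "g \<in> carrier ?G" and f: "f = (\<lambda>w\<in>carrier ?G. g \<otimes>\<^bsub>?G\<^esub> f0 w \<otimes>\<^bsub>?G\<^esub> inv\<^bsub>?G\<^esub> g)"
    using assms(2) by auto
  have f0c: "f0 w \<in> carrier ?G" if "w \<in> carrier ?G" for w using f0 that by (auto simp: auto_def hom_def)
  let ?f = "\<lambda>w\<in>carrier ?G. (x \<otimes>\<^bsub>?G\<^esub> g) \<otimes>\<^bsub>?G\<^esub> f0 w \<otimes>\<^bsub>?G\<^esub> inv\<^bsub>?G\<^esub> (x \<otimes>\<^bsub>?G\<^esub> g)"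
  show ?thesis
  proof (rule that)
    show "?f \<in> \<Phi>" unfolding \<Phi> using assms(3) g by (intro imageI) simp
    fix w assume w: "w \<in> carrier ?G"
    have "?f w = x \<otimes>\<^bsub>?G\<^esub> f w \<otimes>\<^bsub>?G\<^esub> inv\<^bsub>?G\<^esub> x"
      using conj_comp[OF group_free_group assms(3) g f0c[OF w]] w f by simp
    also have "\<dots> = free_reduce (x @ f w @ inv_word x)"
      unfolding inv_free_group[OF assms(3)]
      using free_reduce_append_right[of "x @ f w" "inv_word x"]
      by (simp add: free_group_def free_reduce_append_left)
    finally show "?f w = free_reduce (x @ f w @ inv_word x)" .
  qed
qed

text \<open>Among the representatives choose one that minimizes the total length of the images of the
  basis.  Conjugation by a letter \<open>x\<close> does not shorten it, so at most half of the \<open>2 N\<close> ends of the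
  images are equal to \<open>x\<close>.  If the longest image is not cyclically reduced, both its ends are equal to some \<open>x\<close>;
  then no end of some other image is, and the product of the two is cyclically reduced.\<close>

lemma exists_good_representative:
  assumes N: "N \<ge> 1" and \<Phi>: "\<Phi> \<in> carrier (Out (free_group N))"
  obtains f v where "f \<in> \<Phi>" "set v \<subseteq> letters N" "\<forall>a\<in>set v. snd a" "length v \<in> {1, 2}"
    "f v \<noteq> []" "hd (f v) \<noteq> inv_letter (last (f v))"
    "\<And>a. a \<in> letters N \<Longrightarrow> length (f [a]) \<le> length (f v)"
proof -
  let ?G = "free_group N"
  define S where "S f = (\<Sum>i<N. length (f [(i, True)]))" for f :: "word \<Rightarrow> word"
  obtain f where f: "f \<in> \<Phi>" and fmin: "\<And>h. h \<in> \<Phi> \<Longrightarrow> S f \<le> S h"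
    using Out_subset_auto(2)[OF \<Phi>] ex_has_least_nat[of "\<lambda>f. f \<in> \<Phi>" _ S] by blast
  have auto: "f \<in> auto ?G" using f Out_subset_auto[OF \<Phi>] by blast
  interpret free_automorphism N "\<lambda>a. f [a]" by (rule free_automorphism_auto(1)[OF auto])
  note Ff = free_automorphism_auto(2)[OF auto]
  define w where "w i = f [(i, True)]" for i
  have pos: "(i, True) \<in> letters N" "[(i, True)] \<in> carrier ?G" if "i < N" for i
    using that by (auto simp: letters_def free_group_def)
  have w: "reduced (w i)" "set (w i) \<subseteq> letters N" "w i \<noteq> []" if "i < N" for i
  proof -
    show "reduced (w i)" "set (w i) \<subseteq> letters N"
      using reduced_image image_letters pos(1)[OF that] by (auto simp: w_def)
    show "w i \<noteq> []"
      using letter_hom_eq_Nil[of "[(i, True)]"] Ff[OF pos(2)[OF that]] pos(1)[OF that] by (auto simp: w_def)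
  qed
  have len: "length (f [a]) = length (w (fst a))" if "a \<in> letters N" for a
    using image_inv_letter[of "(fst a, True)"] that pos(1)[of "fst a"]
    by (cases a; cases "snd a") (auto simp: w_def inv_letter_def letters_def)
  have "finite (length ` w ` {..<N})" "length ` w ` {..<N} \<noteq> {}" using N by (auto simp: lessThan_empty_iff)
  then have "Max (length ` w ` {..<N}) \<in> length ` w ` {..<N}" by (rule Max_in)
  then obtain i where i: "i < N" "\<And>j. j < N \<Longrightarrow> length (w j) \<le> length (w i)"
    by (auto simp: image_iff) (metis Max_ge \<open>finite (length ` w ` {..<N})\<close> imageI lessThan_iff)
  have le: "length (f [a]) \<le> length (w i)" if "a \<in> letters N" for a
    using len[OF that] i(2)[of "fst a"] that by (auto simp: letters_def)
  show ?thesis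
  proof (cases "hd (w i) = inv_letter (last (w i))")
    case False
    then show ?thesis
      using that[OF f, of "[(i, True)]"] pos[OF i(1)] w[OF i(1)] le by (simp add: w_def)
  next
    case True
    define x where "x = hd (w i)"
    \<comment> \<open>The number of ends of \<open>w j\<close> equal to \<open>x\<close>, that is,
      of first letters of \<open>w j\<close> and of its inverse.\<close>
    define e where "e j = of_bool (hd (w j) = x) + (of_bool (last (w j) = inv_letter x) :: nat)" for j
    have xl: "x \<in> letters N" using w[OF i(1)] by (auto simp: x_def)
    then have "[inv_letter x] \<in> carrier ?G" by (simp add: free_group_def)
    then obtain f' where f': "f' \<in> \<Phi>"
      "\<And>u. u \<in> carrier ?G \<Longrightarrow> f' u = free_reduce ([inv_letter x] @ f u @ inv_word [inv_letter x])"
      using Out_conj_closed[OF \<Phi> f] by blast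
    have "length (f' [(j, True)]) + 2 * e j \<le> length (w j) + 2" if "j < N" for j
      using length_conj_letter[OF w(1,3)[OF that], of x] f'(2)[OF pos(2)[OF that]]
      by (simp add: w_def e_def inv_word_def)
    then have "(\<Sum>j<N. length (f' [(j, True)]) + 2 * e j) \<le> (\<Sum>j<N. length (w j) + 2)"
      by (intro sum_mono) auto
    moreover have "(\<Sum>j<N. length (w j)) \<le> (\<Sum>j<N. length (f' [(j, True)]))"
      using fmin[OF f'(1)] by (simp add: S_def w_def)
    moreover have "(\<Sum>j<N. length (f' [(j, True)]) + 2 * e j) = (\<Sum>j<N. length (f' [(j, True)])) + 2 * (\<Sum>j<N. e j)"
      by (simp add: sum.distrib sum_distrib_left)
    moreover have "(\<Sum>j<N. length (w j) + 2) = (\<Sum>j<N. length (w j)) + 2 * N"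
      by (simp only: sum.distrib) simp
    ultimately have sum: "(\<Sum>j<N. e j) \<le> N" by linarith
    have ei: "e i = 2" using True by (simp add: e_def x_def)
    \<comment> \<open>The \<open>e j\<close> are at most 1 on average while
      \<open>e i = 2\<close>.\<close>
    have "\<exists>j<N. e j = 0"
    proof (rule ccontr)
      assume "\<not> (\<exists>j<N. e j = 0)"
      then have ge: "\<And>j. j < N \<Longrightarrow> 1 \<le> e j" by (metis One_nat_def Suc_leI neq0_conv)
      have "(\<Sum>j<N. 1) < (\<Sum>j<N. e j)"
        using i(1) ei ge by (intro sum_strict_mono_ex1) (auto intro!: bexI[of _ i])
      then show False using sum by simp
    qed
    then obtain j where j: "j < N" "hd (w j) \<noteq> x" "last (w j) \<noteq> inv_letter x"
      by (auto simp: e_def split: if_splits)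
    have ij: "[(i, True), (j, True)] \<in> carrier ?G"
      using pos[OF i(1)] pos[OF j(1)] by (simp add: free_group_def inv_letter_def)
    have lasti: "last (w i) = inv_letter x" using True by (simp add: x_def)
    then have red: "reduced (w i @ w j)" using w i(1) j by (auto simp: reduced_append)
    have "f [(i, True), (j, True)] = free_reduce (w i @ w j)"
      using Ff[OF ij] by (simp add: letter_hom_def w_def)
    then have fv: "f [(i, True), (j, True)] = w i @ w j" using red by (simp add: free_reduce_id)
    have "hd (w i @ w j) \<noteq> inv_letter (last (w i @ w j))"
      using w(3)[OF i(1)] w(3)[OF j(1)] j(3) by (metis hd_append2 inv_letter_inv_letter last_appendR x_def)
    then show ?thesis
      using that[OF f, of "[(i, True), (j, True)]"] fv pos[OF i(1)] pos[OF j(1)] w(3)[OF i(1)] le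
      by (auto intro: trans_le_add1)
  qed
qed

section \<open>Comparison of the stretching factors\<close>

context free_automorphism
begin

text \<open>The image of a good block outweighs the cancellation at its two ends; all letters
  between consecutive good blocks are treated as a single factor.\<close>

lemma length_F_block_count:
  assumes g: "length (F g) \<ge> 4 * card points + K" and w: "walk N"
    and "length w = q * Suc (length g)" "reduced (u @ w)" "set (u @ w) \<subseteq> letters N"
  shows "real (length (F (u @ w))) \<ge> K * walk.block_count g q w"
  using assms(3-)
proof (induction q arbitrary: u w)
  case 0
  interpret walk N by fact
  show ?case by simp
next
  case (Suc q)
  interpret walk N by fact
  let ?b = "take (Suc (length g)) w" and ?v = "drop (Suc (length g)) w"
  have len: "length ?v = q * Suc (length g)" "length ?b = Suc (length g)" using Suc.prems(1) by auto
  have eq: "u @ w = (u @ ?b) @ ?v" by simp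
  have uv: "reduced ((u @ ?b) @ ?v)" "set ((u @ ?b) @ ?v) \<subseteq> letters N" using Suc.prems by simp_all
  \<comment> \<open>A bad block is absorbed into \<open>u\<close>; behind a good block the induction
    restarts with the empty prefix.\<close>
  show ?case
  proof (cases "take (length g) (tl w) = g")
    case False
    then show ?thesis using Suc.IH[OF len(1) uv] unfolding eq[symmetric] by simp
  next
    case True
    then have b: "?b = [hd w] @ g" using len(2) by (cases w) auto
    let ?x = "u @ [hd w]"
    have bv: "(u @ ?b) @ ?v = ?x @ g @ ?v" unfolding b by (simp only: append.assoc)
    have uw: "u @ w = ?x @ g @ ?v" using eq bv by (rule trans)
    have all: "reduced (?x @ g @ ?v)" "set (?x @ g @ ?v) \<subseteq> letters N"
      using uv unfolding bv by blast+
    then have gv: "reduced (g @ ?v)" "set (g @ ?v) \<subseteq> letters N" "reduced ?v" "set ?v \<subseteq> letters N"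
      unfolding reduced_append set_append by blast+
    \<comment> \<open>The two cuts around \<open>g\<close> cost at most
      \<open>4 * card points\<close>, which the image of \<open>g\<close> pays for with
      \<open>K\<close> to spare.\<close>
    have "length (F ?x) + length (F (g @ ?v)) \<le> length (F (?x @ g @ ?v)) + 2 * card points"
      by (rule bounded_cancellation[OF all])
    moreover have "length (F g) + length (F ?v) \<le> length (F (g @ ?v)) + 2 * card points"
      by (rule bounded_cancellation[OF gv(1,2)])
    ultimately have "length (F (u @ w)) \<ge> K + length (F ?v)" unfolding uw using g by linarith
    moreover have "real (length (F ?v)) \<ge> K * block_count g q ?v"
      using Suc.IH[of ?v "[]"] len(1) gv by simp
    ultimately show ?thesis using True by (simp add: distrib_left)
  qed
qed

end

text \<open>The exponent \<open>16 N + 1\<close> makes the image of the power of \<open>v\<close> longer than \<open>4 C + K\<close>, where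
  \<open>K = length (f v)\<close> bounds the images of all letters and \<open>C \<le> 4 N K\<close> is the cancellation bound.\<close>

lemma generic_stretch_ge:
  assumes N: "N \<ge> 2" and \<Phi>: "\<Phi> \<in> carrier (Out (free_group N))"
  defines "m \<equiv> Suc (2 * (16 * N + 1))"
  shows "generic_stretch N \<Phi> / extremal_stretch N \<Phi> \<ge> (1 / (2 * real N)) ^ m / m"
proof -
  let ?G = "free_group N" and ?k = "16 * N + 1" and ?p = "(1 / (2 * real N)) ^ m"
  obtain f v where f: "f \<in> \<Phi>" and v: "set v \<subseteq> letters N" "\<forall>a\<in>set v. snd a" "length v \<in> {1, 2}"
    "f v \<noteq> []" "hd (f v) \<noteq> inv_letter (last (f v))" "\<And>a. a \<in> letters N \<Longrightarrow> length (f [a]) \<le> length (f v)"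
    using exists_good_representative[of N \<Phi>] N \<Phi> by (metis Suc_1 Suc_leD One_nat_def)
  have auto: "f \<in> auto ?G" using f Out_subset_auto[OF \<Phi>] by blast
  interpret free_automorphism N "\<lambda>a. f [a]" by (rule free_automorphism_auto(1)[OF auto])
  interpret walk N by standard (rule N)
  note Ff = free_automorphism_auto(2)[OF auto]
  have car: "w \<in> carrier ?G \<longleftrightarrow> reduced w \<and> set w \<subseteq> letters N" for w by (simp add: free_group_def)
  define K where "K = length (f v)"
  have K: "K \<ge> 1" "\<And>a. a \<in> letters N \<Longrightarrow> length (f [a]) \<le> K" using v by (auto simp: K_def Suc_le_eq)
  have vc: "v \<in> carrier ?G" "v \<noteq> []" using v reduced_positive by (auto simp: car)
  have fv: "F v = f v" "reduced (f v)" using Ff[OF vc(1)] reduced_letter_hom by metis+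
  have outer: "outer_length \<Phi> w = cyc_length (F w)" if "w \<in> carrier ?G" for w
    using outer_length_eq[OF \<Phi> f that] Ff[OF that] by simp
  have card: "card points \<le> 4 * N * K" by (rule card_points_le) (use K in auto)

  \<comment> \<open>With this exponent \<open>g\<close> has length \<open>2 * ?k\<close> whether
    \<open>v\<close> has one or two letters, so \<open>m\<close> depends on \<open>N\<close>
    alone.\<close>
  define r where "r = (if length v = 1 then 2 * ?k else ?k)"
  define g where "g = concat (replicate r v)"
  have lg: "length g = 2 * ?k" using v(3) by (auto simp: g_def length_concat_replicate r_def)
  have g: "set g \<subseteq> letters N" "reduced g"
    using v(1,2) by (auto simp: g_def intro!: reduced_positive split: if_splits)
  have "g \<noteq> []" using lg by auto
  have "F (concat (replicate n v)) = concat (replicate n (f v))" for n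
  proof (induction n)
    case (Suc n)
    have "F (concat (replicate (Suc n) v)) = free_reduce (concat (replicate (Suc n) (f v)))"
      using Suc fv(1) by (simp add: letter_hom_append)
    then show ?case using reduced_concat_replicate[OF fv(2) v(4,5)] by (metis free_reduce_id)
  qed simp
  then have "length (F g) = r * K" by (simp add: g_def length_concat_replicate K_def)
  moreover have "?k * K \<le> r * K" by (intro mult_right_mono) (simp_all add: r_def)
  moreover have "?k * K = 4 * (4 * N * K) + K" by (simp add: algebra_simps)
  ultimately have Fg: "length (F g) \<ge> 4 * card points + K" using card by linarith

  define B where "B = real (2 * card points + K)"
  interpret qa: quasi_additive N "\<lambda>w. real (length (F w))" B
  proof
    fix u w assume uw: "reduced (u @ w)" "set (u @ w) \<subseteq> letters N"
    have "length (F (u @ w)) \<le> length (F u) + length (F w)"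
      using length_free_reduce[of "F u @ F w"] by (simp add: letter_hom_append)
    then show "\<bar>real (length (F (u @ w))) - real (length (F u)) - real (length (F w))\<bar> \<le> B"
      using bounded_cancellation[OF uw] by (simp add: B_def abs_le_iff)
  next
    fix a assume "a \<in> letters N"
    then have "length (F [a]) \<le> K" using K(2)[of a] reduced_image[of a] by (simp add: letter_hom_def free_reduce_id)
    then show "\<bar>real (length (F [a]))\<bar> \<le> B" by (simp add: B_def)
  qed
  obtain l where lim: "AE y in nbrw_measure N. (\<lambda>n. real (length (F (prefix_word y n))) / n) \<longlonglongrightarrow> l"
    and l: "\<And>n. \<bar>walk_exp n None (\<lambda>w. real (length (F w))) - n * l\<bar> \<le> 7 * B"
    using qa.law_of_large_numbers by blast

  have "is_generic_stretch N \<Phi> l"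
    unfolding is_generic_stretch_def
    using lim AE_cyc_length AE_prefix_word
  proof eventually_elim
    case (elim y)
    let ?w = "prefix_word y"
    have w: "?w n \<in> carrier ?G" "length (?w n) = n" for n
      using elim(3) by (auto simp: walk_words_None_iff car)
    \<comment> \<open>The two lengths differ by a constant plus \<open>K\<close> times the loss of
      the prefix in cyclic reduction, which is o(n) by \<open>AE_cyc_length\<close>.\<close>
    have close: "norm (real (outer_length \<Phi> (?w n)) / n - real (length (F (?w n))) / n) \<le>
        2 * card points / n + K * (1 - cyc_length (?w n) / n)" if "n \<ge> 1" for n
    proof -
      have "\<bar>real (cyc_length (F (?w n))) - length (F (?w n))\<bar> \<le> 2 * card points + K * (real n - cyc_length (?w n))"
        using cyc_length_F_close(2)[of "?w n" K] w[of n] K(2) by (simp add: car)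
      then have "\<bar>real (cyc_length (F (?w n))) - length (F (?w n))\<bar> / n \<le> (2 * card points + K * (real n - cyc_length (?w n))) / n"
        by (rule divide_right_mono) simp
      then show ?thesis
        using that outer[OF w(1)] by (simp add: diff_divide_distrib[symmetric] add_divide_distrib field_simps)
    qed
    have "(\<lambda>n. 2 * card points / real n + K * (1 - cyc_length (?w n) / n)) \<longlonglongrightarrow> 0 + real K * (1 - 1)"
      by (intro tendsto_intros lim_const_over_n elim(2))
    then have "(\<lambda>n. 2 * card points / real n + K * (1 - cyc_length (?w n) / n)) \<longlonglongrightarrow> 0" by simp
    then have "(\<lambda>n. real (outer_length \<Phi> (?w n)) / n - real (length (F (?w n))) / n) \<longlonglongrightarrow> 0"
      by (rule Lim_null_comparison[rotated])
        (use close in \<open>auto intro: eventually_mono[OF eventually_ge_at_top[of 1]]\<close>)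
    from tendsto_add[OF this elim(1)]
    have 1: "(\<lambda>n. real (outer_length \<Phi> (?w n)) / n) \<longlonglongrightarrow> l" by simp
    have 2: "(\<lambda>n. (real (outer_length \<Phi> (?w n)) / n) / (cyc_length (?w n) / n)) \<longlonglongrightarrow> l / 1"
      by (intro tendsto_divide 1 elim(2)) simp
    have "\<forall>\<^sub>F n in sequentially. (real (outer_length \<Phi> (?w n)) / n) / (cyc_length (?w n) / n) =
        real (outer_length \<Phi> (?w n)) / cyc_length (?w n)"
      using eventually_ge_at_top[of 1] by eventually_elim simp
    from Lim_transform_eventually[OF 2 this]
    have "(\<lambda>n. real (outer_length \<Phi> (?w n)) / cyc_length (?w n)) \<longlonglongrightarrow> l" by simp
    with 1 show ?case by simp
  qed
  then have gen: "generic_stretch N \<Phi> = l"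
    unfolding generic_stretch_def using is_generic_stretch_unique by blast

  \<comment> \<open>In a word of \<open>q\<close> blocks of length \<open>m\<close>, the expected
    image length is at least \<open>K\<close> times the expected number of good blocks. The error
    \<open>7 * B\<close> does not grow with \<open>q\<close>, so a large \<open>q\<close> removes
    it.\<close>
  have "K * ?p \<le> m * l"
  proof (rule ccontr)
    assume "\<not> K * ?p \<le> m * l"
    then have "K * ?p - m * l > 0" by simp
    then obtain q :: nat where q: "7 * B < q * (K * ?p - m * l)"
      using reals_Archimedean3 by blast
    have "K * (q * ?p) \<le> K * walk_exp (q * m) None (block_count g q)"
      using walk_exp_block_count[of None g q] g \<open>g \<noteq> []\<close> lg by (intro mult_left_mono) (simp_all add: m_def)
    also have "\<dots> = walk_exp (q * m) None (\<lambda>w. K * block_count g q w)" by (simp only: walk_exp_cmult)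
    also have "\<dots> \<le> walk_exp (q * m) None (\<lambda>w. real (length (F w)))"
    proof (rule walk_exp_mono)
      fix w assume "w \<in> walk_words (q * m) None"
      then have "length w = q * Suc (length g)" "reduced ([] @ w)" "set ([] @ w) \<subseteq> letters N"
        using lg by (simp_all add: walk_words_None_iff m_def)
      from length_F_block_count[OF Fg walk_axioms this]
      show "K * block_count g q w \<le> real (length (F w))" by simp
    qed
    also have "\<dots> \<le> (q * m) * l + 7 * B" using l[of "q * m"] by (simp add: abs_le_iff)
    finally show False using q by (simp add: algebra_simps)
  qed
  moreover have m_pos: "real m > 0" by (simp add: m_def)
  ultimately have l_ge: "l \<ge> K * (?p / m)"
    unfolding times_divide_eq_right pos_divide_le_eq[OF m_pos] by (simp only: mult.commute)
  then have l_pos: "l \<ge> 0" by (intro order_trans[OF _ l_ge]) simp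

  let ?r = "\<lambda>w. real (outer_length \<Phi> w) / real (cyc_length w)"
  have vmem: "v \<in> carrier ?G - {\<one>\<^bsub>?G\<^esub>}" using vc by (simp add: free_group_def)
  have le: "extremal_stretch N \<Phi> \<le> K"
    unfolding extremal_stretch_def
  proof (rule cSUP_least)
    show "carrier ?G - {\<one>\<^bsub>?G\<^esub>} \<noteq> {}" using vmem by blast
    fix w assume "w \<in> carrier ?G - {\<one>\<^bsub>?G\<^esub>}"
    then have w: "w \<in> carrier ?G" by simp
    then have "cyc_length (F w) \<le> K * cyc_length w"
      using cyc_length_F_close(1)[of w K] K(2) by (simp add: car)
    then have "real (cyc_length (F w)) \<le> K * real (cyc_length w)" by (metis of_nat_le_iff of_nat_mult)
    then show "?r w \<le> K" using outer[OF w] by (cases "cyc_length w = 0") (simp_all add: divide_le_eq)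
  qed
  \<comment> \<open>The ratio at \<open>v\<close> is positive, hence so is the supremum, and it can
    be divided by.\<close>
  have "?r v \<le> extremal_stretch N \<Phi>"
    unfolding extremal_stretch_def
    using bdd_above_extremal_stretch[OF \<Phi>] vmem by (intro cSUP_upper) auto
  moreover have "?r v > 0"
  proof -
    have "cyc_length (f v) = K"
      using v(5) cyc_length_cyclically_reduced[of "f v"] by (metis K_def inv_letter_inv_letter)
    moreover have "last v \<noteq> inv_letter (hd v)"
      using v(2) vc(2) by (metis hd_in_set inv_letter_def last_in_set snd_conv)
    then have "cyc_length v > 0" using vc(2) by (simp add: cyc_length_cyclically_reduced)
    ultimately show ?thesis using outer[OF vc(1)] fv(1) K(1) by simp
  qed
  ultimately have pos: "extremal_stretch N \<Phi> > 0" by linarith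
  have "?p / m = K * (?p / m) / K" using K(1) by simp
  also have "\<dots> \<le> l / K" using l_ge by (intro divide_right_mono) auto
  also have "\<dots> \<le> l / extremal_stretch N \<Phi>" using l_pos le pos by (intro divide_left_mono) auto
  finally show ?thesis unfolding gen .
qed

theorem theorem1p6:
  fixes N :: nat
  assumes "N \<ge> 2"
  shows "rho N > 0"
proof -
  define m where "m = Suc (2 * (16 * N + 1))"
  \<comment> \<open>The identity class makes the index set nonempty, so a lower bound common to all
    ratios bounds the infimum.\<close>
  have "group (Out (free_group N))"
    unfolding Out_def using Inn_normal[OF group_free_group] by (rule normal.factorgroup_is_group)
  then have "carrier (Out (free_group N)) \<noteq> {}" using group.is_monoid monoid.one_closed by blast
  then have "(1 / (2 * real N)) ^ m / m \<le> rho N"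
    unfolding rho_def m_def using generic_stretch_ge[OF assms] by (intro cINF_greatest) auto
  moreover have "(1 / (2 * real N)) ^ m / m > 0" using assms by (simp add: m_def)
  ultimately show ?thesis by linarith
qed

end
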